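(* Let the random array $\{X_t(n)\}$, the filtration $\{\mathcal F_t\}$ and the sequence $\{\beta_n\}$ satisfy conditions HL0, HL1, HL2, HL3, HL4 and HL6 listed in the context, and let $f:\mathbb R\to\mathbb R$ be locally integrable. Suppose further that either $f$ is bounded, or all of the following (i)--(iii) hold: (i) there is a $\mathcal Y\subseteq\mathbb R$ such that $\int_{\mathbb R}|f(x+y)|\,\Phi_{X^+}(x)\,dx<\infty$ for all $y\in\mathcal Y$, and $\mathbf P(X^-\in\mathcal Y)=1$; (ii) $n^{-1}\sum_{t=1}^{t_0-1}f(\beta_n^{-1}X_t(n))=o_p(1)$, for $t_0$ as in HL3; (iii) for some $\lambda'\in(0,\lambda)$, where $\lambda$ is as in HL5, either (a) $|f(x)|=O(|x|^{\lambda'})$ as $|x|\to\infty$ and HL5(a) holds; or (b) $|f(x)|=O(\exp(\lambda'|x|))$ as $|x|\to\infty$ and HL5(b) holds. Then, as $n\to\infty$, $$\frac1n\sum_{t=1}^n f\left(\beta_n^{-1}X_t(n)\right)\overset{d}{\rightarrow}\int_{\mathbb R}f(x+X^-)\,\Phi_{X^+}(x)\,dx .$$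
   Context: All limits are as $n\to\infty$ unless indicated otherwise; $\overset{p}{\to}$, $\overset{d}{\to}$ denote convergence in probability and in distribution. The conditions are: HL0: $\{X_t(n)\}_{t=1}^n$, $n\in\mathbb N$, is a random array and $\{\mathcal F_t\}_{t=-\infty}^{\infty}$ a filtration such that $X_t(n)$ is $\mathcal F_t$-measurable for all $t$ and $n$; $\{\beta_n\}$ is a positive sequence with $\beta_n\to\infty$. HL1: $X_t(n)=X_t^+(n)+X_t^-(n)+R_t(n)$, where $X_t^-(n)$ is $\mathcal F_0$-measurable and $\sup_{1\le t\le n}\mathbf P\{\beta_n^{-1}|R_t(n)|>\epsilon\}\to0$ for every $\epsilon>0$. HL2: there are random variables $X^+$ and $X^-$, where $X^+$ has a bounded continuous density $\Phi_{X^+}$, such that for every $\delta\in(0,1)$ and every $\{t_n\}$ with $\lfloor n\delta\rfloor\le t_n\le n$: (a) $\beta_n^{-1}X_{t_n}^+(n)\overset{d}{\to}X^+$ conditionally on $\mathcal F_0$, in the sense that for all bounded continuous $h:\mathbb R\to\mathbb R$, $\mathbf E[h(\beta_n^{-1}X_{t_n}^+(n))\mid\mathcal F_0]\overset{p}{\to}\int_{\mathbb R}h(x)\Phi_{X^+}(x)dx$; and (b) $\beta_n^{-1}X_{t_n}^-(n)\overset{d}{\to}X^-$ and $\beta_n^{-1}[X_n^-(n)-X_{t_n}^-(n)]\overset{p}{\to}0$. HL3: $\beta_t^{-1}X_t(n)$ has density $\mathcal D_{n,t}(x)$ such that for some $n_0\ge t_0\ge1$, $\sup_{n\ge n_0,\,t_0\le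 t\le n}\sup_x\mathcal D_{n,t}(x)<\infty$. HL4: for every bounded and Lipschitz continuous $g:\mathbb R\to\mathbb R$, $\frac1n\sum_{t=1}^n g(\beta_n^{-1}X_t(n))=\frac1n\sum_{t=1}^n\mathbf E[g(\beta_n^{-1}X_t(n))\mid\mathcal F_0]+o_p(1)$. HL5: for some $\lambda\in(0,\infty)$ and $n_0\ge1$: (a) $\sup_{n\ge n_0,1\le t\le n}\mathbf E|\beta_n^{-1}X_t(n)|^{\lambda}<\infty$; or (b) $\sup_{n\ge n_0,1\le t\le n}\mathbf E\exp(\lambda|\beta_n^{-1}X_t(n)|)<\infty$. HL6: $\sup_{n\in\mathbb N}\frac{\beta_n}{n}\sum_{t=t_0}^n\beta_t^{-1}<\infty$, for $t_0$ as in HL3. *)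

theory Defs
  imports "HOL-Probability.Probability"
begin

text \<open>
  Throughout, \<open>X n t\<close> stands for $X_t(n)$, and only the entries with $1 \le t \le n$ are meaningful.
  \<open>M\<close> carries the array and \<open>F 0\<close> is the sigma-algebra conditioned on; the limit
  variables \<open>Xp\<close>, \<open>Xm\<close> (for $X^+$, $X^-$) may live on a different probability space \<open>N\<close>.
\<close>

definition conv_in_prob :: "'a measure \<Rightarrow> (nat \<Rightarrow> 'a \<Rightarrow> real) \<Rightarrow> ('a \<Rightarrow> real) \<Rightarrow> bool" where
  "conv_in_prob M Y Z \<longleftrightarrow>
     (\<forall>\<epsilon>>0. (\<lambda>n. measure M {\<omega> \<in> space M. \<bar>Y n \<omega> - Z \<omega>\<bar> > \<epsilon>}) \<longlonglongrightarrow> 0)"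

definition conv_in_distr ::
  "'a measure \<Rightarrow> (nat \<Rightarrow> 'a \<Rightarrow> real) \<Rightarrow> 'b measure \<Rightarrow> ('b \<Rightarrow> real) \<Rightarrow> bool" where
  "conv_in_distr M Y N Z \<longleftrightarrow> weak_conv_m (\<lambda>n. distr M borel (Y n)) (distr N borel Z)"

text \<open>Locally integrable in the Lebesgue sense; no Borel measurability is required.
  Thus \<open>f (X n t \<omega> / \<beta> n)\<close> is in general only measurable with respect to \<open>completion M\<close>
  (as \<open>X n t\<close> has a density); for Borel \<open>f\<close> the completion changes nothing.\<close>

definition locally_integrable :: "(real \<Rightarrow> real) \<Rightarrow> bool" where
  "locally_integrable f \<longleftrightarrow> (\<forall>K. compact K \<longrightarrow> f absolutely_integrable_on K)"

definition HL0 ::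
  "'a measure \<Rightarrow> (int \<Rightarrow> 'a measure) \<Rightarrow> (nat \<Rightarrow> real) \<Rightarrow> (nat \<Rightarrow> nat \<Rightarrow> 'a \<Rightarrow> real) \<Rightarrow> bool" where
  "HL0 M F \<beta> X \<longleftrightarrow>
     filtration (space M) F \<and> (\<forall>t. subalgebra M (F t)) \<and>
     (\<forall>n\<ge>1. \<forall>t\<in>{1..n}. X n t \<in> borel_measurable (F (int t))) \<and>
     (\<forall>n\<ge>1. \<beta> n > 0) \<and> filterlim \<beta> at_top sequentially"

definition HL1 ::
  "'a measure \<Rightarrow> (int \<Rightarrow> 'a measure) \<Rightarrow> (nat \<Rightarrow> real) \<Rightarrow> (nat \<Rightarrow> nat \<Rightarrow> 'a \<Rightarrow> real) \<Rightarrow>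
   (nat \<Rightarrow> nat \<Rightarrow> 'a \<Rightarrow> real) \<Rightarrow> (nat \<Rightarrow> nat \<Rightarrow> 'a \<Rightarrow> real) \<Rightarrow> (nat \<Rightarrow> nat \<Rightarrow> 'a \<Rightarrow> real) \<Rightarrow> bool" where
  "HL1 M F \<beta> X Xpa Xma R \<longleftrightarrow>
     (\<forall>n\<ge>1. \<forall>t\<in>{1..n}.
        Xpa n t \<in> borel_measurable M \<and> Xma n t \<in> borel_measurable (F 0) \<and>
        R n t \<in> borel_measurable M \<and>
        (\<forall>\<omega>\<in>space M. X n t \<omega> = Xpa n t \<omega> + Xma n t \<omega> + R n t \<omega>)) \<and>
     (\<forall>\<epsilon>>0. (\<lambda>n. SUP t\<in>{1..n}. measure M {\<omega> \<in> space M. \<bar>R n t \<omega>\<bar> / \<beta> n > \<epsilon>}) \<longlonglongrightarrow> 0)"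

definition HL2 ::
  "'a measure \<Rightarrow> (int \<Rightarrow> 'a measure) \<Rightarrow> (nat \<Rightarrow> real) \<Rightarrow> (nat \<Rightarrow> nat \<Rightarrow> 'a \<Rightarrow> real) \<Rightarrow>
   (nat \<Rightarrow> nat \<Rightarrow> 'a \<Rightarrow> real) \<Rightarrow> 'b measure \<Rightarrow> ('b \<Rightarrow> real) \<Rightarrow> ('b \<Rightarrow> real) \<Rightarrow> (real \<Rightarrow> real) \<Rightarrow> bool" where
  "HL2 M F \<beta> Xpa Xma N Xp Xm \<Phi> \<longleftrightarrow>
     Xp \<in> borel_measurable N \<and> Xm \<in> borel_measurable N \<and>
     distributed N lborel Xp (\<lambda>x. ennreal (\<Phi> x)) \<and>
     (\<forall>x. 0 \<le> \<Phi> x) \<and> bounded (range \<Phi>) \<and> continuous_on UNIV \<Phi> \<and>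
     (\<forall>\<delta> \<tau>. 0 < \<delta> \<and> \<delta> < 1 \<and> (\<forall>n\<ge>1. \<lfloor>real n * \<delta>\<rfloor> \<le> int (\<tau> n) \<and> \<tau> n \<le> n) \<longrightarrow>
        (\<forall>h. continuous_on UNIV h \<and> bounded (range h) \<longrightarrow>
           conv_in_prob M
             (\<lambda>n. real_cond_exp M (F 0) (\<lambda>\<omega>. h (Xpa n (\<tau> n) \<omega> / \<beta> n)))
             (\<lambda>_. \<integral>x. h x * \<Phi> x \<partial>lborel)) \<and>
        conv_in_distr M (\<lambda>n \<omega>. Xma n (\<tau> n) \<omega> / \<beta> n) N Xm \<and>
        conv_in_prob M (\<lambda>n \<omega>. (Xma n n \<omega> - Xma n (\<tau> n) \<omega>) / \<beta> n) (\<lambda>_. 0))"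

definition HL3 :: "'a measure \<Rightarrow> (nat \<Rightarrow> real) \<Rightarrow> (nat \<Rightarrow> nat \<Rightarrow> 'a \<Rightarrow> real) \<Rightarrow> nat \<Rightarrow> bool" where
  "HL3 M \<beta> X t0 \<longleftrightarrow>
     (\<exists>D :: nat \<Rightarrow> nat \<Rightarrow> real \<Rightarrow> ennreal.
        (\<forall>n\<ge>1. \<forall>t\<in>{1..n}. distributed M lborel (\<lambda>\<omega>. X n t \<omega> / \<beta> t) (D n t)) \<and>
        (\<exists>n0. 1 \<le> t0 \<and> t0 \<le> n0 \<and>
           (SUP n\<in>{n0..}. SUP t\<in>{t0..n}. SUP x. D n t x) < \<infinity>))"

definition HL4 ::
  "'a measure \<Rightarrow> (int \<Rightarrow> 'a measure) \<Rightarrow> (nat \<Rightarrow> real) \<Rightarrow> (nat \<Rightarrow> nat \<Rightarrow> 'a \<Rightarrow> real) \<Rightarrow> bool" where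
  "HL4 M F \<beta> X \<longleftrightarrow>
     (\<forall>g :: real \<Rightarrow> real. bounded (range g) \<and> (\<exists>L. L-lipschitz_on UNIV g) \<longrightarrow>
        conv_in_prob M
          (\<lambda>n \<omega>. (\<Sum>t=1..n. g (X n t \<omega> / \<beta> n)) / real n
             - (\<Sum>t=1..n. real_cond_exp M (F 0) (\<lambda>\<omega>. g (X n t \<omega> / \<beta> n)) \<omega>) / real n)
          (\<lambda>_. 0))"

definition HL5a :: "'a measure \<Rightarrow> (nat \<Rightarrow> real) \<Rightarrow> (nat \<Rightarrow> nat \<Rightarrow> 'a \<Rightarrow> real) \<Rightarrow> real \<Rightarrow> bool" where
  "HL5a M \<beta> X l \<longleftrightarrow>
     (\<exists>n0\<ge>1. (SUP n\<in>{n0..}. SUP t\<in>{1..n}.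
        \<integral>\<^sup>+\<omega>. ennreal (\<bar>X n t \<omega> / \<beta> n\<bar> powr l) \<partial>M) < \<infinity>)"

definition HL5b :: "'a measure \<Rightarrow> (nat \<Rightarrow> real) \<Rightarrow> (nat \<Rightarrow> nat \<Rightarrow> 'a \<Rightarrow> real) \<Rightarrow> real \<Rightarrow> bool" where
  "HL5b M \<beta> X l \<longleftrightarrow>
     (\<exists>n0\<ge>1. (SUP n\<in>{n0..}. SUP t\<in>{1..n}.
        \<integral>\<^sup>+\<omega>. ennreal (exp (l * \<bar>X n t \<omega> / \<beta> n\<bar>)) \<partial>M) < \<infinity>)"

definition HL6 :: "(nat \<Rightarrow> real) \<Rightarrow> nat \<Rightarrow> bool" where
  "HL6 \<beta> t0 \<longleftrightarrow> bdd_above ((\<lambda>n. \<beta> n / real n * (\<Sum>t=t0..n. inverse (\<beta> t))) ` {1..})"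

end

theory Submission
  imports Defs
begin

text \<open>
  For bounded Lipschitz \<open>g\<close> let \<open>G y = \<integral> g (x + y) \<Phi> x dx\<close>. HL4 replaces the average of
  \<open>g (X_t / \<beta>_n)\<close> by the average of its conditional expectations given \<open>F_0\<close>; by HL1 and HL2(a)
  each of these is close in $L^1$ to \<open>G (X_t^- / \<beta>_n)\<close>, because \<open>X_t^-\<close> is tight and \<open>F_0\<close>-measurable
  and may be discretised, and by HL2(b) the latter is close to \<open>G (X_n^- / \<beta>_n)\<close>, which
  converges in distribution to \<open>G (X^-)\<close>. For general \<open>f\<close>, cut off outside \<open>[-k, k]\<close> and
  approximate in $L^1$ by a bounded Lipschitz function: HL3 and HL6 bound the mean of the averages by
  a multiple of the $L^1$ norm, and the cut-off part is negligible either since \<open>f\<close> is bounded and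
  the averages are tight, or by the moment condition. All errors are measured by
  \<open>E min(1, |U|)\<close>, which metrises convergence in probability.
\<close>

text \<open>Several mismatches between hypotheses and goal shape the proof. HL2 treats one index
  sequence at a time, and only indices above a fraction \<delta> of \<open>n\<close>, while the
  averages run over all \<open>t\<close>; the early indices are few and their errors bounded. HL3
  bounds the density of X_t / \<beta>_t, but \<open>f\<close> is evaluated at X_t / \<beta>_n:
  rescaling costs the factor \<beta>_n / \<beta>_t, whose average over \<open>t\<close> is the
  quantity in HL6. Indices below \<open>t0\<close> have no uniform density bound, so they are split
  off as a head, which boundedness or assumption (ii) removes. The limit lives on another space
  \<open>N\<close>, so no truncated mean can link it to the averages: errors are estimated inside
  \<open>M\<close> and inside \<open>N\<close> separately, and only expectations of continuous test
  functions pass from one space to the other. Finally \<open>f\<close> is merely Lebesgue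
  measurable. All estimates are made for a Borel function that equals \<open>f\<close> almost
  everywhere and is dominated by it everywhere; since each X_t has a density, the averages change
  only on null events.\<close>

definition trunc_mean :: "'a measure \<Rightarrow> ('a \<Rightarrow> real) \<Rightarrow> real" where
  "trunc_mean M U = (\<integral>\<omega>. min 1 \<bar>U \<omega>\<bar> \<partial>M)"

lemma trunc_mean_nonneg: "0 \<le> trunc_mean M U"
  unfolding trunc_mean_def by (rule integral_nonneg_AE) auto

section \<open>Truncated means and conditional expectations on a probability space\<close>

context prob_space
begin

lemma integrable_bounded:
  fixes U :: "'a \<Rightarrow> real"
  assumes "U \<in> borel_measurable M" "\<And>\<omega>. \<omega> \<in> space M \<Longrightarrow> \<bar>U \<omega>\<bar> \<le> B"
  shows "integrable M U"
  by (rule integrable_const_bound[of _ B]) (use assms in auto)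

lemma expectation_le_const:
  fixes U :: "'a \<Rightarrow> real"
  assumes "\<And>\<omega>. \<omega> \<in> space M \<Longrightarrow> U \<omega> \<le> B" "0 \<le> B"
  shows "expectation U \<le> B"
proof -
  have "expectation U \<le> (\<integral>\<omega>. B \<partial>M)"
    using assms by (intro integral_mono') auto
  then show ?thesis by (simp add: prob_space)
qed

lemma integrable_trunc [simp]:
  "U \<in> borel_measurable M \<Longrightarrow> integrable M (\<lambda>\<omega>. min 1 \<bar>U \<omega> :: real\<bar>)"
  by (rule integrable_bounded[of _ 1]) auto

text \<open>Truncation at 1 is subadditive. \<open>W\<close> comes without measurability: the
  Bochner integral of a non-integrable function is 0, which the nonnegative right side dominates
  anyway.\<close>

lemma trunc_mean_add_le:
  assumes [measurable]: "U \<in> borel_measurable M" "V \<in> borel_measurable M"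
    and W: "AE \<omega> in M. \<bar>W \<omega>\<bar> \<le> \<bar>U \<omega>\<bar> + \<bar>V \<omega>\<bar>"
  shows "trunc_mean M W \<le> trunc_mean M U + trunc_mean M V"
proof -
  have "AE \<omega> in M. min 1 \<bar>W \<omega>\<bar> \<le> min 1 \<bar>U \<omega>\<bar> + min 1 \<bar>V \<omega>\<bar>"
    using W by eventually_elim linarith
  then have "trunc_mean M W \<le> (\<integral>\<omega>. min 1 \<bar>U \<omega>\<bar> + min 1 \<bar>V \<omega>\<bar> \<partial>M)"
    unfolding trunc_mean_def by (intro integral_mono_AE') auto
  then show ?thesis
    unfolding trunc_mean_def by (subst (asm) Bochner_Integration.integral_add) auto
qed

lemma trunc_mean_mono:
  assumes "V \<in> borel_measurable M" "AE \<omega> in M. \<bar>W \<omega>\<bar> \<le> \<bar>V \<omega>\<bar>"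
  shows "trunc_mean M W \<le> trunc_mean M V"
  using trunc_mean_add_le[of "\<lambda>_. 0" V W] assms by (auto simp: trunc_mean_def)

lemma trunc_mean_le_const:
  "(\<And>\<omega>. \<omega> \<in> space M \<Longrightarrow> \<bar>W \<omega>\<bar> \<le> c) \<Longrightarrow> 0 \<le> c \<Longrightarrow> trunc_mean M W \<le> c"
  unfolding trunc_mean_def by (rule expectation_le_const) force+

lemma trunc_mean_le_expectation:
  "integrable M U \<Longrightarrow> trunc_mean M U \<le> expectation (\<lambda>\<omega>. \<bar>U \<omega>\<bar>)"
  unfolding trunc_mean_def by (intro integral_mono') auto

text \<open>Where \<open>U\<close> is below 1 in absolute value the first bound is the sharper one,
  elsewhere the second; together they give \<open>c * min 1 \<bar>U\<bar>\<close>. For differences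
  of a bounded Lipschitz function this turns smallness in probability into smallness in L^1.\<close>

lemma expectation_abs_le_trunc_mean:
  assumes [measurable]: "U \<in> borel_measurable M"
    and "AE \<omega> in M. \<bar>W \<omega>\<bar> \<le> c * \<bar>U \<omega>\<bar>" "AE \<omega> in M. \<bar>W \<omega>\<bar> \<le> c"
  shows "expectation (\<lambda>\<omega>. \<bar>W \<omega>\<bar>) \<le> c * trunc_mean M U"
proof -
  have le: "AE \<omega> in M. \<bar>W \<omega>\<bar> \<le> c * min 1 \<bar>U \<omega>\<bar>"
    using assms(2,3) by eventually_elim (simp add: min_def)
  then have "AE \<omega> in M. 0 \<le> c * min 1 \<bar>U \<omega>\<bar>"
    by eventually_elim linarith
  with le have "expectation (\<lambda>\<omega>. \<bar>W \<omega>\<bar>) \<le> expectation (\<lambda>\<omega>. c * min 1 \<bar>U \<omega>\<bar>)"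
    by (intro integral_mono_AE') auto
  then show ?thesis by (simp add: trunc_mean_def)
qed

text \<open>Split at level \<open>e\<close>: below it the integrand is at most \<open>e\<close>,
  above it at most 1.\<close>

lemma trunc_mean_le_prob:
  assumes [measurable]: "U \<in> borel_measurable M" and "0 \<le> e"
  shows "trunc_mean M U \<le> e + prob {\<omega> \<in> space M. e < \<bar>U \<omega>\<bar>}"
proof -
  have "trunc_mean M U \<le> (\<integral>\<omega>. e + indicator {\<omega> \<in> space M. e < \<bar>U \<omega>\<bar>} \<omega> \<partial>M)"
    unfolding trunc_mean_def
  proof (rule integral_mono')
    show "integrable M (\<lambda>\<omega>. e + indicator {\<omega> \<in> space M. e < \<bar>U \<omega>\<bar>} \<omega>)"
      by (rule integrable_bounded[of _ "e + 1"]) (use \<open>0 \<le> e\<close> in \<open>auto simp: indicator_def\<close>)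
  qed (use \<open>0 \<le> e\<close> in \<open>auto simp: indicator_def\<close>)
  also have "\<dots> = e + prob {\<omega> \<in> space M. e < \<bar>U \<omega>\<bar>}"
  proof -
    have "integrable M (indicat_real {\<omega> \<in> space M. e < \<bar>U \<omega>\<bar>})"
      by (rule integrable_bounded[of _ 1]) (auto simp: indicator_def)
    then show ?thesis by (subst Bochner_Integration.integral_add) (auto simp: prob_space)
  qed
  finally show ?thesis .
qed

text \<open>The threshold \<open>m\<close> is there because early rows may involve entries with
  \<open>t > n\<close>, about which nothing is known, not even measurability.\<close>

lemma trunc_mean_LIMSEQ_0:
  assumes meas: "\<And>n. n \<ge> m \<Longrightarrow> U n \<in> borel_measurable M"
    and P: "\<And>e. e > 0 \<Longrightarrow> (\<lambda>n. prob {\<omega> \<in> space M. e < \<bar>U n \<omega>\<bar>}) \<longlonglongrightarrow> 0"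
  shows "(\<lambda>n. trunc_mean M (U n)) \<longlonglongrightarrow> 0"
proof (rule LIMSEQ_I)
  fix r :: real assume "0 < r"
  then have "\<forall>\<^sub>F n in sequentially. prob {\<omega> \<in> space M. r / 2 < \<bar>U n \<omega>\<bar>} < r / 2"
    by (intro order_tendstoD(2)[OF P]) auto
  then obtain n0 where n0: "\<And>n. n \<ge> n0 \<Longrightarrow> prob {\<omega> \<in> space M. r / 2 < \<bar>U n \<omega>\<bar>} < r / 2"
    by (auto simp: eventually_sequentially)
  show "\<exists>no. \<forall>n\<ge>no. norm (trunc_mean M (U n) - 0) < r"
  proof (intro exI allI impI)
    fix n assume "max n0 m \<le> n"
    then show "norm (trunc_mean M (U n) - 0) < r"
      using trunc_mean_le_prob[OF meas, of n "r / 2"] n0[of n] \<open>0 < r\<close> trunc_mean_nonneg[of M "U n"]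
      by simp
  qed
qed

lemma conv_in_prob_trunc_mean:
  assumes "conv_in_prob M U Z" "\<And>n. n \<ge> m \<Longrightarrow> U n \<in> borel_measurable M" "Z \<in> borel_measurable M"
  shows "(\<lambda>n. trunc_mean M (\<lambda>\<omega>. U n \<omega> - Z \<omega>)) \<longlonglongrightarrow> 0"
  using assms by (intro trunc_mean_LIMSEQ_0[of m]) (auto simp: conv_in_prob_def)

text \<open>Both \<open>U - V\<close> and \<open>V - U\<close> lie below their absolute value, and
  conditional expectation is monotone and preserves the mean. This lets errors inside a conditional
  expectation be estimated before conditioning.\<close>

lemma cond_exp_contraction:
  assumes sub: "subalgebra M F" and [measurable]: "integrable M U" "integrable M V"
  shows "expectation (\<lambda>\<omega>. \<bar>real_cond_exp M F U \<omega> - real_cond_exp M F V \<omega>\<bar>)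
    \<le> expectation (\<lambda>\<omega>. \<bar>U \<omega> - V \<omega>\<bar>)"
proof -
  interpret S: finite_measure_subalgebra M F
    using sub by unfold_locales
  have "AE \<omega> in M. \<bar>real_cond_exp M F U \<omega> - real_cond_exp M F V \<omega>\<bar>
      \<le> real_cond_exp M F (\<lambda>\<omega>. \<bar>U \<omega> - V \<omega>\<bar>) \<omega>"
  proof -
    have "AE \<omega> in M. real_cond_exp M F (\<lambda>\<omega>. U \<omega> - V \<omega>) \<omega> \<le> real_cond_exp M F (\<lambda>\<omega>. \<bar>U \<omega> - V \<omega>\<bar>) \<omega>"
      "AE \<omega> in M. real_cond_exp M F (\<lambda>\<omega>. V \<omega> - U \<omega>) \<omega> \<le> real_cond_exp M F (\<lambda>\<omega>. \<bar>U \<omega> - V \<omega>\<bar>) \<omega>"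
      using assms by (auto intro!: S.real_cond_exp_mono)
    with S.real_cond_exp_diff[OF assms(2,3)] S.real_cond_exp_diff[OF assms(3,2)]
    show ?thesis by eventually_elim auto
  qed
  then have "expectation (\<lambda>\<omega>. \<bar>real_cond_exp M F U \<omega> - real_cond_exp M F V \<omega>\<bar>)
      \<le> expectation (real_cond_exp M F (\<lambda>\<omega>. \<bar>U \<omega> - V \<omega>\<bar>))"
    using assms(2,3)
    by (intro integral_mono_AE S.real_cond_exp_int integrable_abs Bochner_Integration.integrable_diff)
  then show ?thesis
    using assms(2,3) by (subst (asm) S.real_cond_exp_int(2)) auto
qed

lemma cond_exp_abs_le:
  assumes sub: "subalgebra M F" and "U \<in> borel_measurable M" "\<And>\<omega>. \<omega> \<in> space M \<Longrightarrow> \<bar>U \<omega>\<bar> \<le> B"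
  shows "AE \<omega> in M. \<bar>real_cond_exp M F U \<omega>\<bar> \<le> B"
proof -
  interpret S: finite_measure_subalgebra M F
    using sub by unfold_locales
  have U: "integrable M U" using assms by (intro integrable_bounded)
  have "AE \<omega> in M. real_cond_exp M F U \<omega> \<le> B"
    by (rule S.real_cond_exp_le_c[OF U]) (use assms(3) in \<open>force intro!: AE_I2\<close>)
  moreover have "AE \<omega> in M. - B \<le> real_cond_exp M F U \<omega>"
    by (rule S.real_cond_exp_ge_c[OF U]) (use assms(3) in \<open>force intro!: AE_I2\<close>)
  ultimately show ?thesis by eventually_elim auto
qed

end

section \<open>Expectations and tightness under convergence in distribution\<close>

lemma conv_in_distr_expectation:
  assumes M: "prob_space M" and N: "prob_space N" and Z[measurable]: "Z \<in> borel_measurable N"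
    and meas: "\<And>n. n \<ge> 1 \<Longrightarrow> V n \<in> borel_measurable M"
    and conv: "conv_in_distr M V N Z"
    and \<psi>: "continuous_on UNIV (\<psi> :: real \<Rightarrow> real)" "\<And>x. \<bar>\<psi> x\<bar> \<le> (B :: real)"
  shows "(\<lambda>n. \<integral>\<omega>. \<psi> (V n \<omega>) \<partial>M) \<longlonglongrightarrow> (\<integral>\<omega>. \<psi> (Z \<omega>) \<partial>N)"
proof -
  interpret M: prob_space M by fact
  interpret N: prob_space N by fact
  have meas_Suc[measurable]: "V (Suc n) \<in> borel_measurable M" for n by (rule meas) simp
  have [measurable]: "\<psi> \<in> borel_measurable borel" by (rule borel_measurable_continuous_onI) fact
  \<comment> \<open>Row 0 is unconstrained and its image need not be a probability distribution, so
    the weak limit is taken along \<open>Suc n\<close>.\<close>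
  have "weak_conv_m (\<lambda>n. distr M borel (V (Suc n))) (distr N borel Z)"
    using conv unfolding conv_in_distr_def weak_conv_m_def weak_conv_def by (auto intro: LIMSEQ_Suc)
  then have "(\<lambda>n. integral\<^sup>L (distr M borel (V (Suc n))) \<psi>) \<longlonglongrightarrow> integral\<^sup>L (distr N borel Z) \<psi>"
    using \<psi> by (intro weak_conv_imp_integral_bdd_continuous_conv[where B = B])
      (auto simp: continuous_on_eq_continuous_at)
  then have "(\<lambda>n. \<integral>\<omega>. \<psi> (V (Suc n) \<omega>) \<partial>M) \<longlonglongrightarrow> (\<integral>\<omega>. \<psi> (Z \<omega>) \<partial>N)"
    by (subst (asm) (1 2) integral_distr) auto
  then show ?thesis by (rule LIMSEQ_imp_Suc)
qed

lemma conv_in_distr_tight: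
  assumes M: "prob_space M" and N: "prob_space N" and Z[measurable]: "Z \<in> borel_measurable N"
    and meas: "\<And>n. n \<ge> 1 \<Longrightarrow> V n \<in> borel_measurable M"
    and conv: "conv_in_distr M V N Z" and "0 < e"
  shows "\<exists>K. \<forall>\<^sub>F n in sequentially. measure M {\<omega> \<in> space M. K < \<bar>V n \<omega>\<bar>} < e"
proof -
  interpret M: prob_space M by fact
  interpret N: prob_space N by fact
  \<comment> \<open>A continuous ramp between the indicators of \<open>K + 1 < \<bar>x\<bar>\<close>
    and \<open>K < \<bar>x\<bar>\<close>: the limit passes through continuous functions only, at the
    price of 1 in the radius.\<close>
  define \<psi> where "\<psi> K x = min 1 (max 0 (\<bar>x\<bar> - K))" for K x :: real
  have "(\<lambda>k. \<integral>\<omega>. \<psi> (real k) (Z \<omega>) \<partial>N) \<longlonglongrightarrow> (\<integral>\<omega>. 0 \<partial>N)"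
  proof (rule integral_dominated_convergence[where w = "\<lambda>_. 1"])
    show "AE \<omega> in N. (\<lambda>k. \<psi> (real k) (Z \<omega>)) \<longlonglongrightarrow> 0"
    proof (rule AE_I2, rule tendsto_eventually)
      fix \<omega> show "\<forall>\<^sub>F k in sequentially. \<psi> (real k) (Z \<omega>) = 0"
        using eventually_ge_at_top[of "nat \<lceil>\<bar>Z \<omega>\<bar>\<rceil>"]
        by eventually_elim (auto simp: \<psi>_def min_def max_def nat_le_iff ceiling_le_iff)
    qed
  qed (auto simp: \<psi>_def)
  then obtain k where k: "(\<integral>\<omega>. \<psi> (real k) (Z \<omega>) \<partial>N) < e"
    using order_tendstoD(2)[of _ "\<integral>\<omega>. 0 \<partial>N" sequentially e] \<open>0 < e\<close>
    by (auto simp: eventually_sequentially)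
  have "(\<lambda>n. \<integral>\<omega>. \<psi> k (V n \<omega>) \<partial>M) \<longlonglongrightarrow> (\<integral>\<omega>. \<psi> k (Z \<omega>) \<partial>N)"
    by (rule conv_in_distr_expectation[OF M N Z meas conv, where B = 1])
      (auto simp: \<psi>_def[abs_def] intro!: continuous_intros)
  then have "\<forall>\<^sub>F n in sequentially. (\<integral>\<omega>. \<psi> k (V n \<omega>) \<partial>M) < e"
    using k by (auto dest!: order_tendstoD(2))
  then have "\<forall>\<^sub>F n in sequentially. measure M {\<omega> \<in> space M. real k + 1 < \<bar>V n \<omega>\<bar>} < e"
    using eventually_ge_at_top[of 1]
  proof eventually_elim
    case (elim n)
    note [measurable] = meas[OF \<open>1 \<le> n\<close>]
    have "measure M {\<omega> \<in> space M. real k + 1 < \<bar>V n \<omega>\<bar>}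
        = (\<integral>\<omega>. indicator {\<omega> \<in> space M. real k + 1 < \<bar>V n \<omega>\<bar>} \<omega> \<partial>M)"
      by simp
    also have "\<dots> \<le> (\<integral>\<omega>. \<psi> k (V n \<omega>) \<partial>M)"
      by (intro integral_mono' M.integrable_bounded[of _ 1])
        (auto simp: \<psi>_def indicator_def)
    finally show ?case using elim by simp
  qed
  then show ?thesis by blast
qed

section \<open>Lipschitz functions and their density in L^1\<close>

lemma lipschitz_UNIV_real_iff:
  "L-lipschitz_on UNIV (g :: 'a::metric_space \<Rightarrow> real) \<longleftrightarrow> 0 \<le> L \<and> (\<forall>x y. \<bar>g x - g y\<bar> \<le> L * dist x y)"
  by (auto simp: lipschitz_on_def dist_real_def)

lemma lipschitz_borel:
  fixes g :: "real \<Rightarrow> real"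
  assumes "L-lipschitz_on UNIV g" shows "g \<in> borel_measurable borel"
  by (rule borel_measurable_continuous_onI[OF lipschitz_on_continuous_on[OF assms]])

text \<open>Outer regularity encloses a set of finite measure in an open \<open>U\<close> of nearly
  the same measure, and the distance to the complement of \<open>U\<close> yields Lipschitz
  functions increasing to its indicator; sums and dominated limits give the rest. Lipschitz
  approximants are what HL4 accepts, and their integrability keeps \<open>f - g\<close> within reach
  of the density bounds.\<close>

lemma integrable_lborel_approx_lipschitz:
  fixes f :: "'a::euclidean_space \<Rightarrow> real"
  assumes "integrable lborel f" "0 < e"
  shows "\<exists>g L B. L-lipschitz_on UNIV g \<and> (\<forall>x. \<bar>g x\<bar> \<le> B) \<and> integrable lborel g \<and>
    (\<integral>x. \<bar>f x - g x\<bar> \<partial>lborel) < e"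
  using assms
proof (induction f arbitrary: e rule: integrable_induct)
  case (base A c)
  \<comment> \<open>Two errors of size \<open>d\<close> arise, from \<open>A\<close> to
    \<open>U\<close> and from \<open>U\<close> to the ramp, both scaled by
    \<open>\<bar>c\<bar>\<close>. The \<open>+ 1\<close> covers \<open>c = 0\<close> and makes the
    final inequality strict.\<close>
  define d where "d = e / (\<bar>c\<bar> + 1) / 2"
  have "0 < d" using base by (simp add: d_def)
  from base have [measurable]: "A \<in> sets borel" by simp
  obtain U where U: "open U" "A \<subseteq> U" and Ud: "emeasure lborel (U - A) < ennreal d"
    using outer_regular_lborel[OF _ \<open>0 < d\<close>, of A] base by auto
  have [measurable]: "U \<in> sets borel" using U by auto
  have "emeasure lborel U = emeasure lborel A + emeasure lborel (U - A)"
    using U by (subst plus_emeasure) (auto intro!: arg_cong[where f = "emeasure lborel"])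
  also have "\<dots> < \<infinity>"
    using base Ud by (auto simp: less_top[symmetric] top_unique)
  finally have U_fin: "emeasure lborel U < \<infinity>" .
  \<comment> \<open>The infimum distance to the empty set is 0 by convention, so for
    \<open>U = UNIV\<close> every ramp \<open>h k\<close> below would vanish.\<close>
  then have "U \<noteq> UNIV" by auto
  define h where "h k x = min 1 (real k * infdist x (- U))" for k x
  have h_range: "0 \<le> h k x" "h k x \<le> indicator U x" for k x
    by (auto simp: h_def indicator_def infdist_nonneg)
  have [measurable]: "h k \<in> borel_measurable borel" for k
    unfolding h_def by (intro borel_measurable_continuous_onI continuous_intros)
  have int_U: "integrable lborel (indicat_real U)"
    using U_fin by (simp add: integrable_indicator_iff)
  have int_h: "integrable lborel (h k)" for k
    by (rule Bochner_Integration.integrable_bound[OF int_U]) (auto simp: h_range abs_of_nonneg)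
  have "(\<lambda>k. \<integral>x. \<bar>indicator U x - h k x\<bar> \<partial>lborel) \<longlonglongrightarrow> integral\<^sup>L lborel (\<lambda>x::'a. 0)"
  proof (rule integral_dominated_convergence[OF _ _ int_U])
    show "AE x in lborel. (\<lambda>k. \<bar>indicator U x - h k x\<bar>) \<longlonglongrightarrow> 0"
    proof (rule AE_I2, rule tendsto_eventually)
      fix x
      show "\<forall>\<^sub>F k in sequentially. \<bar>indicator U x - h k x\<bar> = 0"
      proof (cases "x \<in> U")
        case True
        then have pos: "0 < infdist x (- U)"
          using \<open>U \<noteq> UNIV\<close> U by (intro infdist_pos_not_in_closed) auto
        show ?thesis
          using eventually_ge_at_top[of "nat \<lceil>1 / infdist x (- U)\<rceil>"]
        proof eventually_elim
          case (elim k)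
          then have "1 / infdist x (- U) \<le> real k" by (simp add: nat_le_iff ceiling_le_iff)
          then show ?case using True pos by (simp add: h_def field_simps)
        qed
      qed (use h_range in \<open>auto simp: h_def\<close>)
    qed
    show "AE x in lborel. norm \<bar>indicator U x - h k x\<bar> \<le> indicat_real U x" for k
      using h_range[of k] by (intro AE_I2) (auto simp: indicator_def abs_le_iff h_def)
  qed auto
  then have "\<forall>\<^sub>F k in sequentially. (\<integral>x. \<bar>indicator U x - h k x\<bar> \<partial>lborel) < d"
    using \<open>0 < d\<close> by (intro order_tendstoD(2)) auto
  then obtain k where k: "(\<integral>x. \<bar>indicator U x - h k x\<bar> \<partial>lborel) < d"
    by (auto simp: eventually_sequentially)
  have lip: "(\<bar>c\<bar> * real k)-lipschitz_on UNIV (\<lambda>x. c * h k x)"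
    unfolding lipschitz_UNIV_real_iff
  proof safe
    fix x y
    have "\<bar>h k x - h k y\<bar> \<le> \<bar>real k * (infdist x (- U) - infdist y (- U))\<bar>"
      unfolding h_def right_diff_distrib by linarith
    also have "\<dots> \<le> real k * dist x y"
      by (simp add: abs_mult infdist_triangle_abs mult_left_mono)
    finally have "\<bar>c\<bar> * \<bar>h k x - h k y\<bar> \<le> \<bar>c\<bar> * (real k * dist x y)"
      by (intro mult_left_mono) auto
    then show "\<bar>c * h k x - c * h k y\<bar> \<le> \<bar>c\<bar> * real k * dist x y"
      by (simp add: abs_mult mult.assoc flip: right_diff_distrib)
  qed auto
  have int_d: "integrable lborel (indicat_real (U - A))"
    using Ud by (auto simp: integrable_indicator_iff less_top[symmetric] top_unique)
  have "(\<integral>x. \<bar>indicator A x *\<^sub>R c - c * h k x\<bar> \<partial>lborel)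
      \<le> (\<integral>x. \<bar>c\<bar> * (indicator (U - A) x + \<bar>indicator U x - h k x\<bar>) \<partial>lborel)"
  proof (rule integral_mono')
    fix x
    have "\<bar>indicator A x *\<^sub>R c - c * h k x\<bar> = \<bar>c\<bar> * \<bar>indicator A x - h k x\<bar>"
      by (simp flip: abs_mult add: right_diff_distrib mult.commute)
    also have "\<dots> \<le> \<bar>c\<bar> * (indicator (U - A) x + \<bar>indicator U x - h k x\<bar>)"
      using U h_range[of k x] by (intro mult_left_mono) (auto simp: indicator_def split: if_splits)
    finally show "\<bar>indicator A x *\<^sub>R c - c * h k x\<bar> \<le> \<dots>" .
  qed (use int_d int_U int_h in auto)
  also have "\<dots> = \<bar>c\<bar> * (measure lborel (U - A) + (\<integral>x. \<bar>indicator U x - h k x\<bar> \<partial>lborel))"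
    using int_d int_U int_h
    by (subst integral_mult_right_zero, subst Bochner_Integration.integral_add) auto
  also have "\<dots> \<le> \<bar>c\<bar> * (d + d)"
  proof (intro mult_left_mono add_mono)
    show "measure lborel (U - A) \<le> d"
      unfolding measure_def by (rule enn2real_leI) (use Ud \<open>0 < d\<close> in auto)
  qed (use k in auto)
  also have "\<dots> < (\<bar>c\<bar> + 1) * (d + d)"
    using \<open>0 < d\<close> by (intro mult_strict_right_mono) auto
  also have "\<dots> = e"
  proof -
    have "\<bar>c\<bar> + 1 \<noteq> 0" by linarith
    then show ?thesis
      unfolding d_def field_sum_of_halves times_divide_eq_right by (rule nonzero_mult_div_cancel_left)
  qed
  finally have "(\<integral>x. \<bar>indicator A x *\<^sub>R c - c * h k x\<bar> \<partial>lborel) < e" .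
  moreover have "\<bar>c * h k x\<bar> \<le> \<bar>c\<bar>" for x
  proof -
    have "\<bar>h k x\<bar> \<le> 1" using h_range(1)[of k x] by (simp add: h_def)
    then show ?thesis using mult_left_mono[of "\<bar>h k x\<bar>" 1 "\<bar>c\<bar>"] by (simp add: abs_mult)
  qed
  ultimately show ?case
    using lip integrable_mult_right[OF int_h[of k], of c] by blast
next
  case (add f1 f2)
  obtain g1 L1 B1 where 1: "L1-lipschitz_on UNIV g1" "\<And>x. \<bar>g1 x\<bar> \<le> B1" "integrable lborel g1"
      "(\<integral>x. \<bar>f1 x - g1 x\<bar> \<partial>lborel) < e / 2"
    using add.IH(1)[of "e / 2"] add.prems by auto
  obtain g2 L2 B2 where 2: "L2-lipschitz_on UNIV g2" "\<And>x. \<bar>g2 x\<bar> \<le> B2" "integrable lborel g2"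
      "(\<integral>x. \<bar>f2 x - g2 x\<bar> \<partial>lborel) < e / 2"
    using add.IH(2)[of "e / 2"] add.prems by auto
  have "(\<integral>x. \<bar>f1 x + f2 x - (g1 x + g2 x)\<bar> \<partial>lborel)
      \<le> (\<integral>x. \<bar>f1 x - g1 x\<bar> + \<bar>f2 x - g2 x\<bar> \<partial>lborel)"
    using add.hyps 1 2 by (intro integral_mono') auto
  also have "\<dots> < e"
    using add.hyps 1 2 by (subst Bochner_Integration.integral_add) auto
  finally show ?case
    using 1 2 lipschitz_on_add[OF 1(1) 2(1)] 
    by (intro exI[of _ "\<lambda>x. g1 x + g2 x"] exI[of _ "L1 + L2"] exI[of _ "B1 + B2"])
      (auto intro: order_trans[OF abs_triangle_ineq add_mono])
next
  case (lim f s)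
  have "(\<lambda>i. \<integral>x. \<bar>f x - s i x\<bar> \<partial>lborel) \<longlonglongrightarrow> integral\<^sup>L lborel (\<lambda>x::'a. 0)"
  \<comment> \<open>The induction rule bounds each \<open>s i\<close> by twice
    \<open>\<bar>f\<bar>\<close>; the difference from \<open>f\<close> adds one more.\<close>
  proof (rule integral_dominated_convergence[where w = "\<lambda>x. 3 * \<bar>f x\<bar>"])
    show "AE x in lborel. (\<lambda>i. \<bar>f x - s i x\<bar>) \<longlonglongrightarrow> 0"
      using lim.hyps(2) by (intro AE_I2) (auto intro!: tendsto_eq_intros)
    show "AE x in lborel. norm \<bar>f x - s i x\<bar> \<le> 3 * \<bar>f x\<bar>" for i
    proof (rule AE_I2)
      fix x show "norm \<bar>f x - s i x\<bar> \<le> 3 * \<bar>f x\<bar>"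
        using lim.hyps(3)[of x i] by simp
    qed
  qed (use lim.hyps in auto)
  then have "\<forall>\<^sub>F i in sequentially. (\<integral>x. \<bar>f x - s i x\<bar> \<partial>lborel) < e / 2"
    using lim.prems by (intro order_tendstoD(2)) auto
  then obtain i where i: "(\<integral>x. \<bar>f x - s i x\<bar> \<partial>lborel) < e / 2"
    by (auto simp: eventually_sequentially)
  obtain g L B where g: "L-lipschitz_on UNIV g" "\<And>x. \<bar>g x\<bar> \<le> B" "integrable lborel g"
      "(\<integral>x. \<bar>s i x - g x\<bar> \<partial>lborel) < e / 2"
    using lim.IH(1)[of "e / 2" i] lim.prems by auto
  have "(\<integral>x. \<bar>f x - g x\<bar> \<partial>lborel) \<le> (\<integral>x. \<bar>f x - s i x\<bar> + \<bar>s i x - g x\<bar> \<partial>lborel)"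
    using lim.hyps g by (intro integral_mono') auto
  also have "\<dots> < e"
    using lim.hyps g i by (subst Bochner_Integration.integral_add) auto
  finally show ?case using g by blast
qed

section \<open>Averaging over the density \<Phi>\<close>

definition shift_mean :: "(real \<Rightarrow> real) \<Rightarrow> (real \<Rightarrow> real) \<Rightarrow> real \<Rightarrow> real" where
  "shift_mean \<Phi> g y = (\<integral>x. g (x + y) * \<Phi> x \<partial>lborel)"

locale density_function =
  fixes \<Phi> :: "real \<Rightarrow> real"
  assumes nonneg: "0 \<le> \<Phi> x" and integrable: "integrable lborel \<Phi>" and integral: "(\<integral>x. \<Phi> x \<partial>lborel) = 1"
begin

lemma borel[measurable]: "\<Phi> \<in> borel_measurable borel"
  using borel_measurable_integrable[OF integrable] by simp

lemma integrable_mult_bounded: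
  assumes [measurable]: "h \<in> borel_measurable borel" and "\<And>x. \<bar>h x\<bar> \<le> B"
  shows "integrable lborel (\<lambda>x. h x * \<Phi> x)"
proof (rule Bochner_Integration.integrable_bound[OF integrable_mult_right[OF integrable, of B]])
  show "AE x in lborel. norm (h x * \<Phi> x) \<le> norm (B * \<Phi> x)"
    using assms(2) nonneg
    by (intro AE_I2) (auto simp: abs_mult intro!: mult_mono intro: order_trans[OF _ abs_ge_self])
qed auto

lemma shift_mean_bounded:
  assumes "g \<in> borel_measurable borel" "\<And>x. \<bar>g x\<bar> \<le> B"
  shows "\<bar>shift_mean \<Phi> g y\<bar> \<le> B"
proof -
  have "0 \<le> B" using assms(2)[of 0] by linarith
  have "\<bar>shift_mean \<Phi> g y\<bar> \<le> (\<integral>x. \<bar>g (x + y) * \<Phi> x\<bar> \<partial>lborel)"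
    unfolding shift_mean_def by (rule integral_abs_bound)
  also have "\<dots> \<le> (\<integral>x. B * \<Phi> x \<partial>lborel)"
    using assms integrable nonneg
    by (intro integral_mono') (auto simp: abs_mult \<open>0 \<le> B\<close> intro!: mult_right_mono)
  finally show ?thesis by (simp add: integral)
qed

text \<open>Changing the shift moves the argument of \<open>g\<close> by the same amount for every
  \<open>x\<close>, and \<Phi> has mass 1, so the constant is preserved. Continuity of the shift
  mean is what allows convergence in distribution to be applied to it.\<close>

lemma shift_mean_lipschitz:
  assumes L: "L-lipschitz_on UNIV g" and B: "\<And>x. \<bar>g x\<bar> \<le> B"
  shows "L-lipschitz_on UNIV (shift_mean \<Phi> g)"
  unfolding lipschitz_UNIV_real_iff
proof safe
  show "0 \<le> L" using L by (rule lipschitz_on_nonneg)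
  fix y z
  note [measurable] = lipschitz_borel[OF L]
  have I: "integrable lborel (\<lambda>x. g (x + y) * \<Phi> x)" for y
    by (rule integrable_mult_bounded) (use B in auto)
  have "\<bar>shift_mean \<Phi> g y - shift_mean \<Phi> g z\<bar> = \<bar>\<integral>x. g (x + y) * \<Phi> x - g (x + z) * \<Phi> x \<partial>lborel\<bar>"
    unfolding shift_mean_def by (subst Bochner_Integration.integral_diff) (auto intro: I)
  also have "\<dots> \<le> (\<integral>x. \<bar>g (x + y) * \<Phi> x - g (x + z) * \<Phi> x\<bar> \<partial>lborel)"
    by (rule integral_abs_bound)
  also have "\<dots> \<le> (\<integral>x. (L * dist y z) * \<Phi> x \<partial>lborel)"
  proof (rule integral_mono')
    fix x
    have "\<bar>g (x + y) - g (x + z)\<bar> \<le> L * dist y z"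
      using L unfolding lipschitz_UNIV_real_iff by (metis dist_add_cancel)
    then show "\<bar>g (x + y) * \<Phi> x - g (x + z) * \<Phi> x\<bar> \<le> (L * dist y z) * \<Phi> x"
      using nonneg[of x] by (simp add: abs_mult mult_right_mono flip: left_diff_distrib)
  qed (use integrable nonneg \<open>0 \<le> L\<close> in auto)
  finally show "\<bar>shift_mean \<Phi> g y - shift_mean \<Phi> g z\<bar> \<le> L * dist y z"
    by (simp add: integral)
qed

end

text \<open>The hypothesis \<open>conv\<close> concerns a fixed test function, hence a fixed shift
  \<open>s\<close>, whereas here the shift \<open>V n\<close> is random and changes with
  \<open>n\<close>. Tightness confines it to a bounded interval up to small probability, so after
  rounding only finitely many shifts, the same for all large \<open>n\<close>, remain; their errors
  vanish together.\<close>

lemma (in density_function) cond_exp_shift_mean_LIMSEQ: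
  assumes M: "prob_space M" and sub: "subalgebra M F"
    and U: "\<And>n. n \<ge> 1 \<Longrightarrow> U n \<in> borel_measurable M"
    and V: "\<And>n. n \<ge> 1 \<Longrightarrow> V n \<in> borel_measurable F"
    and conv: "\<And>h. continuous_on UNIV h \<Longrightarrow> bounded (range h) \<Longrightarrow>
      conv_in_prob M (\<lambda>n. real_cond_exp M F (\<lambda>\<omega>. h (U n \<omega>))) (\<lambda>_. \<integral>x. h x * \<Phi> x \<partial>lborel)"
    and tight: "\<And>e. 0 < e \<Longrightarrow> \<exists>K. \<forall>\<^sub>F n in sequentially. measure M {\<omega> \<in> space M. K < \<bar>V n \<omega>\<bar>} < e"
    and L: "L-lipschitz_on UNIV g" and B: "\<And>x. \<bar>g x\<bar> \<le> B"
  shows "(\<lambda>n. \<integral>\<omega>. \<bar>real_cond_exp M F (\<lambda>\<omega>. g (U n \<omega> + V n \<omega>)) \<omega> - shift_mean \<Phi> g (V n \<omega>)\<bar> \<partial>M)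
    \<longlonglongrightarrow> 0"
proof -
  interpret M: prob_space M by fact
  interpret S: finite_measure_subalgebra M F using sub by unfold_locales
  note g_borel[measurable] = lipschitz_borel[OF L]
  have "0 \<le> L" using L by (rule lipschitz_on_nonneg)
  have "0 \<le> B" using B[of 0] by linarith
  define G where "G = shift_mean \<Phi> g"
  have G_L: "L-lipschitz_on UNIV G" unfolding G_def by (rule shift_mean_lipschitz[OF L B])
  note G_borel[measurable] = lipschitz_borel[OF G_L]
  have G_B: "\<bar>G y\<bar> \<le> B" for y unfolding G_def by (rule shift_mean_bounded) (auto intro: B)
  have VM: "V n \<in> borel_measurable M" if "n \<ge> 1" for n
    using V[OF that] measurable_from_subalg[OF sub] by blast
  define E where "E s n = real_cond_exp M F (\<lambda>\<omega>. g (U n \<omega> + s))" for s n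
  have E_meas[measurable]: "E s n \<in> borel_measurable M" for s n by (simp add: E_def)
  have E_conv: "(\<lambda>n. M.expectation (\<lambda>\<omega>. \<bar>E s n \<omega> - G s\<bar>)) \<longlonglongrightarrow> 0" for s
  proof (rule tendsto_sandwich[of "\<lambda>_. 0"])
    have "conv_in_prob M (E s) (\<lambda>_. G s)"
      unfolding E_def G_def shift_mean_def
    proof (rule conv)
      show "continuous_on UNIV (\<lambda>x. g (x + s))"
        by (intro continuous_on_compose2[OF lipschitz_on_continuous_on[OF L]] continuous_intros) auto
      show "bounded (range (\<lambda>x. g (x + s)))"
        using B by (auto simp: bounded_iff)
    qed
    then have "(\<lambda>n. trunc_mean M (\<lambda>\<omega>. E s n \<omega> - G s)) \<longlonglongrightarrow> 0"
      by (rule M.conv_in_prob_trunc_mean) auto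
    \<comment> \<open>The constant has to dominate the bound \<open>2 * B\<close> of the error and
      also be at least 1, since the error is compared with itself.\<close>
    then show "(\<lambda>n. (1 + 2 * B) * trunc_mean M (\<lambda>\<omega>. E s n \<omega> - G s)) \<longlonglongrightarrow> 0"
      by (rule tendsto_mult_right_zero)
    show "\<forall>\<^sub>F n in sequentially. M.expectation (\<lambda>\<omega>. \<bar>E s n \<omega> - G s\<bar>)
        \<le> (1 + 2 * B) * trunc_mean M (\<lambda>\<omega>. E s n \<omega> - G s)"
      using eventually_ge_at_top[of 1]
    proof eventually_elim
      case (elim n)
      note [measurable] = U[OF elim]
      show ?case
      proof (rule M.expectation_abs_le_trunc_mean)
        have "AE \<omega> in M. \<bar>E s n \<omega>\<bar> \<le> B"
          unfolding E_def by (rule M.cond_exp_abs_le[OF sub]) (auto intro: B)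
        then show "AE \<omega> in M. \<bar>E s n \<omega> - G s\<bar> \<le> 1 + 2 * B"
        proof eventually_elim
          case (elim \<omega>) then show ?case using G_B[of s] by linarith
        qed
        show "AE \<omega> in M. \<bar>E s n \<omega> - G s\<bar> \<le> (1 + 2 * B) * \<bar>E s n \<omega> - G s\<bar>"
          using \<open>0 \<le> B\<close> by (intro AE_I2) (simp add: distrib_right)
      qed auto
    qed
  qed auto
  show ?thesis
  proof (rule LIMSEQ_I)
    fix r :: real assume "0 < r"
    \<comment> \<open>Error budget: rounding costs at most \<open>L * \<eta> + B * p\<close>, which
      is at most \<open>r / 4\<close>, once for \<open>g\<close> under the conditional expectation
      and once for \<open>G\<close>. The grid points add \<open>r / 8\<close>, for a total of
      \<open>5 * r / 8\<close>. The \<open>+ 1\<close> in the denominators guards against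
      \<open>L = 0\<close> and \<open>B = 0\<close>.\<close>
    define \<eta> where "\<eta> = r / (L + 1) / 8"
    have "0 < \<eta>" using \<open>0 < r\<close> \<open>0 \<le> L\<close> by (simp add: \<eta>_def)
    have L\<eta>: "L * \<eta> \<le> r / 8"
    proof -
      have "L * \<eta> \<le> (L + 1) * \<eta>" using \<open>0 < \<eta>\<close> by (intro mult_right_mono) auto
      also have "\<dots> = r / 8" unfolding \<eta>_def times_divide_eq_right
        using \<open>0 \<le> L\<close> by (subst nonzero_mult_div_cancel_left) auto
      finally show ?thesis .
    qed
    define p where "p = r / (B + 1) / 8"
    have "0 < p" using \<open>0 < r\<close> \<open>0 \<le> B\<close> by (simp add: p_def)
    have Bp: "B * p \<le> r / 8"
    proof -
      have "B * p \<le> (B + 1) * p" using \<open>0 < p\<close> by (intro mult_right_mono) auto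
      also have "\<dots> = r / 8" unfolding p_def times_divide_eq_right
        using \<open>0 \<le> B\<close> by (subst nonzero_mult_div_cancel_left) auto
      finally show ?thesis .
    qed
    obtain K where K: "\<forall>\<^sub>F n in sequentially. M.prob {\<omega> \<in> space M. K < \<bar>V n \<omega>\<bar>} < p"
      using tight[OF \<open>0 < p\<close>] by blast
    \<comment> \<open>The cells that meet \<open>[-K, K]\<close>. Finiteness of \<open>J\<close>,
      and its independence of \<open>n\<close>, allow the errors at the grid points to be summed and
      sent to 0.\<close>
    define J where "J = {\<lfloor>- K / \<eta>\<rfloor>..\<lfloor>K / \<eta>\<rfloor>}"
    have "(\<lambda>n. \<Sum>j\<in>J. M.expectation (\<lambda>\<omega>. \<bar>E (\<eta> * real_of_int j) n \<omega> - G (\<eta> * real_of_int j)\<bar>)) \<longlonglongrightarrow> (\<Sum>j\<in>J. 0)"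
      by (intro tendsto_sum E_conv)
    then have "\<forall>\<^sub>F n in sequentially.
        (\<Sum>j\<in>J. M.expectation (\<lambda>\<omega>. \<bar>E (\<eta> * real_of_int j) n \<omega> - G (\<eta> * real_of_int j)\<bar>)) < r / 8"
      using \<open>0 < r\<close> by (intro order_tendstoD(2)) auto
    then have "\<forall>\<^sub>F n in sequentially.
        norm (M.expectation (\<lambda>\<omega>. \<bar>real_cond_exp M F (\<lambda>\<omega>. g (U n \<omega> + V n \<omega>)) \<omega> - shift_mean \<Phi> g (V n \<omega>)\<bar>) - 0) < r"
      using K eventually_ge_at_top[of 1]
    proof eventually_elim
      case (elim n)
      note [measurable] = U[OF \<open>1 \<le> n\<close>] VM[OF \<open>1 \<le> n\<close>]
      define bad where "bad = {\<omega> \<in> space M. K < \<bar>V n \<omega>\<bar>}"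
      have [measurable]: "bad \<in> sets M" by (simp add: bad_def)
      \<comment> \<open>\<open>T\<close> is \<open>g (U + V)\<close> with \<open>V\<close> rounded down to the grid \<open>\<eta>\<int>\<close>, so that the \<open>F\<close>-measurable part can be taken out of the conditional expectation.\<close>
      define I where "I j \<omega> = (if \<lfloor>V n \<omega> / \<eta>\<rfloor> = j then 1 else 0 :: real)" for j \<omega>
      have I_F: "I j \<in> borel_measurable F" for j
        using V[OF \<open>1 \<le> n\<close>] unfolding I_def by measurable
      then have I_M[measurable]: "I j \<in> borel_measurable M" for j
        using measurable_from_subalg[OF sub] by blast
      have I_sum: "(\<Sum>j\<in>J. I j \<omega> * c j) = (if \<lfloor>V n \<omega> / \<eta>\<rfloor> \<in> J then c \<lfloor>V n \<omega> / \<eta>\<rfloor> else 0)" for c :: "int \<Rightarrow> real" and \<omega>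
        unfolding I_def J_def by (simp add: if_distrib[of "\<lambda>x. x * _"] sum.delta cong: if_cong)
      define T where "T \<omega> = (\<Sum>j\<in>J. I j \<omega> * g (U n \<omega> + \<eta> * real_of_int j))" for \<omega>
      define H where "H \<omega> = (\<Sum>j\<in>J. I j \<omega> * G (\<eta> * real_of_int j))" for \<omega>
      have grid: "\<bar>V n \<omega> - \<eta> * real_of_int \<lfloor>V n \<omega> / \<eta>\<rfloor>\<bar> \<le> \<eta>" for \<omega>
      proof -
        have "V n \<omega> = \<eta> * (V n \<omega> / \<eta>)" using \<open>0 < \<eta>\<close> by simp
        moreover have "\<eta> * real_of_int \<lfloor>V n \<omega> / \<eta>\<rfloor> \<le> \<eta> * (V n \<omega> / \<eta>)"
          using \<open>0 < \<eta>\<close> by (intro mult_left_mono) auto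
        moreover have "\<eta> * (V n \<omega> / \<eta>) \<le> \<eta> * (real_of_int \<lfloor>V n \<omega> / \<eta>\<rfloor> + 1)"
          using \<open>0 < \<eta>\<close> by (intro mult_left_mono) linarith+
        ultimately show ?thesis by (simp add: distrib_left)
      qed
      have good: "\<lfloor>V n \<omega> / \<eta>\<rfloor> \<in> J" if "\<omega> \<in> space M" "\<omega> \<notin> bad" for \<omega>
        using that divide_right_mono[of "- K" "V n \<omega>" \<eta>] divide_right_mono[of "V n \<omega>" K \<eta>] \<open>0 < \<eta>\<close>
        unfolding J_def bad_def by (auto intro!: floor_mono)
      have lip: "\<bar>k a - k b\<bar> \<le> L * \<eta>" if "L-lipschitz_on UNIV k" "\<bar>a - b\<bar> \<le> \<eta>" for k :: "real \<Rightarrow> real" and a b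
      proof -
        have "\<bar>k a - k b\<bar> \<le> L * \<bar>a - b\<bar>"
          using that(1) unfolding lipschitz_UNIV_real_iff dist_real_def by blast
        also have "\<dots> \<le> L * \<eta>" using that(2) \<open>0 \<le> L\<close> by (rule mult_left_mono)
        finally show ?thesis .
      qed
      \<comment> \<open>If the cell of \<open>V n\<close> lies outside \<open>J\<close> then
        \<open>T\<close> is 0 and the error is bounded by \<open>B\<close>; by \<open>good\<close>
        this happens only on \<open>bad\<close>.\<close>
      have T_close: "\<bar>g (U n \<omega> + V n \<omega>) - T \<omega>\<bar> \<le> L * \<eta> + B * indicator bad \<omega>" if "\<omega> \<in> space M" for \<omega>
      proof -
        have "\<bar>g (U n \<omega> + V n \<omega>) - g (U n \<omega> + \<eta> * real_of_int \<lfloor>V n \<omega> / \<eta>\<rfloor>)\<bar> \<le> L * \<eta>"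
          by (rule lip[OF L]) (use grid[of \<omega>] in simp)
        moreover have "0 \<le> L * \<eta>" using \<open>0 \<le> L\<close> \<open>0 < \<eta>\<close> by simp
        ultimately show ?thesis
          using B[of "U n \<omega> + V n \<omega>"] good[OF that] \<open>0 \<le> B\<close>
          unfolding T_def I_sum indicator_def by (cases "\<omega> \<in> bad"; cases "\<lfloor>V n \<omega> / \<eta>\<rfloor> \<in> J"; simp)
      qed
      have H_close: "\<bar>H \<omega> - G (V n \<omega>)\<bar> \<le> L * \<eta> + B * indicator bad \<omega>" if "\<omega> \<in> space M" for \<omega>
      proof -
        have "\<bar>G (V n \<omega>) - G (\<eta> * real_of_int \<lfloor>V n \<omega> / \<eta>\<rfloor>)\<bar> \<le> L * \<eta>"
          by (rule lip[OF G_L grid])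
        moreover have "0 \<le> L * \<eta>" using \<open>0 \<le> L\<close> \<open>0 < \<eta>\<close> by simp
        ultimately show ?thesis
          using G_B[of "V n \<omega>"] good[OF that] \<open>0 \<le> B\<close>
          unfolding H_def I_sum indicator_def
          by (cases "\<omega> \<in> bad"; cases "\<lfloor>V n \<omega> / \<eta>\<rfloor> \<in> J"; simp add: abs_minus_commute)
      qed
      have [measurable]: "T \<in> borel_measurable M" "H \<in> borel_measurable M"
        unfolding T_def H_def by measurable
      have int_summand: "integrable M (\<lambda>\<omega>. I j \<omega> * g (U n \<omega> + \<eta> * real_of_int j))" for j
        by (rule M.integrable_bounded[of _ B]) (auto simp: I_def B \<open>0 \<le> B\<close>)
      then have int_T: "integrable M T" unfolding T_def by auto
      have int_g: "integrable M (\<lambda>\<omega>. g (U n \<omega> + V n \<omega>))"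
        by (rule M.integrable_bounded[of _ B]) (auto simp: B)
      have int_bound: "integrable M (\<lambda>\<omega>. L * \<eta> + B * indicator bad \<omega>)"
        by (rule M.integrable_bounded[of _ "L * \<eta> + B"])
          (auto simp: indicator_def \<open>0 \<le> B\<close> \<open>0 \<le> L\<close> \<open>0 < \<eta>\<close> less_imp_le abs_of_nonneg)
      have E_bound: "M.expectation (\<lambda>\<omega>. L * \<eta> + B * indicator bad \<omega>) \<le> r / 4"
      proof -
        have "M.expectation (\<lambda>\<omega>. L * \<eta> + B * indicator bad \<omega>) = L * \<eta> + B * M.prob bad"
          by (subst Bochner_Integration.integral_add) (auto simp: M.prob_space less_top[symmetric])
        also have "B * M.prob bad \<le> B * p"
          using elim \<open>0 \<le> B\<close> by (intro mult_left_mono) (auto simp: bad_def)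
        finally show ?thesis using L\<eta> Bp by linarith
      qed
      have AE_T: "AE \<omega> in M. real_cond_exp M F T \<omega> = (\<Sum>j\<in>J. I j \<omega> * E (\<eta> * real_of_int j) n \<omega>)"
      proof -
        have "AE \<omega> in M. real_cond_exp M F T \<omega>
            = (\<Sum>j\<in>J. real_cond_exp M F (\<lambda>\<omega>. I j \<omega> * g (U n \<omega> + \<eta> * real_of_int j)) \<omega>)"
          unfolding T_def by (rule S.real_cond_exp_sum[OF int_summand])
        moreover have "AE \<omega> in M. \<forall>j\<in>J. real_cond_exp M F (\<lambda>\<omega>. I j \<omega> * g (U n \<omega> + \<eta> * real_of_int j)) \<omega>
            = I j \<omega> * E (\<eta> * real_of_int j) n \<omega>"
          unfolding E_def by (intro AE_finite_allI S.real_cond_exp_mult I_F int_summand) (auto simp: J_def)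
        ultimately show ?thesis by eventually_elim simp
      qed
      have int_E: "integrable M (\<lambda>\<omega>. \<bar>E s n \<omega> - G s\<bar>)" for s
        unfolding E_def
        by (intro integrable_abs Bochner_Integration.integrable_diff S.real_cond_exp_int M.integrable_bounded[of _ B])
          (auto simp: B G_B)
      have int_1: "integrable M (\<lambda>\<omega>. \<bar>real_cond_exp M F (\<lambda>\<omega>. g (U n \<omega> + V n \<omega>)) \<omega> - real_cond_exp M F T \<omega>\<bar>)"
        using int_T int_g
        by (intro integrable_abs Bochner_Integration.integrable_diff S.real_cond_exp_int)
      have int_2: "integrable M (\<lambda>\<omega>. \<Sum>j\<in>J. \<bar>E (\<eta> * real_of_int j) n \<omega> - G (\<eta> * real_of_int j)\<bar>)"
        using int_E by (rule Bochner_Integration.integrable_sum)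
      \<comment> \<open>Three comparisons: from \<open>g (U + V)\<close> to \<open>T\<close> under
        the conditional expectation (contraction), from the conditional expectation of
        \<open>T\<close> to \<open>H\<close> (finitely many fixed shifts), and from \<open>H\<close>
        to \<open>G (V n)\<close> (rounding).\<close>
      have "M.expectation (\<lambda>\<omega>. \<bar>real_cond_exp M F (\<lambda>\<omega>. g (U n \<omega> + V n \<omega>)) \<omega> - G (V n \<omega>)\<bar>)
          \<le> M.expectation (\<lambda>\<omega>. \<bar>real_cond_exp M F (\<lambda>\<omega>. g (U n \<omega> + V n \<omega>)) \<omega> - real_cond_exp M F T \<omega>\<bar>
            + ((\<Sum>j\<in>J. \<bar>E (\<eta> * real_of_int j) n \<omega> - G (\<eta> * real_of_int j)\<bar>)
            + (L * \<eta> + B * indicator bad \<omega>)))"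
      proof (rule integral_mono_AE')
        show "AE \<omega> in M. \<bar>real_cond_exp M F (\<lambda>\<omega>. g (U n \<omega> + V n \<omega>)) \<omega> - G (V n \<omega>)\<bar>
            \<le> \<bar>real_cond_exp M F (\<lambda>\<omega>. g (U n \<omega> + V n \<omega>)) \<omega> - real_cond_exp M F T \<omega>\<bar>
              + ((\<Sum>j\<in>J. \<bar>E (\<eta> * real_of_int j) n \<omega> - G (\<eta> * real_of_int j)\<bar>)
              + (L * \<eta> + B * indicator bad \<omega>))"
          using AE_T AE_space
        proof eventually_elim
          case (elim \<omega>)
          have "\<bar>real_cond_exp M F T \<omega> - H \<omega>\<bar>
              \<le> (\<Sum>j\<in>J. \<bar>I j \<omega> * E (\<eta> * real_of_int j) n \<omega> - I j \<omega> * G (\<eta> * real_of_int j)\<bar>)"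
            unfolding elim H_def sum_subtractf[symmetric] by (rule sum_abs)
          also have "\<dots> \<le> (\<Sum>j\<in>J. \<bar>E (\<eta> * real_of_int j) n \<omega> - G (\<eta> * real_of_int j)\<bar>)"
            by (rule sum_mono) (auto simp: I_def)
          finally show ?case using H_close[OF elim(2)] by linarith
        qed
        show "integrable M (\<lambda>\<omega>. \<bar>real_cond_exp M F (\<lambda>\<omega>. g (U n \<omega> + V n \<omega>)) \<omega> - real_cond_exp M F T \<omega>\<bar>
              + ((\<Sum>j\<in>J. \<bar>E (\<eta> * real_of_int j) n \<omega> - G (\<eta> * real_of_int j)\<bar>)
              + (L * \<eta> + B * indicator bad \<omega>)))"
          by (intro Bochner_Integration.integrable_add int_1 int_2 int_bound)
        show "AE \<omega> in M. 0 \<le> \<bar>real_cond_exp M F (\<lambda>\<omega>. g (U n \<omega> + V n \<omega>)) \<omega> - real_cond_exp M F T \<omega>\<bar>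
              + ((\<Sum>j\<in>J. \<bar>E (\<eta> * real_of_int j) n \<omega> - G (\<eta> * real_of_int j)\<bar>)
              + (L * \<eta> + B * indicator bad \<omega>))"
          using \<open>0 \<le> B\<close> \<open>0 \<le> L\<close> \<open>0 < \<eta>\<close> by (intro AE_I2 add_nonneg_nonneg sum_nonneg) auto
      qed
      also have "\<dots> = M.expectation (\<lambda>\<omega>. \<bar>real_cond_exp M F (\<lambda>\<omega>. g (U n \<omega> + V n \<omega>)) \<omega> - real_cond_exp M F T \<omega>\<bar>)
            + ((\<Sum>j\<in>J. M.expectation (\<lambda>\<omega>. \<bar>E (\<eta> * real_of_int j) n \<omega> - G (\<eta> * real_of_int j)\<bar>))
            + M.expectation (\<lambda>\<omega>. L * \<eta> + B * indicator bad \<omega>))"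
        using int_1 int_2 int_bound int_E
        by (simp only: Bochner_Integration.integral_add Bochner_Integration.integrable_add Bochner_Integration.integral_sum)
      also have "M.expectation (\<lambda>\<omega>. \<bar>real_cond_exp M F (\<lambda>\<omega>. g (U n \<omega> + V n \<omega>)) \<omega> - real_cond_exp M F T \<omega>\<bar>)
          \<le> M.expectation (\<lambda>\<omega>. \<bar>g (U n \<omega> + V n \<omega>) - T \<omega>\<bar>)"
        by (rule M.cond_exp_contraction[OF sub int_g int_T])
      also have "\<dots> \<le> M.expectation (\<lambda>\<omega>. L * \<eta> + B * indicator bad \<omega>)"
        using T_close int_bound \<open>0 \<le> B\<close> \<open>0 \<le> L\<close> \<open>0 < \<eta>\<close> by (intro integral_mono') auto
      finally show ?case
        using E_bound elim(1) \<open>0 < r\<close> by (simp add: G_def)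
    qed
    then show "\<exists>no. \<forall>n\<ge>no. norm (M.expectation (\<lambda>\<omega>. \<bar>real_cond_exp M F (\<lambda>\<omega>. g (U n \<omega> + V n \<omega>)) \<omega> - shift_mean \<Phi> g (V n \<omega>)\<bar>) - 0) < r"
      by (simp add: eventually_sequentially)
  qed
qed

section \<open>The array: one index sequence at a time\<close>

locale hl_array =
  fixes M :: "'a measure" and F :: "int \<Rightarrow> 'a measure"
    and \<beta> :: "nat \<Rightarrow> real" and X Xpa Xma R :: "nat \<Rightarrow> nat \<Rightarrow> 'a \<Rightarrow> real"
    and N :: "'b measure" and Xp Xm :: "'b \<Rightarrow> real" and \<Phi> :: "real \<Rightarrow> real"
  assumes prob_M: "prob_space M" and prob_N: "prob_space N"
    and HL0: "HL0 M F \<beta> X" and HL1: "HL1 M F \<beta> X Xpa Xma R"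
    and HL2: "HL2 M F \<beta> Xpa Xma N Xp Xm \<Phi>" and HL4: "HL4 M F \<beta> X"
begin

sublocale prob_space M by (rule prob_M)
sublocale N: prob_space N by (rule prob_N)

lemma Phi_nonneg: "0 \<le> \<Phi> x" and Xm_borel[measurable]: "Xm \<in> borel_measurable N"
  and Phi_distributed: "distributed N lborel Xp (\<lambda>x. ennreal (\<Phi> x))"
  and Phi_bounded: "bounded (range \<Phi>)"
  using HL2 by (auto simp: HL2_def)

sublocale density_function \<Phi>
proof
  have [measurable]: "\<Phi> \<in> borel_measurable borel"
    using distributed_real_measurable[OF _ Phi_distributed] Phi_nonneg by simp
  have "(\<integral>\<^sup>+x. ennreal (\<Phi> x) * 1 \<partial>lborel) = (\<integral>\<^sup>+\<omega>. 1 \<partial>N)"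
    by (rule distributed_nn_integral[OF Phi_distributed]) simp
  then have one: "(\<integral>\<^sup>+x. ennreal (\<Phi> x) \<partial>lborel) = 1"
    by (simp add: N.emeasure_space_1)
  show "integrable lborel \<Phi>"
    by (rule integrableI_nonneg) (auto simp: one Phi_nonneg)
  show "(\<integral>x. \<Phi> x \<partial>lborel) = 1"
    by (subst integral_eq_nn_integral) (auto simp: one Phi_nonneg)
qed (rule Phi_nonneg)

lemma sub: "subalgebra M (F t)"
  using HL0 by (simp add: HL0_def)

lemma beta_pos: "n \<ge> 1 \<Longrightarrow> 0 < \<beta> n"
  using HL0 by (simp add: HL0_def)

lemma
  assumes "t \<in> {1..n}"
  shows X_borel: "X n t \<in> borel_measurable M"
    and Xpa_borel: "Xpa n t \<in> borel_measurable M"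
    and Xma_F0: "Xma n t \<in> borel_measurable (F 0)"
    and Xma_borel: "Xma n t \<in> borel_measurable M"
    and R_borel: "R n t \<in> borel_measurable M"
    and X_decomp: "\<omega> \<in> space M \<Longrightarrow> X n t \<omega> = Xpa n t \<omega> + Xma n t \<omega> + R n t \<omega>"
proof -
  have "n \<ge> 1" using assms by auto
  with assms HL0 have "X n t \<in> borel_measurable (F (int t))" by (simp add: HL0_def)
  then show "X n t \<in> borel_measurable M" by (rule measurable_from_subalg[OF sub])
  show "Xpa n t \<in> borel_measurable M" "R n t \<in> borel_measurable M" and F0: "Xma n t \<in> borel_measurable (F 0)"
    and "\<omega> \<in> space M \<Longrightarrow> X n t \<omega> = Xpa n t \<omega> + Xma n t \<omega> + R n t \<omega>"
    using assms \<open>n \<ge> 1\<close> HL1 by (auto simp: HL1_def)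
  show "Xma n t \<in> borel_measurable M" using F0 by (rule measurable_from_subalg[OF sub])
qed

text \<open>The indices are kept in \<open>{1..n}\<close>: for small \<open>n\<close> the floor can
  be 0, where the array has no meaning.\<close>

lemma HL2_at:
  assumes "0 < \<delta>" "\<delta> < 1" "\<And>n. n \<ge> 1 \<Longrightarrow> \<lfloor>real n * \<delta>\<rfloor> \<le> int (\<tau> n)" "\<And>n. n \<ge> 1 \<Longrightarrow> \<tau> n \<in> {1..n}"
  shows Xpa_cond_conv: "\<And>h. continuous_on UNIV h \<Longrightarrow> bounded (range h) \<Longrightarrow>
      conv_in_prob M (\<lambda>n. real_cond_exp M (F 0) (\<lambda>\<omega>. h (Xpa n (\<tau> n) \<omega> / \<beta> n))) (\<lambda>_. \<integral>x. h x * \<Phi> x \<partial>lborel)"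
    and Xma_conv: "conv_in_distr M (\<lambda>n \<omega>. Xma n (\<tau> n) \<omega> / \<beta> n) N Xm"
    and Xma_diff_conv: "conv_in_prob M (\<lambda>n \<omega>. (Xma n n \<omega> - Xma n (\<tau> n) \<omega>) / \<beta> n) (\<lambda>_. 0)"
proof -
  have *: "0 < \<delta> \<and> \<delta> < 1 \<and> (\<forall>n\<ge>1. \<lfloor>real n * \<delta>\<rfloor> \<le> int (\<tau> n) \<and> \<tau> n \<le> n)"
    using assms by fastforce
  from HL2 have H: "\<And>\<delta> \<tau>. 0 < \<delta> \<and> \<delta> < 1 \<and> (\<forall>n\<ge>1. \<lfloor>real n * \<delta>\<rfloor> \<le> int (\<tau> n) \<and> \<tau> n \<le> n) \<Longrightarrow>
        (\<forall>h. continuous_on UNIV h \<and> bounded (range h) \<longrightarrow>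
           conv_in_prob M
             (\<lambda>n. real_cond_exp M (F 0) (\<lambda>\<omega>. h (Xpa n (\<tau> n) \<omega> / \<beta> n)))
             (\<lambda>_. \<integral>x. h x * \<Phi> x \<partial>lborel)) \<and>
        conv_in_distr M (\<lambda>n \<omega>. Xma n (\<tau> n) \<omega> / \<beta> n) N Xm \<and>
        conv_in_prob M (\<lambda>n \<omega>. (Xma n n \<omega> - Xma n (\<tau> n) \<omega>) / \<beta> n) (\<lambda>_. 0)"
    unfolding HL2_def by blast
  from H[OF *] show "\<And>h. continuous_on UNIV h \<Longrightarrow> bounded (range h) \<Longrightarrow>
      conv_in_prob M (\<lambda>n. real_cond_exp M (F 0) (\<lambda>\<omega>. h (Xpa n (\<tau> n) \<omega> / \<beta> n))) (\<lambda>_. \<integral>x. h x * \<Phi> x \<partial>lborel)"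
    and "conv_in_distr M (\<lambda>n \<omega>. Xma n (\<tau> n) \<omega> / \<beta> n) N Xm"
    and "conv_in_prob M (\<lambda>n \<omega>. (Xma n n \<omega> - Xma n (\<tau> n) \<omega>) / \<beta> n) (\<lambda>_. 0)"
    by blast+
qed

text \<open>The endpoint is the common reference for all indices, because HL2(b) compares every
  admissible index with it. Any \<delta> below 1 serves here.\<close>

lemma Xma_endpoint_conv: "conv_in_distr M (\<lambda>n \<omega>. Xma n n \<omega> / \<beta> n) N Xm"
proof (rule Xma_conv[where \<delta> = "1/2" and \<tau> = "\<lambda>n. n"])
  fix n :: nat
  show "\<lfloor>real n * (1 / 2)\<rfloor> \<le> int n" by linarith
qed auto

text \<open>The supremum over \<open>t\<close> in HL1 dominates every choice of index, so no lower
  bound on \<open>\<tau> n\<close> enters.\<close>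

lemma R_trunc_mean:
  assumes "\<And>n. n \<ge> 1 \<Longrightarrow> \<tau> n \<in> {1..n}"
  shows "(\<lambda>n. trunc_mean M (\<lambda>\<omega>. R n (\<tau> n) \<omega> / \<beta> n)) \<longlonglongrightarrow> 0"
proof (rule trunc_mean_LIMSEQ_0)
  fix n :: nat assume "1 \<le> n"
  then show "(\<lambda>\<omega>. R n (\<tau> n) \<omega> / \<beta> n) \<in> borel_measurable M"
    using R_borel[OF assms] by measurable
next
  fix e :: real assume "0 < e"
  show "(\<lambda>n. prob {\<omega> \<in> space M. e < \<bar>R n (\<tau> n) \<omega> / \<beta> n\<bar>}) \<longlonglongrightarrow> 0"
  proof (rule tendsto_sandwich[of "\<lambda>_. 0"])
    show "(\<lambda>n. SUP t\<in>{1..n}. prob {\<omega> \<in> space M. \<bar>R n t \<omega>\<bar> / \<beta> n > e}) \<longlonglongrightarrow> 0"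
      using HL1 \<open>0 < e\<close> by (simp add: HL1_def)
    show "\<forall>\<^sub>F n in sequentially. prob {\<omega> \<in> space M. e < \<bar>R n (\<tau> n) \<omega> / \<beta> n\<bar>}
        \<le> (SUP t\<in>{1..n}. prob {\<omega> \<in> space M. \<bar>R n t \<omega>\<bar> / \<beta> n > e})"
      using eventually_ge_at_top[of 1]
    proof eventually_elim
      case (elim n)
      then have "{\<omega> \<in> space M. e < \<bar>R n (\<tau> n) \<omega> / \<beta> n\<bar>} = {\<omega> \<in> space M. \<bar>R n (\<tau> n) \<omega>\<bar> / \<beta> n > e}"
        using beta_pos[of n] by (simp add: abs_divide)
      then show ?case
        using assms[OF elim] by (auto intro!: cSUP_upper bdd_above_finite)
    qed
  qed auto
qed

text \<open>The remainder \<open>R\<close> is dropped before conditioning by contraction, the random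
  shift lemma handles the sum of the two main parts, and the Lipschitz property of \<open>G\<close>
  moves the shift from index \<open>\<tau> n\<close> to the endpoint. The limit object then no
  longer depends on \<tau>.\<close>

lemma cond_exp_X_LIMSEQ:
  assumes \<delta>: "0 < \<delta>" "\<delta> < 1" "\<And>n. n \<ge> 1 \<Longrightarrow> \<lfloor>real n * \<delta>\<rfloor> \<le> int (\<tau> n)" and \<tau>: "\<And>n. n \<ge> 1 \<Longrightarrow> \<tau> n \<in> {1..n}"
    and L: "L-lipschitz_on UNIV g" and B: "\<And>x. \<bar>g x\<bar> \<le> B"
  shows "(\<lambda>n. expectation (\<lambda>\<omega>. \<bar>real_cond_exp M (F 0) (\<lambda>\<omega>. g (X n (\<tau> n) \<omega> / \<beta> n)) \<omega>
      - shift_mean \<Phi> g (Xma n n \<omega> / \<beta> n)\<bar>)) \<longlonglongrightarrow> 0"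
proof -
  interpret S: finite_measure_subalgebra M "F 0" using sub by unfold_locales
  note [measurable] = lipschitz_borel[OF L]
  have "0 \<le> L" using L by (rule lipschitz_on_nonneg)
  have "0 \<le> B" using B[of 0] by linarith
  define G where "G = shift_mean \<Phi> g"
  have G_L: "L-lipschitz_on UNIV G" unfolding G_def by (rule shift_mean_lipschitz[OF L B])
  note [measurable] = lipschitz_borel[OF G_L]
  have G_B: "\<bar>G y\<bar> \<le> B" for y unfolding G_def by (rule shift_mean_bounded) (auto intro: B)
  define U V W where "U n \<omega> = Xpa n (\<tau> n) \<omega> / \<beta> n" and "V n \<omega> = Xma n (\<tau> n) \<omega> / \<beta> n"
    and "W n \<omega> = Xma n n \<omega> / \<beta> n" for n \<omega>
  define ce where "ce = real_cond_exp M (F 0)"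
  \<comment> \<open>Large enough to be a Lipschitz constant and a bound on differences at once, for
    both \<open>g\<close> and \<open>G\<close>.\<close>
  define C where "C = 1 + L + 2 * B"
  have small: "\<bar>k a - k b\<bar> \<le> C * \<bar>a - b\<bar>" "\<bar>k a - k b\<bar> \<le> C"
    if "L-lipschitz_on UNIV k" "\<And>x. \<bar>k x\<bar> \<le> B" for k :: "real \<Rightarrow> real" and a b
  proof -
    have "\<bar>k a - k b\<bar> \<le> L * \<bar>a - b\<bar>"
      using that(1) unfolding lipschitz_UNIV_real_iff dist_real_def by blast
    also have "\<dots> \<le> C * \<bar>a - b\<bar>" using \<open>0 \<le> B\<close> by (intro mult_right_mono) (auto simp: C_def)
    finally show "\<bar>k a - k b\<bar> \<le> C * \<bar>a - b\<bar>" .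
    show "\<bar>k a - k b\<bar> \<le> C" using that(2)[of a] that(2)[of b] \<open>0 \<le> L\<close> unfolding C_def by linarith
  qed
  have mid: "(\<lambda>n. expectation (\<lambda>\<omega>. \<bar>ce (\<lambda>\<omega>. g (U n \<omega> + V n \<omega>)) \<omega> - G (V n \<omega>)\<bar>)) \<longlonglongrightarrow> 0"
    unfolding ce_def G_def
  proof (rule cond_exp_shift_mean_LIMSEQ[OF prob_M sub _ _ _ _ L B])
    fix n :: nat assume n: "1 \<le> n"
    note [measurable] = Xpa_borel[OF \<tau>[OF n]] Xma_F0[OF \<tau>[OF n]]
    show "U n \<in> borel_measurable M" "V n \<in> borel_measurable (F 0)"
      unfolding U_def V_def by measurable
  next
    fix h :: "real \<Rightarrow> real" assume "continuous_on UNIV h" "bounded (range h)"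
    then show "conv_in_prob M (\<lambda>n. real_cond_exp M (F 0) (\<lambda>\<omega>. h (U n \<omega>))) (\<lambda>_. \<integral>x. h x * \<Phi> x \<partial>lborel)"
      unfolding U_def by (intro Xpa_cond_conv[where \<delta> = \<delta>] \<delta> \<tau>)
  next
    fix e :: real assume e: "0 < e"
    show "\<exists>K. \<forall>\<^sub>F n in sequentially. prob {\<omega> \<in> space M. K < \<bar>V n \<omega>\<bar>} < e"
    proof (rule conv_in_distr_tight[OF prob_M prob_N Xm_borel _ _ e])
      show "conv_in_distr M V N Xm" unfolding V_def by (rule Xma_conv[OF \<delta> \<tau>])
      fix n :: nat assume n: "1 \<le> n"
      note [measurable] = Xma_borel[OF \<tau>[OF n]]
      show "V n \<in> borel_measurable M" unfolding V_def by measurable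
    qed
  qed
  have R0: "(\<lambda>n. trunc_mean M (\<lambda>\<omega>. R n (\<tau> n) \<omega> / \<beta> n)) \<longlonglongrightarrow> 0"
    by (rule R_trunc_mean[OF \<tau>])
  have D0: "(\<lambda>n. trunc_mean M (\<lambda>\<omega>. (Xma n n \<omega> - Xma n (\<tau> n) \<omega>) / \<beta> n - 0)) \<longlonglongrightarrow> 0"
  proof (rule conv_in_prob_trunc_mean[OF Xma_diff_conv[OF \<delta> \<tau>]])
    fix n :: nat assume n: "1 \<le> n"
    have nn: "n \<in> {1..n}" using n by simp
    note [measurable] = Xma_borel[OF \<tau>[OF n]] Xma_borel[OF nn]
    show "(\<lambda>\<omega>. (Xma n n \<omega> - Xma n (\<tau> n) \<omega>) / \<beta> n) \<in> borel_measurable M"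
      by measurable
  qed auto
  show ?thesis
  proof (rule tendsto_sandwich[of "\<lambda>_. 0"])
    show "(\<lambda>n. C * trunc_mean M (\<lambda>\<omega>. R n (\<tau> n) \<omega> / \<beta> n)
        + (expectation (\<lambda>\<omega>. \<bar>ce (\<lambda>\<omega>. g (U n \<omega> + V n \<omega>)) \<omega> - G (V n \<omega>)\<bar>)
        + C * trunc_mean M (\<lambda>\<omega>. (Xma n n \<omega> - Xma n (\<tau> n) \<omega>) / \<beta> n - 0))) \<longlonglongrightarrow> 0"
      by (intro tendsto_add_zero tendsto_mult_right_zero R0 D0 mid)
    show "\<forall>\<^sub>F n in sequentially. expectation (\<lambda>\<omega>. \<bar>real_cond_exp M (F 0) (\<lambda>\<omega>. g (X n (\<tau> n) \<omega> / \<beta> n)) \<omega>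
        - shift_mean \<Phi> g (Xma n n \<omega> / \<beta> n)\<bar>) \<le> C * trunc_mean M (\<lambda>\<omega>. R n (\<tau> n) \<omega> / \<beta> n)
        + (expectation (\<lambda>\<omega>. \<bar>ce (\<lambda>\<omega>. g (U n \<omega> + V n \<omega>)) \<omega> - G (V n \<omega>)\<bar>)
        + C * trunc_mean M (\<lambda>\<omega>. (Xma n n \<omega> - Xma n (\<tau> n) \<omega>) / \<beta> n - 0))"
      using eventually_ge_at_top[of 1]
    proof eventually_elim
      case (elim n)
      have n: "n \<in> {1..n}" using elim by simp
      note [measurable] = Xma_borel[OF \<tau>[OF elim]] Xma_borel[OF n] Xpa_borel[OF \<tau>[OF elim]]
        R_borel[OF \<tau>[OF elim]] X_borel[OF \<tau>[OF elim]]
      have UV: "g (U n \<omega> + V n \<omega>) = g ((Xpa n (\<tau> n) \<omega> + Xma n (\<tau> n) \<omega>) / \<beta> n)" for \<omega>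
        by (simp add: U_def V_def add_divide_distrib)
      have int_X: "integrable M (\<lambda>\<omega>. g (X n (\<tau> n) \<omega> / \<beta> n))"
        and int_UV: "integrable M (\<lambda>\<omega>. g (U n \<omega> + V n \<omega>))"
        and int_V: "integrable M (\<lambda>\<omega>. G (V n \<omega>))" and int_W: "integrable M (\<lambda>\<omega>. G (W n \<omega>))"
        by (rule integrable_bounded[of _ B]; auto simp: B G_B U_def V_def W_def)+
      have int_1: "integrable M (\<lambda>\<omega>. \<bar>ce (\<lambda>\<omega>. g (X n (\<tau> n) \<omega> / \<beta> n)) \<omega> - ce (\<lambda>\<omega>. g (U n \<omega> + V n \<omega>)) \<omega>\<bar>)"
        and int_2: "integrable M (\<lambda>\<omega>. \<bar>ce (\<lambda>\<omega>. g (U n \<omega> + V n \<omega>)) \<omega> - G (V n \<omega>)\<bar>)"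
        and int_3: "integrable M (\<lambda>\<omega>. \<bar>G (V n \<omega>) - G (W n \<omega>)\<bar>)"
        unfolding ce_def
        by (intro integrable_abs Bochner_Integration.integrable_diff S.real_cond_exp_int int_X int_UV int_V int_W)+
      have "expectation (\<lambda>\<omega>. \<bar>ce (\<lambda>\<omega>. g (X n (\<tau> n) \<omega> / \<beta> n)) \<omega> - G (W n \<omega>)\<bar>)
          \<le> expectation (\<lambda>\<omega>. \<bar>ce (\<lambda>\<omega>. g (X n (\<tau> n) \<omega> / \<beta> n)) \<omega> - ce (\<lambda>\<omega>. g (U n \<omega> + V n \<omega>)) \<omega>\<bar>
            + (\<bar>ce (\<lambda>\<omega>. g (U n \<omega> + V n \<omega>)) \<omega> - G (V n \<omega>)\<bar> + \<bar>G (V n \<omega>) - G (W n \<omega>)\<bar>))"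
        by (rule integral_mono') (intro Bochner_Integration.integrable_add int_1 int_2 int_3, linarith+)
      also have "\<dots> = expectation (\<lambda>\<omega>. \<bar>ce (\<lambda>\<omega>. g (X n (\<tau> n) \<omega> / \<beta> n)) \<omega> - ce (\<lambda>\<omega>. g (U n \<omega> + V n \<omega>)) \<omega>\<bar>)
            + (expectation (\<lambda>\<omega>. \<bar>ce (\<lambda>\<omega>. g (U n \<omega> + V n \<omega>)) \<omega> - G (V n \<omega>)\<bar>)
            + expectation (\<lambda>\<omega>. \<bar>G (V n \<omega>) - G (W n \<omega>)\<bar>))"
        using int_1 int_2 int_3
        by (simp only: Bochner_Integration.integral_add Bochner_Integration.integrable_add)
      also have "expectation (\<lambda>\<omega>. \<bar>ce (\<lambda>\<omega>. g (X n (\<tau> n) \<omega> / \<beta> n)) \<omega> - ce (\<lambda>\<omega>. g (U n \<omega> + V n \<omega>)) \<omega>\<bar>)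
          \<le> expectation (\<lambda>\<omega>. \<bar>g (X n (\<tau> n) \<omega> / \<beta> n) - g (U n \<omega> + V n \<omega>)\<bar>)"
        unfolding ce_def by (rule cond_exp_contraction[OF sub int_X int_UV])
      also have "\<dots> \<le> C * trunc_mean M (\<lambda>\<omega>. R n (\<tau> n) \<omega> / \<beta> n)"
      proof (rule expectation_abs_le_trunc_mean)
        have "\<bar>g (X n (\<tau> n) \<omega> / \<beta> n) - g (U n \<omega> + V n \<omega>)\<bar> \<le> C * \<bar>R n (\<tau> n) \<omega> / \<beta> n\<bar>" if "\<omega> \<in> space M" for \<omega>
        proof -
          have "X n (\<tau> n) \<omega> / \<beta> n - (U n \<omega> + V n \<omega>) = R n (\<tau> n) \<omega> / \<beta> n"
            by (simp add: X_decomp[OF \<tau>[OF elim] that] U_def V_def add_divide_distrib)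
          then show ?thesis using small(1)[OF L B] by metis
        qed
        then show "AE \<omega> in M. \<bar>g (X n (\<tau> n) \<omega> / \<beta> n) - g (U n \<omega> + V n \<omega>)\<bar> \<le> C * \<bar>R n (\<tau> n) \<omega> / \<beta> n\<bar>"
          by (rule AE_I2)
      qed (auto intro!: AE_I2 small(2)[OF L B])
      also have "expectation (\<lambda>\<omega>. \<bar>G (V n \<omega>) - G (W n \<omega>)\<bar>)
          \<le> C * trunc_mean M (\<lambda>\<omega>. (Xma n n \<omega> - Xma n (\<tau> n) \<omega>) / \<beta> n - 0)"
      proof (rule expectation_abs_le_trunc_mean)
        have "\<bar>G (V n \<omega>) - G (W n \<omega>)\<bar> \<le> C * \<bar>(Xma n n \<omega> - Xma n (\<tau> n) \<omega>) / \<beta> n - 0\<bar>" for \<omega>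
        proof -
          have "\<bar>V n \<omega> - W n \<omega>\<bar> = \<bar>(Xma n n \<omega> - Xma n (\<tau> n) \<omega>) / \<beta> n - 0\<bar>"
            by (simp add: V_def W_def diff_divide_distrib abs_minus_commute)
          then show ?thesis using small(1)[OF G_L G_B] by metis
        qed
        then show "AE \<omega> in M. \<bar>G (V n \<omega>) - G (W n \<omega>)\<bar> \<le> C * \<bar>(Xma n n \<omega> - Xma n (\<tau> n) \<omega>) / \<beta> n - 0\<bar>"
          by (intro AE_I2)
      qed (auto intro!: AE_I2 small(2)[OF G_L G_B])
      finally show ?case by (simp add: ce_def G_def W_def)
    qed
  qed auto
qed

end

section \<open>Averages of bounded Lipschitz functions\<close>

context hl_array begin

text \<open>Below the floor of \<open>n * \<delta>\<close> HL2 is silent, but those indices form at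
  most a fraction \<delta> of all and each contributes at most \<open>2 * B\<close>. All the others
  are dominated by a single sequence of indices.\<close>

lemma average_cond_exp_LIMSEQ:
  assumes L: "L-lipschitz_on UNIV g" and B: "\<And>x. \<bar>g x\<bar> \<le> B"
  shows "(\<lambda>n. (\<Sum>t=1..n. expectation (\<lambda>\<omega>. \<bar>real_cond_exp M (F 0) (\<lambda>\<omega>. g (X n t \<omega> / \<beta> n)) \<omega>
      - shift_mean \<Phi> g (Xma n n \<omega> / \<beta> n)\<bar>)) / real n) \<longlonglongrightarrow> 0"
proof -
  define err where "err n t = expectation (\<lambda>\<omega>. \<bar>real_cond_exp M (F 0) (\<lambda>\<omega>. g (X n t \<omega> / \<beta> n)) \<omega>
      - shift_mean \<Phi> g (Xma n n \<omega> / \<beta> n)\<bar>)" for n t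
  have "0 \<le> B" using B[of 0] by linarith
  note [measurable] = lipschitz_borel[OF L]
  have err_nonneg: "0 \<le> err n t" for n t
    unfolding err_def by (rule integral_nonneg_AE) auto
  have err_le: "err n t \<le> 2 * B" if "t \<in> {1..n}" for n t
  proof -
    note [measurable] = X_borel[OF that]
    have "AE \<omega> in M. \<bar>real_cond_exp M (F 0) (\<lambda>\<omega>. g (X n t \<omega> / \<beta> n)) \<omega>\<bar> \<le> B"
      by (rule cond_exp_abs_le[OF sub]) (auto intro: B)
    then have "AE \<omega> in M. \<bar>real_cond_exp M (F 0) (\<lambda>\<omega>. g (X n t \<omega> / \<beta> n)) \<omega>
      - shift_mean \<Phi> g (Xma n n \<omega> / \<beta> n)\<bar> \<le> 2 * B"
    proof eventually_elim
      case (elim \<omega>)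
      moreover have "\<bar>shift_mean \<Phi> g (Xma n n \<omega> / \<beta> n)\<bar> \<le> B"
        by (rule shift_mean_bounded) (auto intro: B)
      ultimately show ?case by linarith
    qed
    then have "err n t \<le> (\<integral>\<omega>. 2 * B \<partial>M)"
      unfolding err_def using \<open>0 \<le> B\<close> by (intro integral_mono_AE') auto
    then show ?thesis by (simp add: prob_space)
  qed
  show ?thesis
    unfolding err_def[symmetric]
  proof (rule LIMSEQ_I)
    fix r :: real assume "0 < r"
    \<comment> \<open>The second entry makes the early indices cost at most \<open>r / 2\<close>;
      the first keeps \<delta> below 1, as HL2 demands.\<close>
    define \<delta> where "\<delta> = min (1 / 2) (r / (2 * B + 1) / 2)"
    have \<delta>: "0 < \<delta>" "\<delta> < 1" using \<open>0 < r\<close> \<open>0 \<le> B\<close> by (auto simp: \<delta>_def)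
    have B\<delta>: "2 * B * \<delta> \<le> r / 2"
    proof -
      have "2 * B * \<delta> \<le> (2 * B + 1) * (r / (2 * B + 1) / 2)"
        using \<open>0 \<le> B\<close> \<delta> by (intro mult_mono) (auto simp: \<delta>_def)
      also have "\<dots> = r / 2"
        unfolding times_divide_eq_right using \<open>0 \<le> B\<close> by (subst nonzero_mult_div_cancel_left) auto
      finally show ?thesis .
    qed
    \<comment> \<open>HL2 gives convergence along each sequence \<open>\<tau>\<close>; choosing the worst index for each \<open>n\<close> makes it uniform in \<open>t\<close>.\<close>
    have "\<exists>s. s \<in> {1..n} \<and> \<lfloor>real n * \<delta>\<rfloor> \<le> int s \<and> (\<forall>t\<in>{1..n}. \<lfloor>real n * \<delta>\<rfloor> \<le> int t \<longrightarrow> err n t \<le> err n s)"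
      if "1 \<le> n" for n
    proof -
      define S where "S = {t \<in> {1..n}. \<lfloor>real n * \<delta>\<rfloor> \<le> int t}"
      have "real n * \<delta> \<le> real n * 1" using \<delta> by (intro mult_left_mono) auto
      then have "\<lfloor>real n * \<delta>\<rfloor> \<le> int n" by linarith
      with that have "n \<in> S" by (simp add: S_def)
      then have "Max (err n ` S) \<in> err n ` S" by (intro Max_in) (auto simp: S_def)
      then obtain s where s: "s \<in> S" "err n s = Max (err n ` S)" by auto
      have "err n t \<le> err n s" if "t \<in> S" for t
        unfolding s(2) using that by (intro Max_ge) (auto simp: S_def)
      with s(1) show ?thesis unfolding S_def by blast
    qed
    then have "\<forall>n. \<exists>s. 1 \<le> n \<longrightarrow> s \<in> {1..n} \<and> \<lfloor>real n * \<delta>\<rfloor> \<le> int s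
        \<and> (\<forall>t\<in>{1..n}. \<lfloor>real n * \<delta>\<rfloor> \<le> int t \<longrightarrow> err n t \<le> err n s)"
      by blast
    then obtain \<tau> where "\<forall>n. 1 \<le> n \<longrightarrow> \<tau> n \<in> {1..n} \<and> \<lfloor>real n * \<delta>\<rfloor> \<le> int (\<tau> n)
        \<and> (\<forall>t\<in>{1..n}. \<lfloor>real n * \<delta>\<rfloor> \<le> int t \<longrightarrow> err n t \<le> err n (\<tau> n))"
      by (rule exE[OF choice])
    then have \<tau>: "\<And>n. 1 \<le> n \<Longrightarrow> \<tau> n \<in> {1..n}" "\<And>n. 1 \<le> n \<Longrightarrow> \<lfloor>real n * \<delta>\<rfloor> \<le> int (\<tau> n)"
      and \<tau>_max: "\<And>n t. t \<in> {1..n} \<Longrightarrow> 1 \<le> n \<Longrightarrow> \<lfloor>real n * \<delta>\<rfloor> \<le> int t \<Longrightarrow> err n t \<le> err n (\<tau> n)"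
      by blast+
    have "(\<lambda>n. err n (\<tau> n)) \<longlonglongrightarrow> 0"
      unfolding err_def by (rule cond_exp_X_LIMSEQ[OF \<delta> \<tau>(2) \<tau>(1) L B])
    then have "\<forall>\<^sub>F n in sequentially. err n (\<tau> n) < r / 2"
      using \<open>0 < r\<close> by (intro order_tendstoD(2)) auto
    then have "\<forall>\<^sub>F n in sequentially. norm ((\<Sum>t=1..n. err n t) / real n - 0) < r"
      using eventually_ge_at_top[of 1]
    proof eventually_elim
      case (elim n)
      \<comment> \<open>The two ranges overlap at the floor itself, which only weakens the bound.
        Because \<open>t\<close> starts at 1, the second range has at most
        \<open>n * \<delta>\<close> elements.\<close>
      have "(\<Sum>t=1..n. err n t) \<le> (\<Sum>t=1..n. err n (\<tau> n) + 2 * B * indicator {..nat \<lfloor>real n * \<delta>\<rfloor>} t)"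
      proof (rule sum_mono)
        fix t assume t: "t \<in> {1..n}"
        show "err n t \<le> err n (\<tau> n) + 2 * B * indicator {..nat \<lfloor>real n * \<delta>\<rfloor>} t"
        proof (cases "\<lfloor>real n * \<delta>\<rfloor> \<le> int t")
          case True
          then show ?thesis using \<tau>_max[OF t \<open>1 \<le> n\<close>] \<open>0 \<le> B\<close> by (simp add: indicator_def)
        next
          case False
          then have "t \<le> nat \<lfloor>real n * \<delta>\<rfloor>" by linarith
          then show ?thesis using err_le[OF t] err_nonneg[of n "\<tau> n"] by (simp add: indicator_def)
        qed
      qed
      also have "\<dots> = real n * err n (\<tau> n) + 2 * B * (\<Sum>t=1..n. indicator {..nat \<lfloor>real n * \<delta>\<rfloor>} t)"
        by (simp add: sum.distrib sum_distrib_left)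
      also have "(\<Sum>t=1..n. indicator {..nat \<lfloor>real n * \<delta>\<rfloor>} t) = real (card ({1..n} \<inter> {..nat \<lfloor>real n * \<delta>\<rfloor>}))"
        unfolding indicator_def by (subst sum_of_bool_eq) (auto simp: Int_def)
      also have "card ({1..n} \<inter> {..nat \<lfloor>real n * \<delta>\<rfloor>}) \<le> card {1..nat \<lfloor>real n * \<delta>\<rfloor>}"
        by (intro card_mono) auto
      also have "real (card {1..nat \<lfloor>real n * \<delta>\<rfloor>}) \<le> real n * \<delta>"
        using \<delta> by simp
      finally have "(\<Sum>t=1..n. err n t) \<le> real n * err n (\<tau> n) + 2 * B * (real n * \<delta>)"
        using \<open>0 \<le> B\<close> by (simp add: mult_left_mono)
      also have "\<dots> = real n * (err n (\<tau> n) + 2 * B * \<delta>)" by (simp add: algebra_simps)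
      finally have "(\<Sum>t=1..n. err n t) / real n \<le> err n (\<tau> n) + 2 * B * \<delta>"
        using elim by (simp add: divide_le_eq mult.commute)
      also have "\<dots> < r" using elim B\<delta> by linarith
      finally show ?case using err_nonneg by (simp add: sum_nonneg)
    qed
    then show "\<exists>no. \<forall>n\<ge>no. norm ((\<Sum>t=1..n. err n t) / real n - 0) < r"
      by (simp add: eventually_sequentially)
  qed
qed

lemma average_lipschitz_LIMSEQ:
  assumes L: "L-lipschitz_on UNIV g" and B: "\<And>x. \<bar>g x\<bar> \<le> B"
  shows "(\<lambda>n. trunc_mean M (\<lambda>\<omega>. (\<Sum>t=1..n. g (X n t \<omega> / \<beta> n)) / real n
      - shift_mean \<Phi> g (Xma n n \<omega> / \<beta> n))) \<longlonglongrightarrow> 0"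
proof -
  interpret S: finite_measure_subalgebra M "F 0" using sub by unfold_locales
  note [measurable] = lipschitz_borel[OF L]
  define G where "G = shift_mean \<Phi> g"
  have G_L: "L-lipschitz_on UNIV G" unfolding G_def by (rule shift_mean_lipschitz[OF L B])
  note [measurable] = lipschitz_borel[OF G_L]
  have G_B: "\<bar>G y\<bar> \<le> B" for y unfolding G_def by (rule shift_mean_bounded) (auto intro: B)
  define ce where "ce n t = real_cond_exp M (F 0) (\<lambda>\<omega>. g (X n t \<omega> / \<beta> n))" for n t
  have ce_meas[measurable]: "ce n t \<in> borel_measurable M" for n t by (simp add: ce_def)
  have avg_meas: "(\<lambda>\<omega>. (\<Sum>t=1..n. g (X n t \<omega> / \<beta> n)) / real n) \<in> borel_measurable M" for n
    by (intro borel_measurable_divide borel_measurable_sum measurable_compose[OF _ lipschitz_borel[OF L]] X_borel) auto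
  have cp: "conv_in_prob M (\<lambda>n \<omega>. (\<Sum>t=1..n. g (X n t \<omega> / \<beta> n)) / real n
      - (\<Sum>t=1..n. ce n t \<omega>) / real n) (\<lambda>_. 0)"
    using HL4 L B unfolding HL4_def ce_def by (auto simp: bounded_iff)
  have D0: "(\<lambda>n. trunc_mean M (\<lambda>\<omega>. (\<Sum>t=1..n. g (X n t \<omega> / \<beta> n)) / real n
      - (\<Sum>t=1..n. ce n t \<omega>) / real n - 0)) \<longlonglongrightarrow> 0"
    by (rule conv_in_prob_trunc_mean[OF cp borel_measurable_diff[OF avg_meas]]) auto
  show ?thesis
  proof (rule tendsto_sandwich[of "\<lambda>_. 0"])
    show "(\<lambda>n. trunc_mean M (\<lambda>\<omega>. (\<Sum>t=1..n. g (X n t \<omega> / \<beta> n)) / real n - (\<Sum>t=1..n. ce n t \<omega>) / real n - 0)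
        + (\<Sum>t=1..n. expectation (\<lambda>\<omega>. \<bar>ce n t \<omega> - G (Xma n n \<omega> / \<beta> n)\<bar>)) / real n) \<longlonglongrightarrow> 0"
      unfolding ce_def G_def
      by (rule tendsto_add_zero[OF D0[unfolded ce_def] average_cond_exp_LIMSEQ[OF L B]])
    show "\<forall>\<^sub>F n in sequentially. trunc_mean M (\<lambda>\<omega>. (\<Sum>t=1..n. g (X n t \<omega> / \<beta> n)) / real n
        - shift_mean \<Phi> g (Xma n n \<omega> / \<beta> n))
        \<le> trunc_mean M (\<lambda>\<omega>. (\<Sum>t=1..n. g (X n t \<omega> / \<beta> n)) / real n - (\<Sum>t=1..n. ce n t \<omega>) / real n - 0)
        + (\<Sum>t=1..n. expectation (\<lambda>\<omega>. \<bar>ce n t \<omega> - G (Xma n n \<omega> / \<beta> n)\<bar>)) / real n"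
      using eventually_ge_at_top[of 1]
    proof eventually_elim
      case (elim n)
      have n: "n \<in> {1..n}" using elim by simp
      note [measurable] = Xma_borel[OF n]
      have int_ce: "integrable M (ce n t)" if "t \<in> {1..n}" for t
      proof -
        note [measurable] = X_borel[OF that]
        show ?thesis unfolding ce_def
          by (intro S.real_cond_exp_int integrable_bounded[of _ B]) (auto intro: B)
      qed
      have int_G: "integrable M (\<lambda>\<omega>. G (Xma n n \<omega> / \<beta> n))"
        by (rule integrable_bounded[of _ B]) (auto intro: G_B)
      have int_d: "integrable M (\<lambda>\<omega>. \<bar>ce n t \<omega> - G (Xma n n \<omega> / \<beta> n)\<bar>)" if "t \<in> {1..n}" for t
        by (intro integrable_abs Bochner_Integration.integrable_diff int_ce int_G that)
      have "trunc_mean M (\<lambda>\<omega>. (\<Sum>t=1..n. g (X n t \<omega> / \<beta> n)) / real n - G (Xma n n \<omega> / \<beta> n))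
          \<le> trunc_mean M (\<lambda>\<omega>. (\<Sum>t=1..n. g (X n t \<omega> / \<beta> n)) / real n - (\<Sum>t=1..n. ce n t \<omega>) / real n - 0)
            + trunc_mean M (\<lambda>\<omega>. (\<Sum>t=1..n. ce n t \<omega>) / real n - G (Xma n n \<omega> / \<beta> n))"
      proof (rule trunc_mean_add_le)
        show "(\<lambda>\<omega>. (\<Sum>t=1..n. g (X n t \<omega> / \<beta> n)) / real n - (\<Sum>t=1..n. ce n t \<omega>) / real n - 0) \<in> borel_measurable M"
          using avg_meas by measurable
        show "(\<lambda>\<omega>. (\<Sum>t=1..n. ce n t \<omega>) / real n - G (Xma n n \<omega> / \<beta> n)) \<in> borel_measurable M"
          by measurable
      qed (rule AE_I2, linarith)
      also have "trunc_mean M (\<lambda>\<omega>. (\<Sum>t=1..n. ce n t \<omega>) / real n - G (Xma n n \<omega> / \<beta> n))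
          \<le> expectation (\<lambda>\<omega>. \<bar>(\<Sum>t=1..n. ce n t \<omega>) / real n - G (Xma n n \<omega> / \<beta> n)\<bar>)"
        by (rule trunc_mean_le_expectation)
          (intro Bochner_Integration.integrable_diff integrable_divide Bochner_Integration.integrable_sum int_ce int_G)
      also have "\<dots> \<le> expectation (\<lambda>\<omega>. (\<Sum>t=1..n. \<bar>ce n t \<omega> - G (Xma n n \<omega> / \<beta> n)\<bar>) / real n)"
      proof (rule integral_mono')
        fix \<omega>
        \<comment> \<open>The reference value is the same for every \<open>t\<close>, so it goes
          inside the average and the individual L^1 errors can be averaged.\<close>
        have "(\<Sum>t=1..n. ce n t \<omega>) / real n - G (Xma n n \<omega> / \<beta> n) = (\<Sum>t=1..n. ce n t \<omega> - G (Xma n n \<omega> / \<beta> n)) / real n"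
          using elim by (simp add: sum_subtractf diff_divide_distrib)
        then show "\<bar>(\<Sum>t=1..n. ce n t \<omega>) / real n - G (Xma n n \<omega> / \<beta> n)\<bar>
            \<le> (\<Sum>t=1..n. \<bar>ce n t \<omega> - G (Xma n n \<omega> / \<beta> n)\<bar>) / real n"
          by (simp add: abs_divide divide_right_mono sum_abs)
      qed (auto intro!: integrable_divide Bochner_Integration.integrable_sum int_d sum_nonneg divide_nonneg_nonneg simp del: integrable_abs_iff)
      also have "\<dots> = (\<Sum>t=1..n. expectation (\<lambda>\<omega>. \<bar>ce n t \<omega> - G (Xma n n \<omega> / \<beta> n)\<bar>)) / real n"
        using int_d by (simp add: Bochner_Integration.integral_sum)
      finally show ?case by (simp add: G_def)
    qed
  qed (auto simp: trunc_mean_nonneg)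
qed

end

section \<open>Density bounds for averages, and test functions for weak convergence\<close>

text \<open>The density belongs to \<open>Y / b\<close> but \<open>k\<close> is evaluated at
  \<open>Y / c\<close>; the linear substitution between the two scales produces the Jacobian
  \<open>c / b\<close>. With \<beta>_t for \<open>b\<close> and \<beta>_n for \<open>c\<close> this
  is the origin of the weights in HL6.\<close>

lemma distributed_rescaled_nn_integral_le:
  assumes D: "distributed M lborel (\<lambda>\<omega>. Y \<omega> / b) D" and C: "\<And>x. D x \<le> C"
    and [measurable]: "k \<in> borel_measurable borel" and "0 < b" "0 < c"
  shows "(\<integral>\<^sup>+\<omega>. k (Y \<omega> / c) \<partial>M) \<le> C * (ennreal (c / b) * (\<integral>\<^sup>+x. k x \<partial>lborel))"
proof -
  have "(\<integral>\<^sup>+\<omega>. k (Y \<omega> / c) \<partial>M) = (\<integral>\<^sup>+\<omega>. k (0 + b / c * (Y \<omega> / b)) \<partial>M)"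
    using \<open>0 < b\<close> by simp
  also have "\<dots> = (\<integral>\<^sup>+x. D x * k (0 + b / c * x) \<partial>lborel)"
    by (rule distributed_nn_integral[OF D, symmetric]) measurable
  also have "\<dots> \<le> (\<integral>\<^sup>+x. C * k (0 + b / c * x) \<partial>lborel)"
    by (intro nn_integral_mono mult_right_mono C) auto
  also have "\<dots> = C * (\<integral>\<^sup>+x. k (0 + b / c * x) \<partial>lborel)"
    by (rule nn_integral_cmult) measurable
  \<comment> \<open>The factors \<open>c / b\<close> and \<open>b / c\<close> cancel; they are
    inserted so that the inner expression has the shape of the affine substitution rule, as does the
    summand 0.\<close>
  also have "(\<integral>\<^sup>+x. k (0 + b / c * x) \<partial>lborel)
      = ennreal (c / b) * (ennreal \<bar>b / c\<bar> * (\<integral>\<^sup>+x. k (0 + b / c * x) \<partial>lborel))"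
    using \<open>0 < b\<close> \<open>0 < c\<close> by (simp add: mult.assoc[symmetric] ennreal_mult[symmetric])
  also have "ennreal \<bar>b / c\<bar> * (\<integral>\<^sup>+x. k (0 + b / c * x) \<partial>lborel) = (\<integral>\<^sup>+x. k x \<partial>lborel)"
    using \<open>0 < b\<close> \<open>0 < c\<close> by (subst nn_integral_real_affine[of k "b / c" 0]) auto
  finally show ?thesis .
qed

text \<open>\<open>cts_step a b\<close> takes values in [0, 1] and has slope at most
  \<open>1 / (b - a)\<close>; adding the two constants covers small and large distances at once.
  These functions suffice to establish weak convergence, so a truncated mean controls everything
  that has to be compared.\<close>

lemma abs_cts_step_diff_le:
  assumes "a < b"
  shows "\<bar>cts_step a b x - cts_step a b y\<bar> \<le> (1 + 1 / (b - a)) * min 1 \<bar>x - y\<bar>"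
proof -
  have clip: "cts_step a b x = max 0 (min 1 ((b - x) / (b - a)))" for x
    using assms by (auto simp: cts_step_def max_def min_def field_simps)
  have "\<bar>cts_step a b x - cts_step a b y\<bar> \<le> \<bar>(b - x) / (b - a) - (b - y) / (b - a)\<bar>"
    unfolding clip by linarith
  also have "\<dots> = 1 / (b - a) * \<bar>x - y\<bar>"
    using assms by (simp add: abs_divide abs_minus_commute flip: diff_divide_distrib)
  finally have 1: "\<bar>cts_step a b x - cts_step a b y\<bar> \<le> 1 / (b - a) * \<bar>x - y\<bar>" .
  have "\<bar>cts_step a b x - cts_step a b y\<bar> \<le> 1" unfolding clip by linarith
  moreover have "0 < 1 / (b - a)" using assms by simp
  ultimately have "\<bar>cts_step a b x - cts_step a b y\<bar> \<le> 1 + 1 / (b - a)"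
    "\<bar>cts_step a b x - cts_step a b y\<bar> \<le> (1 + 1 / (b - a)) * \<bar>x - y\<bar>"
    using 1 by (linarith, simp add: distrib_right)
  then show ?thesis by (simp add: min_def)
qed

lemma (in prob_space) expectation_cts_step_diff_le:
  assumes [measurable]: "U \<in> borel_measurable M" "V \<in> borel_measurable M" and "a < b"
  shows "\<bar>expectation (\<lambda>\<omega>. cts_step a b (U \<omega>)) - expectation (\<lambda>\<omega>. cts_step a b (V \<omega>))\<bar>
    \<le> (1 + 1 / (b - a)) * trunc_mean M (\<lambda>\<omega>. U \<omega> - V \<omega>)"
proof -
  have [measurable]: "cts_step a b \<in> borel_measurable borel"
    unfolding cts_step_def[abs_def] by measurable
  have int: "integrable M (\<lambda>\<omega>. cts_step a b (W \<omega>))" if [measurable]: "W \<in> borel_measurable M" for W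
    by (rule integrable_bounded[of _ 1]) (use \<open>a < b\<close> in \<open>auto simp: cts_step_def\<close>)
  have "\<bar>expectation (\<lambda>\<omega>. cts_step a b (U \<omega>)) - expectation (\<lambda>\<omega>. cts_step a b (V \<omega>))\<bar>
      = \<bar>expectation (\<lambda>\<omega>. cts_step a b (U \<omega>) - cts_step a b (V \<omega>))\<bar>"
    by (subst Bochner_Integration.integral_diff) (auto intro: int)
  also have "\<dots> \<le> expectation (\<lambda>\<omega>. \<bar>cts_step a b (U \<omega>) - cts_step a b (V \<omega>)\<bar>)"
    by (rule integral_abs_bound)
  also have "\<dots> \<le> expectation (\<lambda>\<omega>. (1 + 1 / (b - a)) * min 1 \<bar>U \<omega> - V \<omega>\<bar>)"
    using \<open>a < b\<close> by (intro integral_mono' abs_cts_step_diff_le) auto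
  finally show ?thesis by (simp add: trunc_mean_def)
qed

locale hl_array_density = hl_array +
  fixes t0 :: nat
  assumes HL3: "HL3 M \<beta> X t0" and HL6: "HL6 \<beta> t0"
begin

lemma t0_ge_1: "1 \<le> t0"
  using HL3 by (auto simp: HL3_def)

text \<open>Each term costs the density bound times \<beta>_n / \<beta>_t times the L^1 norm, and
  HL6 bounds the average of these ratios. The constants are chosen before \<open>k\<close>, so they
  survive when \<open>k\<close> is later an approximation error.\<close>

lemma average_density_bound:
  "\<exists>C n0. 0 \<le> C \<and> (\<forall>k n. integrable lborel k \<longrightarrow> n \<ge> n0 \<longrightarrow>
     (\<forall>t\<in>{t0..n}. integrable M (\<lambda>\<omega>. k (X n t \<omega> / \<beta> n))) \<and>
     expectation (\<lambda>\<omega>. \<bar>(\<Sum>t=t0..n. k (X n t \<omega> / \<beta> n)) / real n\<bar>) \<le> C * (\<integral>x. \<bar>k x\<bar> \<partial>lborel))"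
proof -
  obtain D n0 where D: "\<And>n t. 1 \<le> n \<Longrightarrow> t \<in> {1..n} \<Longrightarrow> distributed M lborel (\<lambda>\<omega>. X n t \<omega> / \<beta> t) (D n t)"
    and n0: "1 \<le> t0" "t0 \<le> n0" and fin: "(SUP n\<in>{n0..}. SUP t\<in>{t0..n}. SUP x. D n t x) < \<infinity>"
    using HL3 unfolding HL3_def by blast
  define C where "C = enn2real (SUP n\<in>{n0..}. SUP t\<in>{t0..n}. SUP x. D n t x)"
  have C: "D n t x \<le> ennreal C" if "n0 \<le> n" "t \<in> {t0..n}" for n t x
  proof -
    have "D n t x \<le> (SUP x. D n t x)" by (intro SUP_upper) auto
    also have "\<dots> \<le> (SUP t\<in>{t0..n}. SUP x. D n t x)"
      using that(2) by (rule SUP_upper)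
    also have "\<dots> \<le> (SUP n\<in>{n0..}. SUP t\<in>{t0..n}. SUP x. D n t x)"
      by (rule SUP_upper) (use that in auto)
    also have "\<dots> = ennreal C" using fin by (simp add: C_def less_top)
    finally show ?thesis .
  qed
  have "0 \<le> C" by (simp add: C_def)
  obtain C6 where C6: "\<And>n. 1 \<le> n \<Longrightarrow> \<beta> n / real n * (\<Sum>t=t0..n. inverse (\<beta> t)) \<le> C6"
    using HL6 unfolding HL6_def bdd_above_def by auto
  show ?thesis
  \<comment> \<open>The absolute value gives a nonnegative constant without examining the sign of
    the bound from HL6.\<close>
  proof (intro exI[of _ "C * \<bar>C6\<bar>"] exI[of _ n0] conjI allI impI)
    show "0 \<le> C * \<bar>C6\<bar>" using \<open>0 \<le> C\<close> by simp
    fix k :: "real \<Rightarrow> real" and n assume k: "integrable lborel k" and n: "n0 \<le> n"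
    have [measurable]: "k \<in> borel_measurable borel" using borel_measurable_integrable[OF k] by simp
    have "1 \<le> n" using n n0 by simp
    define I where "I = (\<integral>x. \<bar>k x\<bar> \<partial>lborel)"
    have I: "(\<integral>\<^sup>+x. ennreal \<bar>k x\<bar> \<partial>lborel) = ennreal I"
      unfolding I_def using k by (intro nn_integral_eq_integral) auto
    have "0 \<le> I" by (simp add: I_def)
    have bound: "(\<integral>\<^sup>+\<omega>. ennreal \<bar>k (X n t \<omega> / \<beta> n)\<bar> \<partial>M) \<le> ennreal (C * (\<beta> n / \<beta> t * I))"
      if t: "t \<in> {t0..n}" for t
    proof -
      have t': "t \<in> {1..n}" using t n0 by simp
      then have b: "0 < \<beta> t" "0 < \<beta> n" using \<open>1 \<le> n\<close> by (auto intro: beta_pos)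
      have "(\<integral>\<^sup>+\<omega>. ennreal \<bar>k (X n t \<omega> / \<beta> n)\<bar> \<partial>M)
          \<le> ennreal C * (ennreal (\<beta> n / \<beta> t) * (\<integral>\<^sup>+x. ennreal \<bar>k x\<bar> \<partial>lborel))"
        by (rule distributed_rescaled_nn_integral_le[OF D[OF \<open>1 \<le> n\<close> t'] C[OF n t] _ b]) measurable
      also have "\<dots> = ennreal (C * (\<beta> n / \<beta> t * I))"
        using b \<open>0 \<le> C\<close> \<open>0 \<le> I\<close> by (simp add: I ennreal_mult[symmetric])
      finally show ?thesis .
    qed
    have meas: "(\<lambda>\<omega>. k (X n t \<omega> / \<beta> n)) \<in> borel_measurable M" if t: "t \<in> {t0..n}" for t
    proof -
      have "t \<in> {1..n}" using t n0 by simp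
      note [measurable] = X_borel[OF this]
      show ?thesis by measurable
    qed
    show int: "\<forall>t\<in>{t0..n}. integrable M (\<lambda>\<omega>. k (X n t \<omega> / \<beta> n))"
    proof
      fix t assume t: "t \<in> {t0..n}"
      show "integrable M (\<lambda>\<omega>. k (X n t \<omega> / \<beta> n))"
        using meas[OF t] le_less_trans[OF bound[OF t]]
        by (intro integrableI_bounded) auto
    qed
    have E: "expectation (\<lambda>\<omega>. \<bar>k (X n t \<omega> / \<beta> n)\<bar>) \<le> C * (\<beta> n / \<beta> t * I)" if t: "t \<in> {t0..n}" for t
    proof -
      have "0 < \<beta> t" "0 < \<beta> n" using t n0 \<open>1 \<le> n\<close> by (auto intro: beta_pos)
      then show ?thesis
        using bound[OF t] int t \<open>0 \<le> C\<close> \<open>0 \<le> I\<close>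
        by (subst (asm) nn_integral_eq_integral) auto
    qed
    have "expectation (\<lambda>\<omega>. \<bar>(\<Sum>t=t0..n. k (X n t \<omega> / \<beta> n)) / real n\<bar>)
        \<le> expectation (\<lambda>\<omega>. (\<Sum>t=t0..n. \<bar>k (X n t \<omega> / \<beta> n)\<bar>) / real n)"
      using int by (intro integral_mono' integrable_divide Bochner_Integration.integrable_sum integrable_abs)
        (auto simp: abs_divide intro!: divide_right_mono sum_abs sum_nonneg)
    also have "\<dots> = (\<Sum>t=t0..n. expectation (\<lambda>\<omega>. \<bar>k (X n t \<omega> / \<beta> n)\<bar>)) / real n"
      using int by (simp add: Bochner_Integration.integral_sum)
    also have "\<dots> \<le> (\<Sum>t=t0..n. C * (\<beta> n / \<beta> t * I)) / real n"
      by (intro divide_right_mono sum_mono E) auto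
    also have "\<dots> = C * I * (\<beta> n / real n * (\<Sum>t=t0..n. inverse (\<beta> t)))"
      by (simp add: sum_distrib_left sum_divide_distrib divide_inverse mult_ac)
    also have "\<dots> \<le> C * I * \<bar>C6\<bar>"
      using C6[OF \<open>1 \<le> n\<close>] \<open>0 \<le> C\<close> \<open>0 \<le> I\<close> by (intro mult_left_mono) auto
    finally show "expectation (\<lambda>\<omega>. \<bar>(\<Sum>t=t0..n. k (X n t \<omega> / \<beta> n)) / real n\<bar>) \<le> C * \<bar>C6\<bar> * (\<integral>x. \<bar>k x\<bar> \<partial>lborel)"
      by (simp add: I_def mult_ac)
  qed
qed

end

section \<open>Shift means of integrable functions and of tails\<close>

lemma (in prob_space) trunc_mean_add:
  "U \<in> borel_measurable M \<Longrightarrow> V \<in> borel_measurable M \<Longrightarrow>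
    trunc_mean M (\<lambda>\<omega>. U \<omega> + V \<omega>) \<le> trunc_mean M U + trunc_mean M V"
  by (rule trunc_mean_add_le) auto

context density_function
begin

lemma shift_mean_borel [measurable]:
  assumes [measurable]: "g \<in> borel_measurable borel"
  shows "shift_mean \<Phi> g \<in> borel_measurable borel"
  unfolding shift_mean_def[abs_def] by measurable

text \<open>A bounded density and translation invariance of Lebesgue measure turn L^1 closeness into
  closeness of shift means, uniformly in the shift. This is the counterpart, on the side of the
  limit, of \<open>average_density_bound\<close>.\<close>

lemma
  assumes g: "integrable lborel g" and S: "\<And>x. \<Phi> x \<le> S"
  shows integrable_shift: "integrable lborel (\<lambda>x. g (x + y) * \<Phi> x)"
    and shift_mean_le_integral: "\<bar>shift_mean \<Phi> g y\<bar> \<le> S * (\<integral>x. \<bar>g x\<bar> \<partial>lborel)"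
proof -
  have [measurable]: "g \<in> borel_measurable borel" using borel_measurable_integrable[OF g] by simp
  have g_shift: "integrable lborel (\<lambda>x. g (x + y))"
    using lborel_integrable_real_affine[OF g, of 1 y] by (simp add: add.commute)
  have bound: "\<bar>g (x + y) * \<Phi> x\<bar> \<le> S * \<bar>g (x + y)\<bar>" for x
    using S[of x] nonneg[of x] by (simp add: abs_mult mult.commute mult_right_mono)
  then show int: "integrable lborel (\<lambda>x. g (x + y) * \<Phi> x)"
    by (intro Bochner_Integration.integrable_bound[OF integrable_mult_right[OF integrable_abs[OF g_shift], of S]])
      (auto intro: order_trans[OF _ abs_ge_self])
  have "\<bar>shift_mean \<Phi> g y\<bar> \<le> (\<integral>x. \<bar>g (x + y) * \<Phi> x\<bar> \<partial>lborel)"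
    unfolding shift_mean_def by (rule integral_abs_bound)
  also have "\<dots> \<le> (\<integral>x. S * \<bar>g (x + y)\<bar> \<partial>lborel)"
    using bound g_shift int by (intro integral_mono) auto
  also have "\<dots> = S * (\<integral>x. \<bar>g x\<bar> \<partial>lborel)"
    using lborel_integral_real_affine[of 1 "\<lambda>x. \<bar>g x\<bar>" y] by (simp add: add.commute)
  finally show "\<bar>shift_mean \<Phi> g y\<bar> \<le> S * (\<integral>x. \<bar>g x\<bar> \<partial>lborel)" .
qed

lemma shift_mean_tail_LIMSEQ:
  assumes [measurable]: "f \<in> borel_measurable borel" and int: "integrable lborel (\<lambda>x. f (x + y) * \<Phi> x)"
  shows "(\<lambda>k. shift_mean \<Phi> (\<lambda>x. indicator (- {- real k..real k}) x * f x) y) \<longlonglongrightarrow> 0"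
proof -
  have "(\<lambda>k. \<integral>x. indicator (- {- real k..real k}) (x + y) * f (x + y) * \<Phi> x \<partial>lborel) \<longlonglongrightarrow> integral\<^sup>L lborel (\<lambda>x::real. 0)"
  proof (rule integral_dominated_convergence[where w = "\<lambda>x. \<bar>f (x + y) * \<Phi> x\<bar>"])
    show "AE x in lborel. (\<lambda>k. indicator (- {- real k..real k}) (x + y) * f (x + y) * \<Phi> x) \<longlonglongrightarrow> 0"
    proof (rule AE_I2, rule tendsto_eventually)
      fix x
      show "\<forall>\<^sub>F k in sequentially. indicator (- {- real k..real k}) (x + y) * f (x + y) * \<Phi> x = 0"
        using eventually_ge_at_top[of "nat \<lceil>\<bar>x + y\<bar>\<rceil>"]
      proof eventually_elim
        case (elim k)
        then have "\<bar>x + y\<bar> \<le> real k" by (simp add: nat_le_iff ceiling_le_iff)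
        then show ?case by (auto simp: indicator_def)
      qed
    qed
  qed (use int in \<open>auto simp: indicator_def\<close>)
  then show ?thesis by (simp add: shift_mean_def)
qed

text \<open>Truncation supplies the dominating constant 1, so pointwise convergence of the tails is
  enough even when the shift mean of \<open>f\<close> has no moment under \<open>N\<close>.\<close>

lemma trunc_mean_shift_mean_tail_LIMSEQ:
  assumes "prob_space N" and [measurable]: "Y \<in> borel_measurable N" "f \<in> borel_measurable borel"
    and int: "AE \<omega> in N. integrable lborel (\<lambda>x. f (x + Y \<omega>) * \<Phi> x)"
  shows "(\<lambda>k. trunc_mean N (\<lambda>\<omega>. shift_mean \<Phi> (\<lambda>x. indicator (- {- real k..real k}) x * f x) (Y \<omega>))) \<longlonglongrightarrow> 0"
proof -
  interpret N: prob_space N by fact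
  have "(\<lambda>k. \<integral>\<omega>. min 1 \<bar>shift_mean \<Phi> (\<lambda>x. indicator (- {- real k..real k}) x * f x) (Y \<omega>)\<bar> \<partial>N) \<longlonglongrightarrow> (\<integral>\<omega>. 0 \<partial>N)"
  proof (rule integral_dominated_convergence[where w = "\<lambda>_. 1"])
    show "AE \<omega> in N. (\<lambda>k. min 1 \<bar>shift_mean \<Phi> (\<lambda>x. indicator (- {- real k..real k}) x * f x) (Y \<omega>)\<bar>) \<longlonglongrightarrow> 0"
      using int
    proof eventually_elim
      case (elim \<omega>)
      have "(\<lambda>k. shift_mean \<Phi> (\<lambda>x. indicator (- {- real k..real k}) x * f x) (Y \<omega>)) \<longlonglongrightarrow> 0"
        by (rule shift_mean_tail_LIMSEQ[OF _ elim]) measurable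
      then have "(\<lambda>k. min 1 \<bar>shift_mean \<Phi> (\<lambda>x. indicator (- {- real k..real k}) x * f x) (Y \<omega>)\<bar>) \<longlonglongrightarrow> min 1 \<bar>0\<bar>"
        by (intro tendsto_intros)
      then show ?case by simp
    qed
  qed auto
  then show ?thesis by (simp add: trunc_mean_def)
qed

end

text \<open>A fixed number of bounded terms is divided by \<open>n\<close>; used with
  \<open>m = t0\<close>.\<close>

lemma (in prob_space) trunc_mean_head_le:
  assumes B: "\<And>x. \<bar>g x\<bar> \<le> B"
  shows "trunc_mean M (\<lambda>\<omega>. (\<Sum>t=1..<m. g (Y t \<omega>)) / real n) \<le> real m * B * (1 / real n)"
proof (rule trunc_mean_le_const)
  have "0 \<le> B" using B[of undefined] by linarith
  then show "0 \<le> real m * B * (1 / real n)" by simp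
  fix \<omega>
  have "\<bar>\<Sum>t=1..<m. g (Y t \<omega>)\<bar> \<le> (\<Sum>t=1..<m. \<bar>g (Y t \<omega>)\<bar>)" by (rule sum_abs)
  also have "\<dots> \<le> real (card {1..<m}) * B" by (rule sum_bounded_above) (rule B)
  also have "\<dots> \<le> real m * B" using \<open>0 \<le> B\<close> by (intro mult_right_mono) auto
  finally show "\<bar>(\<Sum>t=1..<m. g (Y t \<omega>)) / real n\<bar> \<le> real m * B * (1 / real n)"
    by (simp add: abs_divide divide_right_mono)
qed

text \<open>On \<open>M\<close> the average of \<open>f\<close> is compared with
  \<open>G (W n)\<close>, on \<open>N\<close> the limit with \<open>G (Xm)\<close>, where
  \<open>G\<close> is the shift mean of a Lipschitz approximant of \<open>f\<close> on
  \<open>[-k, k]\<close>. The two sides meet through convergence in distribution of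
  \<open>W n\<close>, tested with \<open>cts_step\<close>. The hypotheses \<open>head\<close>,
  \<open>tail\<close> and \<open>lim\<close> isolate what depends on whether \<open>f\<close> is
  bounded or satisfies a growth condition.\<close>

lemma (in hl_array_density) average_conv_in_distr:
  assumes f[measurable]: "f \<in> borel_measurable borel"
    and loc: "\<And>k::nat. integrable lborel (\<lambda>x. indicator {- real k..real k} x * f x)"
    and head: "(\<lambda>n. trunc_mean M (\<lambda>\<omega>. (\<Sum>t=1..<t0. f (X n t \<omega> / \<beta> n)) / real n)) \<longlonglongrightarrow> 0"
    and tail: "\<And>e. 0 < e \<Longrightarrow> \<forall>\<^sub>F k in sequentially. \<forall>\<^sub>F n in sequentially.
      trunc_mean M (\<lambda>\<omega>. (\<Sum>t=t0..n. indicator (- {- real k..real k}) (X n t \<omega> / \<beta> n) * f (X n t \<omega> / \<beta> n)) / real n) \<le> e"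
    and lim: "AE \<omega> in N. integrable lborel (\<lambda>x. f (x + Xm \<omega>) * \<Phi> x)"
  shows "conv_in_distr M (\<lambda>n \<omega>. (\<Sum>t=1..n. f (X n t \<omega> / \<beta> n)) / real n) N (\<lambda>\<omega>. shift_mean \<Phi> f (Xm \<omega>))"
proof -
  define A where "A f n \<omega> = (\<Sum>t=1..n. f (X n t \<omega> / \<beta> n)) / real n" for f :: "real \<Rightarrow> real" and n \<omega>
  define H where "H f n \<omega> = (\<Sum>t=1..<t0. f (X n t \<omega> / \<beta> n)) / real n" for f :: "real \<Rightarrow> real" and n \<omega>
  define Q where "Q f n \<omega> = (\<Sum>t=t0..n. f (X n t \<omega> / \<beta> n)) / real n" for f :: "real \<Rightarrow> real" and n \<omega>
  define in_k where "in_k k x = indicator {- real k..real k} x * f x" for k x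
  define out_k where "out_k k x = indicator (- {- real k..real k}) x * f x" for k x
  have f_split: "f x = in_k k x + out_k k x" for k x by (simp add: in_k_def out_k_def indicator_def)
  have [measurable]: "in_k k \<in> borel_measurable borel" "out_k k \<in> borel_measurable borel" for k
    unfolding in_k_def[abs_def] out_k_def[abs_def] by measurable
  have comp_meas: "(\<lambda>\<omega>. h (X n t \<omega> / \<beta> n)) \<in> borel_measurable M"
    if "h \<in> borel_measurable borel" "t \<in> {1..n}" for h :: "real \<Rightarrow> real" and n t
    using X_borel[OF that(2)] that(1) by measurable
  have A_meas: "A h n \<in> borel_measurable M" if "h \<in> borel_measurable borel" for h n
    unfolding A_def by (intro borel_measurable_divide borel_measurable_sum comp_meas that) auto
  have Q_meas: "Q h n \<in> borel_measurable M" if "h \<in> borel_measurable borel" for h n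
    unfolding Q_def using t0_ge_1 by (intro borel_measurable_divide borel_measurable_sum comp_meas that) auto
  have H_meas: "H h n \<in> borel_measurable M" if "h \<in> borel_measurable borel" "t0 \<le> n" for h n
    unfolding H_def using \<open>t0 \<le> n\<close> by (intro borel_measurable_divide borel_measurable_sum comp_meas that) auto
  define Z where "Z \<omega> = shift_mean \<Phi> f (Xm \<omega>)" for \<omega>
  have Z_meas[measurable]: "Z \<in> borel_measurable N" unfolding Z_def by measurable
  obtain S where S: "\<And>x. \<Phi> x \<le> S"
  proof -
    obtain S where "\<forall>y\<in>range \<Phi>. norm y \<le> S" using Phi_bounded by (auto simp: bounded_iff)
    then have "\<Phi> x \<le> S" for x by (auto intro: order_trans[OF abs_ge_self])
    then show ?thesis by (rule that)
  qed
  have "0 \<le> S" using S[of 0] Phi_nonneg[of 0] by linarith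
  obtain C n0 where "0 \<le> C" and C: "\<And>k n. integrable lborel k \<Longrightarrow> n0 \<le> n \<Longrightarrow>
      (\<forall>t\<in>{t0..n}. integrable M (\<lambda>\<omega>. k (X n t \<omega> / \<beta> n))) \<and>
      expectation (\<lambda>\<omega>. \<bar>(\<Sum>t=t0..n. k (X n t \<omega> / \<beta> n)) / real n\<bar>) \<le> C * (\<integral>x. \<bar>k x\<bar> \<partial>lborel)"
    using average_density_bound by metis
  have Xm_tail: "(\<lambda>k. trunc_mean N (\<lambda>\<omega>. shift_mean \<Phi> (out_k k) (Xm \<omega>))) \<longlonglongrightarrow> 0"
    unfolding out_k_def by (rule trunc_mean_shift_mean_tail_LIMSEQ[OF prob_N Xm_borel f lim])
  have conv: "(\<lambda>n. expectation (\<lambda>\<omega>. cts_step a b (A f n \<omega>))) \<longlonglongrightarrow> N.expectation (\<lambda>\<omega>. cts_step a b (Z \<omega>))"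
    if "a < b" for a b
  proof (rule LIMSEQ_I)
    fix r :: real assume "0 < r"
    define c where "c = 1 + 1 / (b - a)"
    have "0 \<le> c" using \<open>a < b\<close> by (simp add: c_def)
    \<comment> \<open>\<open>C + 4\<close> collects five errors on \<open>M\<close> (head of
      \<open>f\<close>, head of \<open>g\<close>, tail, Lipschitz average, and \<open>C * e\<close>
      from the density bound). The middle 1 is the weak limit, and \<open>1 + S\<close> collects
      tail and approximation on \<open>N\<close>.\<close>
    define D where "D = c * (C + 4) + 1 + c * (1 + S)"
    have "0 < D" using \<open>0 \<le> c\<close> \<open>0 \<le> C\<close> \<open>0 \<le> S\<close> by (simp add: D_def add_nonneg_pos add_pos_nonneg)
    define e where "e = r / D / 2"
    have "0 < e" "D * e < r" using \<open>0 < r\<close> \<open>0 < D\<close> by (auto simp: e_def)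
    \<comment> \<open>One cut-off level must serve both spaces, and it is fixed before the
      approximant \<open>g\<close>, which depends on it.\<close>
    obtain k where k: "\<forall>\<^sub>F n in sequentially. trunc_mean M (Q (out_k k) n) \<le> e"
      and k': "trunc_mean N (\<lambda>\<omega>. shift_mean \<Phi> (out_k k) (Xm \<omega>)) < e"
    proof -
      have "\<forall>\<^sub>F k in sequentially. (\<forall>\<^sub>F n in sequentially. trunc_mean M (Q (out_k k) n) \<le> e) \<and>
          trunc_mean N (\<lambda>\<omega>. shift_mean \<Phi> (out_k k) (Xm \<omega>)) < e"
        using tail[OF \<open>0 < e\<close>] order_tendstoD(2)[OF Xm_tail \<open>0 < e\<close>]
        unfolding Q_def out_k_def by (rule eventually_conj)
      from eventually_happens'[OF sequentially_bot this] show ?thesis using that by blast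
    qed
    have int_in: "integrable lborel (in_k k)" unfolding in_k_def by (rule loc)
    obtain g L B where L: "L-lipschitz_on UNIV g" and B: "\<And>x. \<bar>g x\<bar> \<le> B" and int_g: "integrable lborel g"
      and g: "(\<integral>x. \<bar>in_k k x - g x\<bar> \<partial>lborel) < e"
      using integrable_lborel_approx_lipschitz[OF int_in \<open>0 < e\<close>] by blast
    note g_borel[measurable] = lipschitz_borel[OF L]
    define d where "d x = in_k k x - g x" for x
    have int_d: "integrable lborel d" unfolding d_def by (intro Bochner_Integration.integrable_diff int_in int_g)
    have [measurable]: "d \<in> borel_measurable borel" unfolding d_def[abs_def] by measurable
    have d_le: "(\<integral>x. \<bar>d x\<bar> \<partial>lborel) \<le> e" using g by (simp add: d_def)
    define G where "G = shift_mean \<Phi> g"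
    have G_L: "L-lipschitz_on UNIV G" unfolding G_def by (rule shift_mean_lipschitz[OF L B])
    note G_borel[measurable] = lipschitz_borel[OF G_L]
    define W where "W n \<omega> = Xma n n \<omega> / \<beta> n" for n \<omega>
    have W_meas: "W n \<in> borel_measurable M" if "1 \<le> n" for n
    proof -
      have "n \<in> {1..n}" using that by simp
      from Xma_borel[OF this] show ?thesis unfolding W_def by measurable
    qed
    have H_g: "(\<lambda>n. trunc_mean M (H g n)) \<longlonglongrightarrow> 0"
    proof (rule tendsto_sandwich[of "\<lambda>_. 0"])
      show "(\<lambda>n. real t0 * B * (1 / real n)) \<longlonglongrightarrow> 0"
        by (intro tendsto_mult_right_zero lim_1_over_n)
      show "\<forall>\<^sub>F n in sequentially. trunc_mean M (H g n) \<le> real t0 * B * (1 / real n)"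
        unfolding H_def by (intro always_eventually allI trunc_mean_head_le B)
    qed (auto simp: trunc_mean_nonneg)
    have step: "(\<lambda>n. trunc_mean M (\<lambda>\<omega>. A g n \<omega> - G (W n \<omega>))) \<longlonglongrightarrow> 0"
      unfolding A_def G_def W_def by (rule average_lipschitz_LIMSEQ[OF L B])
    have cts_cont: "continuous_on UNIV (cts_step a b)"
      using \<open>a < b\<close> by (intro uniformly_continuous_imp_continuous cts_step_uniformly_continuous)
    have EW: "(\<lambda>n. expectation (\<lambda>\<omega>. cts_step a b (G (W n \<omega>)))) \<longlonglongrightarrow> N.expectation (\<lambda>\<omega>. cts_step a b (G (Xm \<omega>)))"
    proof (rule conv_in_distr_expectation[OF prob_M prob_N Xm_borel W_meas, where B = 1])
      show "conv_in_distr M W N Xm" unfolding W_def by (rule Xma_endpoint_conv)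
      show "continuous_on UNIV (\<lambda>x. cts_step a b (G x))"
        by (rule continuous_on_compose2[OF cts_cont lipschitz_on_continuous_on[OF G_L]]) auto
      show "\<bar>cts_step a b (G x)\<bar> \<le> 1" for x using \<open>a < b\<close> by (auto simp: cts_step_def)
    qed auto
    \<comment> \<open>On \<open>N\<close> the difference splits into the shift mean of
      \<open>out_k k\<close>, small by the choice of \<open>k\<close>, and that of \<open>d\<close>,
      at most \<open>S * e\<close> for every shift.\<close>
    have third: "\<bar>N.expectation (\<lambda>\<omega>. cts_step a b (G (Xm \<omega>))) - N.expectation (\<lambda>\<omega>. cts_step a b (Z \<omega>))\<bar>
        \<le> c * ((1 + S) * e)"
    proof -
      have "trunc_mean N (\<lambda>\<omega>. G (Xm \<omega>) - Z \<omega>)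
          \<le> trunc_mean N (\<lambda>\<omega>. shift_mean \<Phi> (out_k k) (Xm \<omega>)) + trunc_mean N (\<lambda>\<omega>. shift_mean \<Phi> d (Xm \<omega>))"
      proof (rule N.trunc_mean_add_le)
        show "AE \<omega> in N. \<bar>G (Xm \<omega>) - Z \<omega>\<bar> \<le> \<bar>shift_mean \<Phi> (out_k k) (Xm \<omega>)\<bar> + \<bar>shift_mean \<Phi> d (Xm \<omega>)\<bar>"
          using lim
        proof eventually_elim
          case (elim \<omega>)
          note int_parts = integrable_shift[OF int_in S, of "Xm \<omega>"] integrable_shift[OF int_g S, of "Xm \<omega>"]
          have out_eq: "(\<lambda>x. out_k k (x + Xm \<omega>) * \<Phi> x) = (\<lambda>x. f (x + Xm \<omega>) * \<Phi> x - in_k k (x + Xm \<omega>) * \<Phi> x)"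
            by (auto simp: f_split[of _ k] algebra_simps)
          have "shift_mean \<Phi> (out_k k) (Xm \<omega>) = Z \<omega> - shift_mean \<Phi> (in_k k) (Xm \<omega>)"
            unfolding shift_mean_def Z_def out_eq by (rule Bochner_Integration.integral_diff[OF elim int_parts(1)])
          moreover have "shift_mean \<Phi> d (Xm \<omega>) = shift_mean \<Phi> (in_k k) (Xm \<omega>) - G (Xm \<omega>)"
            unfolding shift_mean_def G_def d_def left_diff_distrib
            by (rule Bochner_Integration.integral_diff[OF int_parts])
          ultimately show ?case by linarith
        qed
      qed auto
      also have "trunc_mean N (\<lambda>\<omega>. shift_mean \<Phi> d (Xm \<omega>)) \<le> S * e"
      proof (rule N.trunc_mean_le_const)
        show "\<bar>shift_mean \<Phi> d (Xm \<omega>)\<bar> \<le> S * e" for \<omega>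
          using shift_mean_le_integral[OF int_d S, of "Xm \<omega>"] mult_left_mono[OF d_le \<open>0 \<le> S\<close>] by linarith
      qed (use \<open>0 \<le> S\<close> \<open>0 < e\<close> in simp)
      finally have "trunc_mean N (\<lambda>\<omega>. G (Xm \<omega>) - Z \<omega>) \<le> (1 + S) * e"
        using k' by (simp add: distrib_right)
      then have "c * trunc_mean N (\<lambda>\<omega>. G (Xm \<omega>) - Z \<omega>) \<le> c * ((1 + S) * e)"
        using \<open>0 \<le> c\<close> by (rule mult_left_mono)
      moreover have "\<bar>N.expectation (\<lambda>\<omega>. cts_step a b (G (Xm \<omega>))) - N.expectation (\<lambda>\<omega>. cts_step a b (Z \<omega>))\<bar>
          \<le> c * trunc_mean N (\<lambda>\<omega>. G (Xm \<omega>) - Z \<omega>)"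
        unfolding c_def by (rule N.expectation_cts_step_diff_le) (use \<open>a < b\<close> in auto)
      ultimately show ?thesis by linarith
    qed
    have "\<forall>\<^sub>F n in sequentially. \<bar>expectation (\<lambda>\<omega>. cts_step a b (G (W n \<omega>))) - N.expectation (\<lambda>\<omega>. cts_step a b (G (Xm \<omega>)))\<bar> < e"
      using tendstoD[OF EW \<open>0 < e\<close>] by (simp add: dist_real_def)
    then have "\<forall>\<^sub>F n in sequentially. norm (expectation (\<lambda>\<omega>. cts_step a b (A f n \<omega>)) - N.expectation (\<lambda>\<omega>. cts_step a b (Z \<omega>))) < r"
      using k order_tendstoD(2)[OF head[folded H_def] \<open>0 < e\<close>] order_tendstoD(2)[OF H_g \<open>0 < e\<close>]
        order_tendstoD(2)[OF step \<open>0 < e\<close>] eventually_ge_at_top[of "max n0 t0"]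
    proof eventually_elim
      case (elim n)
      then have n: "1 \<le> n" "n0 \<le> n" "t0 \<le> n" using t0_ge_1 by auto
      note [measurable] = W_meas[OF n(1)] A_meas[OF f] A_meas[OF g_borel] H_meas[OF f n(3)] H_meas[OF g_borel n(3)] Q_meas
      have split: "A h n \<omega> = H h n \<omega> + Q h n \<omega>" for h \<omega>
      proof -
        have "{1..n} = {1..<t0} \<union> {t0..n}" using n t0_ge_1 by auto
        then have "sum q {1..n} = sum q {1..<t0} + sum q {t0..n}" for q :: "nat \<Rightarrow> real"
          by (simp only:) (rule sum.union_disjoint; auto)
        then show ?thesis unfolding A_def H_def Q_def by (simp only: add_divide_distrib)
      qed
      \<comment> \<open>\<open>f\<close> is the sum of \<open>d\<close>, \<open>g\<close> and
        \<open>out_k k\<close>. Only \<open>d\<close> goes through the density bound, hence the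
        restriction to indices from \<open>t0\<close> on.\<close>
      have Q_split: "Q f n \<omega> = Q d n \<omega> + Q g n \<omega> + Q (out_k k) n \<omega>" for \<omega>
        unfolding Q_def by (simp add: f_split[of _ k] d_def add_divide_distrib[symmetric] sum.distrib[symmetric])
      have Q_d: "trunc_mean M (Q d n) \<le> C * e"
      proof -
        have "integrable M (Q d n)"
          unfolding Q_def using C[OF int_d n(2)]
          by (intro integrable_divide Bochner_Integration.integrable_sum) auto
        then have "trunc_mean M (Q d n) \<le> expectation (\<lambda>\<omega>. \<bar>Q d n \<omega>\<bar>)"
          by (rule trunc_mean_le_expectation)
        also have "\<dots> \<le> C * (\<integral>x. \<bar>d x\<bar> \<partial>lborel)"
          unfolding Q_def using C[OF int_d n(2)] by blast
        also have "\<dots> \<le> C * e" using d_le \<open>0 \<le> C\<close> by (rule mult_left_mono)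
        finally show ?thesis .
      qed
      \<comment> \<open>The part of \<open>g\<close> beyond \<open>t0\<close> is rewritten as its
        full average minus its head, because the Lipschitz limit is known for full averages
        only.\<close>
      have "(\<lambda>\<omega>. A f n \<omega> - G (W n \<omega>))
          = (\<lambda>\<omega>. H f n \<omega> + (Q d n \<omega> + (Q (out_k k) n \<omega> + (- H g n \<omega> + (A g n \<omega> - G (W n \<omega>))))))"
        by (auto simp: split[of f] split[of g] Q_split)
      then have "trunc_mean M (\<lambda>\<omega>. A f n \<omega> - G (W n \<omega>))
          \<le> trunc_mean M (H f n) + (trunc_mean M (Q d n) + (trunc_mean M (Q (out_k k) n)
            + (trunc_mean M (\<lambda>\<omega>. - H g n \<omega>) + trunc_mean M (\<lambda>\<omega>. A g n \<omega> - G (W n \<omega>)))))"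
        by (simp only:) (intro order_trans[OF trunc_mean_add] add_left_mono order_refl; measurable)
      also have "trunc_mean M (\<lambda>\<omega>. - H g n \<omega>) = trunc_mean M (H g n)"
        by (simp add: trunc_mean_def)
      finally have "trunc_mean M (\<lambda>\<omega>. A f n \<omega> - G (W n \<omega>)) \<le> (C + 4) * e"
        using elim Q_d by (simp add: distrib_right)
      then have "c * trunc_mean M (\<lambda>\<omega>. A f n \<omega> - G (W n \<omega>)) \<le> c * ((C + 4) * e)"
        using \<open>0 \<le> c\<close> by (rule mult_left_mono)
      moreover have "\<bar>expectation (\<lambda>\<omega>. cts_step a b (A f n \<omega>)) - expectation (\<lambda>\<omega>. cts_step a b (G (W n \<omega>)))\<bar>
          \<le> c * trunc_mean M (\<lambda>\<omega>. A f n \<omega> - G (W n \<omega>))"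
        unfolding c_def by (rule expectation_cts_step_diff_le[OF _ _ \<open>a < b\<close>]) measurable
      moreover have "D * e = c * ((C + 4) * e) + e + c * ((1 + S) * e)"
        by (simp add: D_def algebra_simps)
      ultimately show ?case
        using third elim(1) \<open>D * e < r\<close> unfolding real_norm_def by linarith
    qed
    then show "\<exists>no. \<forall>n\<ge>no. norm (expectation (\<lambda>\<omega>. cts_step a b (A f n \<omega>)) - N.expectation (\<lambda>\<omega>. cts_step a b (Z \<omega>))) < r"
      by (simp add: eventually_sequentially)
  qed
  have "weak_conv_m (\<lambda>n. distr M borel (A f n)) (distr N borel Z)"
  proof (rule integral_cts_step_conv_imp_weak_conv)
    fix a b :: real assume "a < b"
    have [measurable]: "cts_step a b \<in> borel_measurable borel"
      unfolding cts_step_def[abs_def] by measurable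
    note [measurable] = A_meas[OF f]
    show "(\<lambda>n. integral\<^sup>L (distr M borel (A f n)) (cts_step a b)) \<longlonglongrightarrow> integral\<^sup>L (distr N borel Z) (cts_step a b)"
      using conv[OF \<open>a < b\<close>] by (simp add: integral_distr)
  qed (auto intro: A_meas[OF f])
  then show ?thesis unfolding conv_in_distr_def A_def Z_def .
qed

section \<open>Negligibility of the tails\<close>

context hl_array_density
begin

text \<open>For large \<open>k\<close> the tail indicator lies below a Lipschitz ramp. The averages
  of the ramp obey the Lipschitz limit, so they are eventually small as soon as the shift mean of
  the ramp is small under \<open>N\<close>. This is tightness of the empirical averages, obtained
  without any moment.\<close>

lemma tail_bounded:
  assumes [measurable]: "f \<in> borel_measurable borel" and B: "\<And>x. \<bar>f x\<bar> \<le> B" and "0 < e"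
  shows "\<forall>\<^sub>F k in sequentially. \<forall>\<^sub>F n in sequentially.
    trunc_mean M (\<lambda>\<omega>. (\<Sum>t=t0..n. indicator (- {- real k..real k}) (X n t \<omega> / \<beta> n) * f (X n t \<omega> / \<beta> n)) / real n) \<le> e"
proof -
  have "0 \<le> B" using B[of 0] by linarith
  \<comment> \<open>The average of the ramp is bounded by two terms of size \<open>e'\<close>, and
    passing from it to the tail costs the factor \<open>1 + B\<close>.\<close>
  define e' where "e' = e / (1 + B) / 2"
  have "0 < e'" using \<open>0 < e\<close> \<open>0 \<le> B\<close> by (simp add: e'_def)
  have e'_eq: "(1 + B) * (e' + e') = e"
    unfolding e'_def field_sum_of_halves times_divide_eq_right
    using \<open>0 \<le> B\<close> by (subst nonzero_mult_div_cancel_left) auto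
  define \<psi> where "\<psi> K x = min 1 (max 0 (\<bar>x\<bar> - real K))" for K :: nat and x :: real
  have \<psi>_L: "1-lipschitz_on UNIV (\<psi> K)" for K
    unfolding lipschitz_UNIV_real_iff \<psi>_def dist_real_def
  proof safe
    fix x y :: real
    have "\<bar>min 1 (max 0 a) - min 1 (max 0 b)\<bar> \<le> \<bar>a - b\<bar>" for a b :: real by linarith
    from order_trans[OF this, of "\<bar>x\<bar> - real K" "\<bar>y\<bar> - real K" "1 * \<bar>x - y\<bar>"]
    show "\<bar>min 1 (max 0 (\<bar>x\<bar> - real K)) - min 1 (max 0 (\<bar>y\<bar> - real K))\<bar> \<le> 1 * \<bar>x - y\<bar>"
      by simp
  qed simp
  have \<psi>_B: "\<bar>\<psi> K x\<bar> \<le> 1" "0 \<le> \<psi> K x" for K x by (auto simp: \<psi>_def)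
  note [measurable] = lipschitz_borel[OF \<psi>_L]
  have "(\<lambda>K. trunc_mean N (\<lambda>\<omega>. shift_mean \<Phi> (\<psi> K) (Xm \<omega>))) \<longlonglongrightarrow> 0"
  proof (rule tendsto_sandwich[of "\<lambda>_. 0"])
    \<comment> \<open>The constant function 1 takes the place of \<open>f\<close> in the tail lemma,
      which explains the factor \<open>* 1\<close>.\<close>
    show "(\<lambda>K. trunc_mean N (\<lambda>\<omega>. shift_mean \<Phi> (\<lambda>x. indicator (- {- real K..real K}) x * 1) (Xm \<omega>))) \<longlonglongrightarrow> 0"
      by (rule trunc_mean_shift_mean_tail_LIMSEQ[OF prob_N]) (auto simp: integrable)
    have "\<bar>shift_mean \<Phi> (\<psi> K) y\<bar> \<le> \<bar>shift_mean \<Phi> (\<lambda>x. indicator (- {- real K..real K}) x * 1) y\<bar>" for K y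
    proof -
      have "shift_mean \<Phi> (\<psi> K) y \<le> shift_mean \<Phi> (\<lambda>x. indicator (- {- real K..real K}) x * 1) y"
        unfolding shift_mean_def
      proof (rule integral_mono)
        show "integrable lborel (\<lambda>x. \<psi> K (x + y) * \<Phi> x)"
          by (rule integrable_mult_bounded[of _ 1]) (auto intro: \<psi>_B)
        show "integrable lborel (\<lambda>x. indicator (- {- real K..real K}) (x + y) * 1 * \<Phi> x)"
          by (rule integrable_mult_bounded[of _ 1]) (auto simp: indicator_def)
        show "\<psi> K (x + y) * \<Phi> x \<le> indicator (- {- real K..real K}) (x + y) * 1 * \<Phi> x" for x
          using nonneg by (intro mult_right_mono) (auto simp: \<psi>_def indicator_def)
      qed
      moreover have "0 \<le> shift_mean \<Phi> (\<psi> K) y"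
        unfolding shift_mean_def using \<psi>_B nonneg by (intro integral_nonneg_AE AE_I2) auto
      ultimately show ?thesis by simp
    qed
    then show "\<forall>\<^sub>F K in sequentially. trunc_mean N (\<lambda>\<omega>. shift_mean \<Phi> (\<psi> K) (Xm \<omega>))
        \<le> trunc_mean N (\<lambda>\<omega>. shift_mean \<Phi> (\<lambda>x. indicator (- {- real K..real K}) x * 1) (Xm \<omega>))"
      by (intro always_eventually allI N.trunc_mean_mono AE_I2) auto
  qed (auto simp: trunc_mean_nonneg)
  from eventually_happens'[OF sequentially_bot order_tendstoD(2)[OF this \<open>0 < e'\<close>]]
  obtain K where K: "trunc_mean N (\<lambda>\<omega>. shift_mean \<Phi> (\<psi> K) (Xm \<omega>)) < e'" by blast
  define G where "G = shift_mean \<Phi> (\<psi> K)"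
  have G_L: "1-lipschitz_on UNIV G" unfolding G_def by (rule shift_mean_lipschitz[OF \<psi>_L \<psi>_B(1)])
  note [measurable] = lipschitz_borel[OF G_L]
  define W where "W n \<omega> = Xma n n \<omega> / \<beta> n" for n \<omega>
  have W_meas: "W n \<in> borel_measurable M" if "1 \<le> n" for n
  proof -
    have "n \<in> {1..n}" using that by simp
    from Xma_borel[OF this] show ?thesis unfolding W_def by measurable
  qed
  define A where "A n \<omega> = (\<Sum>t=1..n. \<psi> K (X n t \<omega> / \<beta> n)) / real n" for n \<omega>
  have A_meas[measurable]: "A n \<in> borel_measurable M" for n
    unfolding A_def
    by (intro borel_measurable_divide borel_measurable_sum measurable_compose[OF _ lipschitz_borel[OF \<psi>_L]] X_borel) auto
  have step: "(\<lambda>n. trunc_mean M (\<lambda>\<omega>. A n \<omega> - G (W n \<omega>))) \<longlonglongrightarrow> 0"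
    unfolding A_def G_def W_def by (rule average_lipschitz_LIMSEQ[OF \<psi>_L \<psi>_B(1)])
  have "(\<lambda>n. trunc_mean M (\<lambda>\<omega>. G (W n \<omega>))) \<longlonglongrightarrow> trunc_mean N (\<lambda>\<omega>. G (Xm \<omega>))"
    unfolding trunc_mean_def
  proof (rule conv_in_distr_expectation[OF prob_M prob_N Xm_borel W_meas, where B = 1])
    show "conv_in_distr M W N Xm" unfolding W_def by (rule Xma_endpoint_conv)
    show "continuous_on UNIV (\<lambda>y. min 1 \<bar>G y\<bar>)"
      by (intro continuous_intros lipschitz_on_continuous_on[OF G_L])
  qed auto
  from order_tendstoD(2)[OF this K[folded G_def]]
  have "\<forall>\<^sub>F n in sequentially. trunc_mean M (\<lambda>\<omega>. G (W n \<omega>)) < e'" .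
  then have A_small: "\<forall>\<^sub>F n in sequentially. trunc_mean M (A n) \<le> e' + e'"
    using order_tendstoD(2)[OF step \<open>0 < e'\<close>] eventually_ge_at_top[of 1]
  proof eventually_elim
    case (elim n)
    note [measurable] = W_meas[OF \<open>1 \<le> n\<close>]
    have "trunc_mean M (A n) \<le> trunc_mean M (\<lambda>\<omega>. A n \<omega> - G (W n \<omega>)) + trunc_mean M (\<lambda>\<omega>. G (W n \<omega>))"
    proof (rule trunc_mean_add_le)
      show "(\<lambda>\<omega>. A n \<omega> - G (W n \<omega>)) \<in> borel_measurable M" by measurable
      show "(\<lambda>\<omega>. G (W n \<omega>)) \<in> borel_measurable M" by measurable
    qed (rule AE_I2, linarith)
    then show ?case using elim by linarith
  qed
  show ?thesis
    \<comment> \<open>The ramp starts at \<open>K\<close> and reaches 1 only at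
      \<open>K + 1\<close>, so it dominates the tail indicator from \<open>Suc K\<close> on.\<close>
    using eventually_ge_at_top[of "Suc K"]
  proof eventually_elim
    case (elim k)
    show ?case using A_small
    proof eventually_elim
      case (elim n)
      define T where "T \<omega> = (\<Sum>t=t0..n. indicator (- {- real k..real k}) (X n t \<omega> / \<beta> n) * f (X n t \<omega> / \<beta> n)) / real n" for \<omega>
      have T_le: "\<bar>T \<omega>\<bar> \<le> B * A n \<omega>" for \<omega>
      proof -
        have "\<bar>\<Sum>t=t0..n. indicator (- {- real k..real k}) (X n t \<omega> / \<beta> n) * f (X n t \<omega> / \<beta> n)\<bar>
            \<le> (\<Sum>t=t0..n. \<bar>indicator (- {- real k..real k}) (X n t \<omega> / \<beta> n) * f (X n t \<omega> / \<beta> n)\<bar>)"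
          by (rule sum_abs)
        also have "\<dots> \<le> (\<Sum>t=t0..n. B * \<psi> K (X n t \<omega> / \<beta> n))"
        proof (rule sum_mono)
          fix t
          have "indicator (- {- real k..real k}) x \<le> \<psi> K x" for x
            using \<open>Suc K \<le> k\<close> unfolding \<psi>_def indicator_def by auto
          then show "\<bar>indicator (- {- real k..real k}) (X n t \<omega> / \<beta> n) * f (X n t \<omega> / \<beta> n)\<bar> \<le> B * \<psi> K (X n t \<omega> / \<beta> n)"
            using B \<open>0 \<le> B\<close> by (subst abs_mult, subst mult.commute, intro mult_mono) auto
        qed
        also have "\<dots> \<le> (\<Sum>t=1..n. B * \<psi> K (X n t \<omega> / \<beta> n))"
          using t0_ge_1 \<open>0 \<le> B\<close> \<psi>_B by (intro sum_mono2) auto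
        finally show ?thesis
          unfolding T_def A_def by (simp add: abs_divide divide_right_mono flip: sum_distrib_left)
      qed
      \<comment> \<open>If \<open>A n\<close> is at least 1, the right integrand is at least 1;
        otherwise it is at least \<open>B * A n\<close>, which dominates \<open>T\<close>.\<close>
      have "trunc_mean M T \<le> (\<integral>\<omega>. (1 + B) * min 1 \<bar>A n \<omega>\<bar> \<partial>M)"
        unfolding trunc_mean_def
      proof (rule integral_mono')
        fix \<omega>
        have "0 \<le> A n \<omega>" unfolding A_def using \<psi>_B by (intro divide_nonneg_nonneg sum_nonneg) auto
        then show "min 1 \<bar>T \<omega>\<bar> \<le> (1 + B) * min 1 \<bar>A n \<omega>\<bar>"
          using T_le[of \<omega>] \<open>0 \<le> B\<close> by (auto simp: min_def distrib_right)
      qed (use \<open>0 \<le> B\<close> in auto)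
      also have "\<dots> \<le> (1 + B) * (e' + e')"
        using elim \<open>0 \<le> B\<close> unfolding trunc_mean_def by (simp only: integral_mult_right_zero) (rule mult_left_mono, auto)
      finally have "trunc_mean M T \<le> e" using e'_eq by simp
      then show ?case unfolding T_def[abs_def] .
    qed
  qed
qed

text \<open>Far out \<open>f\<close> is at most a small multiple of \<open>w\<close>, and the mean
  of \<open>w\<close> along the array is uniformly bounded. The weight \<open>w\<close> stands for
  the power in HL5(a) and the exponential in HL5(b) alike.\<close>

lemma tail_small:
  assumes [measurable]: "f \<in> borel_measurable borel" "w \<in> borel_measurable borel"
    and f: "f \<in> o[at_infinity](w)" and w: "\<And>x. 0 \<le> w x"
    and moment: "1 \<le> n0" "(SUP n\<in>{n0..}. SUP t\<in>{1..n}. \<integral>\<^sup>+\<omega>. ennreal (w (X n t \<omega> / \<beta> n)) \<partial>M) < \<infinity>"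
    and "0 < e"
  shows "\<forall>\<^sub>F k in sequentially. \<forall>\<^sub>F n in sequentially.
    trunc_mean M (\<lambda>\<omega>. (\<Sum>t=t0..n. indicator (- {- real k..real k}) (X n t \<omega> / \<beta> n) * f (X n t \<omega> / \<beta> n)) / real n) \<le> e"
proof -
  define C where "C = enn2real (SUP n\<in>{n0..}. SUP t\<in>{1..n}. \<integral>\<^sup>+\<omega>. ennreal (w (X n t \<omega> / \<beta> n)) \<partial>M)"
  have "0 \<le> C" by (simp add: C_def)
  have C: "(\<integral>\<^sup>+\<omega>. ennreal (w (X n t \<omega> / \<beta> n)) \<partial>M) \<le> ennreal C" if "n0 \<le> n" "t \<in> {1..n}" for n t
  proof -
    have "(\<integral>\<^sup>+\<omega>. ennreal (w (X n t \<omega> / \<beta> n)) \<partial>M) \<le> (SUP t\<in>{1..n}. \<integral>\<^sup>+\<omega>. ennreal (w (X n t \<omega> / \<beta> n)) \<partial>M)"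
      using that(2) by (rule SUP_upper)
    also have "\<dots> \<le> (SUP n\<in>{n0..}. SUP t\<in>{1..n}. \<integral>\<^sup>+\<omega>. ennreal (w (X n t \<omega> / \<beta> n)) \<partial>M)"
      by (rule SUP_upper) (use that in auto)
    also have "\<dots> = ennreal C" using moment(2) by (simp add: C_def less_top)
    finally show ?thesis .
  qed
  define e' where "e' = e / (1 + C)"
  have "0 < e'" using \<open>0 < e\<close> \<open>0 \<le> C\<close> by (simp add: e'_def)
  have e'C: "e' * C \<le> e"
  proof -
    have "e' * C \<le> (1 + C) * e'" using \<open>0 < e'\<close> by (simp add: algebra_simps)
    also have "\<dots> = e"
      unfolding e'_def times_divide_eq_right
      using \<open>0 \<le> C\<close> by (subst nonzero_mult_div_cancel_left) auto
    finally show ?thesis .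
  qed
  from landau_o.smallD[OF f \<open>0 < e'\<close>]
  obtain b where b: "\<And>x. b \<le> \<bar>x\<bar> \<Longrightarrow> \<bar>f x\<bar> \<le> e' * w x"
    using w by (auto simp: eventually_at_infinity)
  show ?thesis
    using eventually_ge_at_top[of "nat \<lceil>b\<rceil>"]
  proof eventually_elim
    case (elim k)
    then have "b \<le> real k" by (simp add: nat_le_iff ceiling_le_iff)
    show ?case using eventually_ge_at_top[of n0]
    proof eventually_elim
      case (elim n)
      then have "1 \<le> n" using moment(1) by simp
      define T where "T \<omega> = (\<Sum>t=t0..n. indicator (- {- real k..real k}) (X n t \<omega> / \<beta> n) * f (X n t \<omega> / \<beta> n)) / real n" for \<omega>
      have in_range: "t \<in> {1..n}" if "t \<in> {t0..n}" for t using that t0_ge_1 by simp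
      have comp_meas: "(\<lambda>\<omega>. h (X n t \<omega> / \<beta> n)) \<in> borel_measurable M"
        if "h \<in> borel_measurable borel" "t \<in> {t0..n}" for h :: "real \<Rightarrow> real" and t
        using X_borel[OF in_range[OF that(2)]] that(1) by measurable
      have int_w: "integrable M (\<lambda>\<omega>. w (X n t \<omega> / \<beta> n))" if "t \<in> {t0..n}" for t
        using comp_meas[OF assms(2) that] w le_less_trans[OF C[OF elim in_range[OF that]]]
        by (intro integrableI_bounded) auto
      have E_w: "expectation (\<lambda>\<omega>. w (X n t \<omega> / \<beta> n)) \<le> C" if "t \<in> {t0..n}" for t
        using C[OF elim in_range[OF that]] int_w[OF that] w \<open>0 \<le> C\<close>
        by (subst (asm) nn_integral_eq_integral) auto
      have "trunc_mean M T \<le> expectation (\<lambda>\<omega>. (\<Sum>t=t0..n. e' * w (X n t \<omega> / \<beta> n)) / real n)"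
        unfolding trunc_mean_def
      proof (rule integral_mono')
        show "integrable M (\<lambda>\<omega>. (\<Sum>t=t0..n. e' * w (X n t \<omega> / \<beta> n)) / real n)"
          by (intro integrable_divide Bochner_Integration.integrable_sum integrable_mult_right int_w)
        fix \<omega>
        show "0 \<le> (\<Sum>t=t0..n. e' * w (X n t \<omega> / \<beta> n)) / real n"
          using w \<open>0 < e'\<close> by (intro divide_nonneg_nonneg sum_nonneg) auto
        have "\<bar>\<Sum>t=t0..n. indicator (- {- real k..real k}) (X n t \<omega> / \<beta> n) * f (X n t \<omega> / \<beta> n)\<bar>
            \<le> (\<Sum>t=t0..n. \<bar>indicator (- {- real k..real k}) (X n t \<omega> / \<beta> n) * f (X n t \<omega> / \<beta> n)\<bar>)"
          by (rule sum_abs)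
        also have "\<dots> \<le> (\<Sum>t=t0..n. e' * w (X n t \<omega> / \<beta> n))"
        proof (rule sum_mono)
          fix t
          have "\<bar>indicator (- {- real k..real k}) x * f x\<bar> \<le> e' * w x" for x
            using b[of x] w[of x] \<open>b \<le> real k\<close> \<open>0 < e'\<close> by (auto simp: indicator_def)
          then show "\<bar>indicator (- {- real k..real k}) (X n t \<omega> / \<beta> n) * f (X n t \<omega> / \<beta> n)\<bar> \<le> e' * w (X n t \<omega> / \<beta> n)" .
        qed
        finally have "\<bar>T \<omega>\<bar> \<le> (\<Sum>t=t0..n. e' * w (X n t \<omega> / \<beta> n)) / real n"
          unfolding T_def by (simp add: abs_divide divide_right_mono)
        then show "min 1 \<bar>T \<omega>\<bar> \<le> (\<Sum>t=t0..n. e' * w (X n t \<omega> / \<beta> n)) / real n" by simp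
      qed
      also have "\<dots> = (\<Sum>t=t0..n. e' * expectation (\<lambda>\<omega>. w (X n t \<omega> / \<beta> n))) / real n"
        using int_w by (simp add: Bochner_Integration.integral_sum)
      also have "\<dots> \<le> (\<Sum>t=t0..n. e' * C) / real n"
        using E_w \<open>0 < e'\<close> by (intro divide_right_mono sum_mono mult_left_mono) auto
      \<comment> \<open>Counting gives \<open>Suc n - t0\<close> terms, at most \<open>n\<close>
        because \<open>t0\<close> is at least 1; truncated subtraction makes this correct also for
        \<open>t0 > n\<close>.\<close>
      also have "\<dots> = e' * C * (real (Suc n - t0) / real n)"
        unfolding sum_constant card_atLeastAtMost by (simp only: times_divide_eq_right mult.commute)
      also have "\<dots> \<le> e' * C * 1"
      proof (rule mult_left_mono)
        have "Suc n - t0 \<le> n" using t0_ge_1 by linarith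
        then have "real (Suc n - t0) \<le> real n" by (simp only: of_nat_le_iff)
        moreover have "0 < real n" using \<open>1 \<le> n\<close> by simp
        ultimately show "real (Suc n - t0) / real n \<le> 1" using divide_le_eq_1_pos by blast
      qed (use \<open>0 < e'\<close> \<open>0 \<le> C\<close> in simp)
      finally have "trunc_mean M T \<le> e" using e'C by simp
      then show ?case unfolding T_def[abs_def] .
    qed
  qed
qed

end

section \<open>Growth comparison, completions and Borel versions\<close>

lemma abs_powr_smallo:
  assumes "l' < l"
  shows "(\<lambda>x::real. \<bar>x\<bar> powr l') \<in> o[at_infinity](\<lambda>x. \<bar>x\<bar> powr l)"
  using powr_smallo_iff[OF filterlim_norm_at_top[where 'a = real] trivial_limit_at_infinity, of l' l] assms
  by simp

text \<open>The exponentials are powers of \<open>exp \<bar>x\<bar>\<close>, which tends to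
  infinity, so the comparison of powers applies.\<close>

lemma exp_abs_smallo:
  assumes "l' < l"
  shows "(\<lambda>x::real. exp (l' * \<bar>x\<bar>)) \<in> o[at_infinity](\<lambda>x. exp (l * \<bar>x\<bar>))"
proof -
  have "filterlim (\<lambda>x::real. exp \<bar>x\<bar>) at_top at_infinity"
    using filterlim_compose[OF exp_at_top filterlim_norm_at_top[where 'a = real]] by simp
  from powr_smallo_iff[OF this trivial_limit_at_infinity, of l' l] assms show ?thesis
    by (simp add: powr_def)
qed

text \<open>An almost everywhere modification changes preimages by null events only, and these
  belong to the completion.\<close>

lemma borel_measurable_completion_AE:
  assumes U: "U \<in> borel_measurable M" and eq: "AE \<omega> in M. U \<omega> = V \<omega>"
  shows "V \<in> borel_measurable (completion M)"
proof (rule measurableI)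
  fix A :: "'b set" assume A: "A \<in> sets borel"
  have "V -` A \<inter> space (completion M) \<in> sets (completion M)"
  proof (rule completion.in_sets_AE)
    show "U -` A \<inter> space M \<in> sets (completion M)"
      using measurable_sets[OF U A] by (rule sets_completionI_sets)
    show "AE \<omega> in completion M. \<omega> \<in> U -` A \<inter> space M \<longleftrightarrow> \<omega> \<in> V -` A \<inter> space (completion M)"
      using AE_completion[OF eq] by eventually_elim simp
  qed simp
  then show "V -` A \<inter> space (completion M) \<in> sets (completion M)" .
qed simp

lemma distr_completion_AE:
  assumes [measurable]: "U \<in> borel_measurable M" and eq: "AE \<omega> in M. U \<omega> = V \<omega>"
  shows "distr (completion M) borel V = distr M borel U"
proof -
  have "distr (completion M) borel V = distr (completion M) borel U"
    using borel_measurable_completion_AE[OF assms] AE_completion[OF eq]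
    by (intro distr_cong_AE) (auto intro: measurable_completion elim: eventually_mono)
  then show ?thesis by (simp add: distr_completion)
qed

text \<open>The exceptional set of \<open>P\<close> may fail to be Borel; it is enclosed in a Borel
  null set, for which the affine rule is available.\<close>

lemma AE_lborel_affine:
  fixes P :: "real \<Rightarrow> bool"
  assumes "AE x in lborel. P x" "c \<noteq> 0"
  shows "AE x in lborel. P (t + c * x)"
proof -
  obtain A where A: "{x. \<not> P x} \<subseteq> A" "emeasure lborel A = 0" and [measurable]: "A \<in> sets borel"
    using AE_E[OF assms(1)] by auto
  have "AE x in lborel. x \<notin> A" using A by (intro AE_not_in) (simp add: null_sets_def)
  then have "AE x in lborel. t + c * x \<notin> A"
    by (rule AE_borel_affine[OF assms(2), rotated]) measurable
  then show ?thesis by eventually_elim (use A in auto)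
qed

text \<open>A variable with a density hits Lebesgue null sets with probability 0. Again a Borel null
  superset of the exceptional set is used.\<close>

lemma distributed_lborel_AE:
  fixes Y :: "'a \<Rightarrow> real"
  assumes D: "distributed M lborel Y D" and P: "AE x in lborel. P x"
  shows "AE \<omega> in M. P (Y \<omega>)"
proof -
  obtain A where A: "{x. \<not> P x} \<subseteq> A" "emeasure lborel A = 0" and A_borel: "A \<in> sets lborel"
    using AE_E[OF P] by auto
  have [measurable]: "Y \<in> measurable M lborel" using D by (simp add: distributed_def)
  have "emeasure M (Y -` A \<inter> space M) = (\<integral>\<^sup>+x. D x * indicator A x \<partial>lborel)"
    by (rule distributed_emeasure[OF D A_borel])
  also have "\<dots> = (\<integral>\<^sup>+(x::real). 0 \<partial>lborel)"
  proof (rule nn_integral_cong_AE)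
    have "AE x in lborel. x \<notin> A" using A A_borel by (intro AE_not_in) (simp add: null_sets_def)
    then show "AE x in lborel. D x * indicator A x = 0" by eventually_elim simp
  qed
  finally have "Y -` A \<inter> space M \<in> null_sets M"
    using A_borel by (simp add: null_sets_def)
  then show ?thesis by (rule AE_I') (use A in auto)
qed

text \<open>Setting a Borel version to 0 on a Borel null set that contains all disagreements makes
  the domination hold at every point. Boundedness, integrability and growth of \<open>f\<close> are
  then inherited, while both functions give the same averages almost surely.\<close>

lemma lebesgue_borel_minorant:
  fixes f :: "real \<Rightarrow> real"
  assumes "f \<in> borel_measurable lebesgue"
  shows "\<exists>f'\<in>borel_measurable borel. (\<forall>x. \<bar>f' x\<bar> \<le> \<bar>f x\<bar>) \<and> (AE x in lborel. f' x = f x)"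
proof -
  obtain h where h: "h \<in> borel_measurable lborel" and eq: "AE x in lborel. f x = h x"
    using completion_ex_borel_measurable_real[OF assms] by blast
  obtain A where A: "{x. f x \<noteq> h x} \<subseteq> A" "emeasure lborel A = 0" and A_borel[measurable]: "A \<in> sets borel"
    using AE_E[OF eq] by auto
  have [measurable]: "h \<in> borel_measurable borel" using h by simp
  have f_eq: "f x = h x" if "x \<notin> A" for x using A that by blast
  show ?thesis
  proof (intro bexI[of _ "\<lambda>x. if x \<in> A then 0 else h x"] conjI allI)
    show "(\<lambda>x. if x \<in> A then 0 else h x) \<in> borel_measurable borel" by measurable
    show "\<bar>if x \<in> A then 0 else h x\<bar> \<le> \<bar>f x\<bar>" for x using f_eq by simp
    have "AE x in lborel. x \<notin> A" using A by (intro AE_not_in) (simp add: null_sets_def)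
    then show "AE x in lborel. (if x \<in> A then 0 else h x) = f x" by eventually_elim (simp add: f_eq)
  qed
qed

lemma locally_integrable_cbox:
  assumes "locally_integrable f"
  shows "integrable lebesgue (\<lambda>x. indicator {- k..k} x * f x)"
  using assms unfolding locally_integrable_def set_integrable_def by auto

lemma locally_integrable_measurable:
  assumes "locally_integrable f"
  shows "f \<in> borel_measurable lebesgue"
proof (rule borel_measurable_LIMSEQ_real)
  show "(\<lambda>x. indicator {- real k..real k} x * f x) \<in> borel_measurable lebesgue" for k
    using locally_integrable_cbox[OF assms] by (rule borel_measurable_integrable)
  show "(\<lambda>k. indicator {- real k..real k} x * f x) \<longlonglongrightarrow> f x" for x
  proof (rule tendsto_eventually)
    show "\<forall>\<^sub>F k in sequentially. indicator {- real k..real k} x * f x = f x"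
      using eventually_ge_at_top[of "nat \<lceil>\<bar>x\<bar>\<rceil>"]
    proof eventually_elim
      case (elim k)
      then have "\<bar>x\<bar> \<le> real k" by (simp add: nat_le_iff ceiling_le_iff)
      then show ?case by (auto simp: indicator_def)
    qed
  qed
qed

lemma conv_in_distr_cong:
  assumes "\<And>n. distr M' borel (U' n) = distr M borel (U n)" "distr N' borel Z' = distr N borel Z"
  shows "conv_in_distr M' U' N' Z' \<longleftrightarrow> conv_in_distr M U N Z"
  using assms by (simp add: conv_in_distr_def)

theorem theorem3p1:
  fixes M :: "'a measure" and F :: "int \<Rightarrow> 'a measure"
    and \<beta> :: "nat \<Rightarrow> real" and X Xpa Xma R :: "nat \<Rightarrow> nat \<Rightarrow> 'a \<Rightarrow> real"
    and N :: "'b measure" and Xp Xm :: "'b \<Rightarrow> real" and \<Phi> :: "real \<Rightarrow> real"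
    and t0 :: nat and f :: "real \<Rightarrow> real"
  assumes "prob_space M" and "prob_space N"
    and "HL0 M F \<beta> X"
    and "HL1 M F \<beta> X Xpa Xma R"
    and "HL2 M F \<beta> Xpa Xma N Xp Xm \<Phi>"
    and "HL3 M \<beta> X t0"
    and "HL4 M F \<beta> X"
    and "HL6 \<beta> t0"
    and "locally_integrable f"
    and "bounded (range f) \<or>
      ((\<exists>Y :: real set.
          (\<forall>y\<in>Y. (\<integral>\<^sup>+x. ennreal (\<bar>f (x + y)\<bar> * \<Phi> x) \<partial>lebesgue) < \<infinity>) \<and>
          (AE \<omega> in N. Xm \<omega> \<in> Y)) \<and>
       conv_in_prob (completion M)
         (\<lambda>n \<omega>. (\<Sum>t=1..<t0. f (X n t \<omega> / \<beta> n)) / real n) (\<lambda>_. 0) \<and>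
       (\<exists>l l'. 0 < l' \<and> l' < l \<and>
          (f \<in> O[at_infinity](\<lambda>x. \<bar>x\<bar> powr l') \<and> HL5a M \<beta> X l \<or>
           f \<in> O[at_infinity](\<lambda>x. exp (l' * \<bar>x\<bar>)) \<and> HL5b M \<beta> X l)))"
  shows "conv_in_distr (completion M)
           (\<lambda>n \<omega>. (\<Sum>t=1..n. f (X n t \<omega> / \<beta> n)) / real n)
           N (\<lambda>\<omega>. \<integral>x. f (x + Xm \<omega>) * \<Phi> x \<partial>lebesgue)"
proof -
  interpret hl_array_density M F \<beta> X Xpa Xma R N Xp Xm \<Phi> t0
    by (intro hl_array_density.intro hl_array.intro hl_array_density_axioms.intro assms)
  note alternatives = assms(10)
  have f_leb[measurable]: "f \<in> borel_measurable lebesgue"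
    by (rule locally_integrable_measurable) fact
  obtain f' where f'[measurable]: "f' \<in> borel_measurable borel"
    and f'_le: "\<And>x. \<bar>f' x\<bar> \<le> \<bar>f x\<bar>" and f'_eq: "AE x in lborel. f' x = f x"
    using lebesgue_borel_minorant[OF f_leb] by blast
  have f'_leb: "(\<lambda>x. f' (x + y) * \<Phi> x) \<in> borel_measurable lborel" for y by measurable
  have X_eq: "AE \<omega> in M. f' (X n t \<omega> / \<beta> n) = f (X n t \<omega> / \<beta> n)" if "t \<in> {1..n}" for n t
  proof -
    have "1 \<le> n" "1 \<le> t" using that by auto
    obtain D where "\<forall>n\<ge>1. \<forall>t\<in>{1..n}. distributed M lborel (\<lambda>\<omega>. X n t \<omega> / \<beta> t) (D n t)"
      using HL3 unfolding HL3_def by (elim exE conjE)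
    then have "distributed M lborel (\<lambda>\<omega>. X n t \<omega> / \<beta> t) (D n t)"
      using \<open>1 \<le> n\<close> that by simp
    \<comment> \<open>\<open>X n t / \<beta> n\<close> is \<open>\<beta> t / \<beta> n\<close> times
      the variable \<open>X n t / \<beta> t\<close>, which is the one with a density.\<close>
    moreover have "AE x in lborel. f' (0 + \<beta> t / \<beta> n * x) = f (0 + \<beta> t / \<beta> n * x)"
      using beta_pos[OF \<open>1 \<le> n\<close>] beta_pos[OF \<open>1 \<le> t\<close>] by (intro AE_lborel_affine[OF f'_eq]) simp
    ultimately have "AE \<omega> in M. f' (0 + \<beta> t / \<beta> n * (X n t \<omega> / \<beta> t)) = f (0 + \<beta> t / \<beta> n * (X n t \<omega> / \<beta> t))"
      by (rule distributed_lborel_AE)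
    then show ?thesis using beta_pos[OF \<open>1 \<le> t\<close>] by simp
  qed
  have sum_eq: "AE \<omega> in M. (\<Sum>t\<in>T. f' (X n t \<omega> / \<beta> n)) / real n = (\<Sum>t\<in>T. f (X n t \<omega> / \<beta> n)) / real n"
    if "T \<subseteq> {1..n}" for T n
  proof -
    have "finite T" using that by (rule finite_subset) simp
    then have "AE \<omega> in M. \<forall>t\<in>T. f' (X n t \<omega> / \<beta> n) = f (X n t \<omega> / \<beta> n)"
      using that X_eq by (intro AE_finite_allI) auto
    then show ?thesis by eventually_elim simp
  qed
  have sum_meas: "(\<lambda>\<omega>. (\<Sum>t\<in>T. f' (X n t \<omega> / \<beta> n)) / real n) \<in> borel_measurable M" if "T \<subseteq> {1..n}" for T n
    using that by (intro borel_measurable_divide borel_measurable_sum measurable_compose[OF _ f'] X_borel) auto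
  have limit_eq: "(\<integral>x. f (x + y) * \<Phi> x \<partial>lebesgue) = shift_mean \<Phi> f' y" for y
  proof -
    have eq: "AE x in lborel. f' (x + y) * \<Phi> x = f (x + y) * \<Phi> x"
      using AE_lborel_affine[OF f'_eq one_neq_zero, of y] by eventually_elim (simp add: add.commute)
    have "(\<integral>x. f (x + y) * \<Phi> x \<partial>lebesgue) = (\<integral>x. f' (x + y) * \<Phi> x \<partial>lebesgue)"
    proof (rule integral_cong_AE)
      show "(\<lambda>x. f (x + y) * \<Phi> x) \<in> borel_measurable lebesgue"
        by (rule borel_measurable_completion_AE[OF f'_leb eq])
      show "(\<lambda>x. f' (x + y) * \<Phi> x) \<in> borel_measurable lebesgue"
        by (rule measurable_completion[OF f'_leb])
      show "AE x in lebesgue. f (x + y) * \<Phi> x = f' (x + y) * \<Phi> x"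
        using AE_completion[OF eq] by eventually_elim (rule sym)
    qed
    also have "\<dots> = shift_mean \<Phi> f' y"
      unfolding shift_mean_def by (rule integral_completion[OF f'_leb])
    finally show ?thesis .
  qed
  have loc: "integrable lborel (\<lambda>x. indicator {- real k..real k} x * f' x)" for k
  proof -
    have "integrable lebesgue (\<lambda>x. indicator {- real k..real k} x * f' x)"
    proof (rule Bochner_Integration.integrable_bound[OF locally_integrable_cbox[OF assms(9), of "real k"]])
      show "(\<lambda>x. indicator {- real k..real k} x * f' x) \<in> borel_measurable lebesgue"
        by (rule measurable_completion) measurable
    qed (use f'_le in \<open>auto simp: indicator_def\<close>)
    then show ?thesis by (subst (asm) integrable_completion) auto
  qed
  have f'_bounded: "\<bar>f' x\<bar> \<le> B" if "\<And>x. \<bar>f x\<bar> \<le> B" for B x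
    using f'_le[of x] that[of x] by linarith
  have bounded_cases: "bounded (range f) \<longleftrightarrow> (\<exists>B. \<forall>x. \<bar>f x\<bar> \<le> B)"
    by (auto simp: bounded_iff)
  have head: "(\<lambda>n. trunc_mean M (\<lambda>\<omega>. (\<Sum>t=1..<t0. f' (X n t \<omega> / \<beta> n)) / real n)) \<longlonglongrightarrow> 0"
  proof (cases "bounded (range f)")
    case True
    then obtain B where B: "\<And>x. \<bar>f x\<bar> \<le> B" unfolding bounded_cases by blast
    have "0 \<le> B" using B[of 0] by linarith
    show ?thesis
    proof (rule tendsto_sandwich[of "\<lambda>_. 0"])
      show "(\<lambda>n. real t0 * B * (1 / real n)) \<longlonglongrightarrow> 0"
        by (intro tendsto_mult_right_zero lim_1_over_n)
      show "\<forall>\<^sub>F n in sequentially. trunc_mean M (\<lambda>\<omega>. (\<Sum>t=1..<t0. f' (X n t \<omega> / \<beta> n)) / real n)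
          \<le> real t0 * B * (1 / real n)"
        by (intro always_eventually allI trunc_mean_head_le) (auto intro: f'_bounded[OF B])
    qed (auto simp: trunc_mean_nonneg)
  next
    case False
    then have cp: "conv_in_prob (completion M)
         (\<lambda>n \<omega>. (\<Sum>t=1..<t0. f (X n t \<omega> / \<beta> n)) / real n) (\<lambda>_. 0)"
      using alternatives by blast
    interpret C: prob_space "completion M"
      by (rule prob_spaceI) (simp add: emeasure_space_1)
    have head_sub: "{1..<t0} \<subseteq> {1..n}" if "t0 \<le> n" for n using that by auto
    note head_meas = borel_measurable_completion_AE[OF sum_meas sum_eq, OF head_sub head_sub]
    \<comment> \<open>Assumption (ii) concerns \<open>f\<close> and therefore lives on the
      completion; replacing \<open>f\<close> by \<open>f'\<close> afterwards returns to
      \<open>M\<close>.\<close>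
    have "(\<lambda>n. trunc_mean (completion M) (\<lambda>\<omega>. (\<Sum>t=1..<t0. f (X n t \<omega> / \<beta> n)) / real n - 0)) \<longlonglongrightarrow> 0"
      by (rule C.conv_in_prob_trunc_mean[OF cp head_meas]) auto
    moreover have "\<forall>\<^sub>F n in sequentially. trunc_mean (completion M) (\<lambda>\<omega>. (\<Sum>t=1..<t0. f (X n t \<omega> / \<beta> n)) / real n - 0)
        = trunc_mean M (\<lambda>\<omega>. (\<Sum>t=1..<t0. f' (X n t \<omega> / \<beta> n)) / real n)"
      using eventually_ge_at_top[of t0]
    proof eventually_elim
      case (elim n)
      note [measurable] = sum_meas[OF head_sub[OF elim]]
      have "trunc_mean (completion M) (\<lambda>\<omega>. (\<Sum>t=1..<t0. f (X n t \<omega> / \<beta> n)) / real n - 0)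
          = trunc_mean (completion M) (\<lambda>\<omega>. (\<Sum>t=1..<t0. f' (X n t \<omega> / \<beta> n)) / real n)"
        unfolding trunc_mean_def
      proof (rule integral_cong_AE)
        have [measurable]: "(\<lambda>\<omega>. (\<Sum>t=1..<t0. f (X n t \<omega> / \<beta> n)) / real n) \<in> borel_measurable (completion M)"
          by (rule head_meas) fact+
        show "(\<lambda>\<omega>. min 1 \<bar>(\<Sum>t=1..<t0. f (X n t \<omega> / \<beta> n)) / real n - 0\<bar>) \<in> borel_measurable (completion M)"
          by measurable
        show "(\<lambda>\<omega>. min 1 \<bar>(\<Sum>t=1..<t0. f' (X n t \<omega> / \<beta> n)) / real n\<bar>) \<in> borel_measurable (completion M)"
          by (rule measurable_completion) measurable
        show "AE \<omega> in completion M. min 1 \<bar>(\<Sum>t=1..<t0. f (X n t \<omega> / \<beta> n)) / real n - 0\<bar>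
            = min 1 \<bar>(\<Sum>t=1..<t0. f' (X n t \<omega> / \<beta> n)) / real n\<bar>"
          using AE_completion[OF sum_eq[OF head_sub[OF elim]]] by eventually_elim (simp only: diff_zero)
      qed
      moreover have "(\<lambda>\<omega>. min 1 \<bar>(\<Sum>t=1..<t0. f' (X n t \<omega> / \<beta> n)) / real n\<bar>) \<in> borel_measurable M"
        by measurable
      from integral_completion[OF this]
      have "trunc_mean (completion M) (\<lambda>\<omega>. (\<Sum>t=1..<t0. f' (X n t \<omega> / \<beta> n)) / real n)
          = trunc_mean M (\<lambda>\<omega>. (\<Sum>t=1..<t0. f' (X n t \<omega> / \<beta> n)) / real n)"
        unfolding trunc_mean_def .
      ultimately show ?case by (rule trans)
    qed
    ultimately show ?thesis by (rule Lim_transform_eventually)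
  qed
  have tail: "\<forall>\<^sub>F k in sequentially. \<forall>\<^sub>F n in sequentially.
      trunc_mean M (\<lambda>\<omega>. (\<Sum>t=t0..n. indicator (- {- real k..real k}) (X n t \<omega> / \<beta> n) * f' (X n t \<omega> / \<beta> n)) / real n) \<le> e"
    if "0 < e" for e
  proof (cases "bounded (range f)")
    case True
    then obtain B where B: "\<And>x. \<bar>f x\<bar> \<le> B" unfolding bounded_cases by blast
    show ?thesis by (rule tail_bounded[OF f' f'_bounded[OF B] that])
  next
    case False
    then obtain l l' where "l' < l"
      and growth: "f \<in> O[at_infinity](\<lambda>x. \<bar>x\<bar> powr l') \<and> HL5a M \<beta> X l \<or>
           f \<in> O[at_infinity](\<lambda>x. exp (l' * \<bar>x\<bar>)) \<and> HL5b M \<beta> X l"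
      using alternatives by blast
    \<comment> \<open>Domination at every point is used here: almost everywhere equality alone gives
      no control of \<open>f'\<close> at infinity.\<close>
    have f'_f: "f' \<in> O[at_infinity](f)"
      by (rule bigoI[of _ 1]) (simp add: f'_le)
    from growth show ?thesis
    proof (elim disjE conjE)
      assume "f \<in> O[at_infinity](\<lambda>x. \<bar>x\<bar> powr l')" "HL5a M \<beta> X l"
      then obtain n0 where small: "f' \<in> o[at_infinity](\<lambda>x. \<bar>x\<bar> powr l)" and n0: "1 \<le> n0"
        and moment: "(SUP n\<in>{n0..}. SUP t\<in>{1..n}. \<integral>\<^sup>+\<omega>. ennreal (\<bar>X n t \<omega> / \<beta> n\<bar> powr l) \<partial>M) < \<infinity>"
        using landau_o.big_small_trans[OF landau_o.big_trans[OF f'_f] abs_powr_smallo[OF \<open>l' < l\<close>]]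
        unfolding HL5a_def by blast
      show ?thesis by (rule tail_small[where w = "\<lambda>x. \<bar>x\<bar> powr l", OF f' _ small _ n0 moment that]) auto
    next
      assume "f \<in> O[at_infinity](\<lambda>x. exp (l' * \<bar>x\<bar>))" "HL5b M \<beta> X l"
      then obtain n0 where small: "f' \<in> o[at_infinity](\<lambda>x. exp (l * \<bar>x\<bar>))" and n0: "1 \<le> n0"
        and moment: "(SUP n\<in>{n0..}. SUP t\<in>{1..n}. \<integral>\<^sup>+\<omega>. ennreal (exp (l * \<bar>X n t \<omega> / \<beta> n\<bar>)) \<partial>M) < \<infinity>"
        using landau_o.big_small_trans[OF landau_o.big_trans[OF f'_f] exp_abs_smallo[OF \<open>l' < l\<close>]]
        unfolding HL5b_def by blast
      show ?thesis by (rule tail_small[where w = "\<lambda>x. exp (l * \<bar>x\<bar>)", OF f' _ small _ n0 moment that]) auto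
    qed
  qed
  have lim: "AE \<omega> in N. integrable lborel (\<lambda>x. f' (x + Xm \<omega>) * \<Phi> x)"
  proof (cases "bounded (range f)")
    case True
    then obtain B where B: "\<And>x. \<bar>f x\<bar> \<le> B" unfolding bounded_cases by blast
    show ?thesis
      by (intro AE_I2 integrable_mult_bounded[of _ B]) (auto intro: f'_bounded[OF B])
  next
    case False
    then obtain Y where Y: "\<And>y. y \<in> Y \<Longrightarrow> (\<integral>\<^sup>+x. ennreal (\<bar>f (x + y)\<bar> * \<Phi> x) \<partial>lebesgue) < \<infinity>"
      and "AE \<omega> in N. Xm \<omega> \<in> Y"
      using alternatives by blast
    from this(2) show ?thesis
    proof eventually_elim
      case (elim \<omega>)
      \<comment> \<open>\<open>f\<close> is not Borel, but \<open>nn_integral\<close> is a supremum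
        over simple functions below, so it is monotone for arbitrary functions and takes the same
        value over \<open>lborel\<close> and its completion.\<close>
      have "(\<integral>\<^sup>+x. ennreal (norm (f' (x + Xm \<omega>) * \<Phi> x)) \<partial>lborel) \<le> (\<integral>\<^sup>+x. ennreal (\<bar>f (x + Xm \<omega>)\<bar> * \<Phi> x) \<partial>lborel)"
        using f'_le Phi_nonneg by (intro nn_integral_mono ennreal_leI) (simp add: abs_mult mult_right_mono)
      also have "\<dots> < \<infinity>" using Y[OF elim] by (simp add: nn_integral_completion)
      finally show ?case by (intro integrableI_bounded) auto
    qed
  qed
  have "conv_in_distr M (\<lambda>n \<omega>. (\<Sum>t=1..n. f' (X n t \<omega> / \<beta> n)) / real n) N (\<lambda>\<omega>. shift_mean \<Phi> f' (Xm \<omega>))"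
    by (rule average_conv_in_distr[OF f' loc head tail lim])
  then show ?thesis
    \<comment> \<open>The averages of \<open>f\<close> on the completion and of \<open>f'\<close> on
      \<open>M\<close> have the same law, and \<open>limit_eq\<close> identifies the limit variables
      pointwise.\<close>
    by (subst conv_in_distr_cong[OF distr_completion_AE[OF sum_meas sum_eq]]) (simp_all add: limit_eq)
qed

end
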